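(* Let $G$ be a connected 4-regular graph and let $v$ and $w$ be vertices of $G$. Then \[ c_2^{(2)}(G - v) = c_2^{(2)}(G - w). \]
   Context: For a graph $H$, $H-v$ denotes the graph obtained by deleting the vertex $v$ and all edges incident to it. For a connected graph $H$ with at least $3$ vertices, assign a variable $\alpha_e$ to each edge $e$ and define the Kirchhoff polynomial $\Psi_H=\sum_{T}\prod_{e\notin T}\alpha_e$, the sum running over all spanning trees $T$ of $H$. For a prime $p$, let $[\Psi_H]_p$ be the number of zeros of $\Psi_H$ in $\mathbb{F}_p^{|E(H)|}$; this number is divisible by $p^2$, and the $c_2$-invariant is $c_2^{(p)}(H)\equiv [\Psi_H]_p/p^2 \pmod p$, viewed as an element of $\mathbb{Z}/p\mathbb{Z}$. *)

theory Defs
  imports "HOL-Library.FuncSet" "HOL-Number_Theory.Cong"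
begin

text \<open>
  Graphs are finite and undirected; parallel edges are allowed, self-loops are not
  (every edge has exactly two endpoints).
\<close>

record ('v, 'e) mgraph =
  vertices :: "'v set"
  edges :: "'e set"
  ends :: "'e \<Rightarrow> 'v set"

definition multigraph :: "('v, 'e) mgraph \<Rightarrow> bool" where
  "multigraph G \<longleftrightarrow> finite (vertices G) \<and> finite (edges G) \<and>
     (\<forall>e\<in>edges G. ends G e \<subseteq> vertices G \<and> card (ends G e) = 2)"

definition vertex_degree :: "('v, 'e) mgraph \<Rightarrow> 'v \<Rightarrow> nat" where
  "vertex_degree G v = card {e \<in> edges G. v \<in> ends G e}"

definition regular_graph :: "nat \<Rightarrow> ('v, 'e) mgraph \<Rightarrow> bool" where
  "regular_graph d G \<longleftrightarrow> (\<forall>v\<in>vertices G. vertex_degree G v = d)"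

definition adjacency :: "('v, 'e) mgraph \<Rightarrow> ('v \<times> 'v) set" where
  "adjacency G = {(u, v). \<exists>e\<in>edges G. ends G e = {u, v}}"

definition connected_graph :: "('v, 'e) mgraph \<Rightarrow> bool" where
  "connected_graph G \<longleftrightarrow> vertices G \<noteq> {} \<and>
     (\<forall>u\<in>vertices G. \<forall>v\<in>vertices G. (u, v) \<in> (adjacency G)\<^sup>*)"

definition delete_vertex :: "('v, 'e) mgraph \<Rightarrow> 'v \<Rightarrow> ('v, 'e) mgraph" where
  "delete_vertex G v =
     \<lparr>vertices = vertices G - {v}, edges = {e \<in> edges G. v \<notin> ends G e}, ends = ends G\<rparr>"

text \<open>
  The edge \<open>es ! i\<close> joins \<open>vs ! i\<close> to its cyclic successor; two parallel edges form
  a cycle of length 2.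
\<close>

definition is_cycle :: "('v, 'e) mgraph \<Rightarrow> 'v list \<Rightarrow> 'e list \<Rightarrow> bool" where
  "is_cycle G vs es \<longleftrightarrow>
     length vs = length es \<and> 2 \<le> length es \<and> distinct vs \<and> distinct es \<and>
     set es \<subseteq> edges G \<and>
     (\<forall>i<length es. ends G (es ! i) = {vs ! i, vs ! (Suc i mod length vs)})"

definition is_tree :: "('v, 'e) mgraph \<Rightarrow> bool" where
  "is_tree G \<longleftrightarrow> connected_graph G \<and> (\<nexists>vs es. is_cycle G vs es)"

text \<open>A spanning tree is identified with its edge set.\<close>

definition spanning_trees :: "('v, 'e) mgraph \<Rightarrow> 'e set set" where
  "spanning_trees G = {T. T \<subseteq> edges G \<and> is_tree (G\<lparr>edges := T\<rparr>)}"

text \<open>The Kirchhoff polynomial, given by its evaluation at a point \<open>\<alpha>\<close>.\<close>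

definition kirchhoff :: "('v, 'e) mgraph \<Rightarrow> ('e \<Rightarrow> 'a::comm_ring_1) \<Rightarrow> 'a" where
  "kirchhoff G \<alpha> = (\<Sum>T\<in>spanning_trees G. \<Prod>e\<in>edges G - T. \<alpha> e)"

text \<open>The elements of the prime field are represented by the residues \<open>0, \<dots>, p - 1\<close>.\<close>

definition kirchhoff_zeros :: "nat \<Rightarrow> ('v, 'e) mgraph \<Rightarrow> ('e \<Rightarrow> int) set" where
  "kirchhoff_zeros p G =
     {\<alpha> \<in> edges G \<rightarrow>\<^sub>E {0..<int p}. [kirchhoff G \<alpha> = 0] (mod int p)}"

text \<open>
  The class in \<open>\<int>/p\<int>\<close> is given by its representative in \<open>{0..<p}\<close>. For connected graphs
  with at least 3 vertices the division by \<open>p\<^sup>2\<close> is exact. A disconnected graph has no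
  spanning tree, so its polynomial is 0 and all points are zeros.
\<close>

definition c2_invariant :: "nat \<Rightarrow> ('v, 'e) mgraph \<Rightarrow> nat" where
  "c2_invariant p G = (card (kirchhoff_zeros p G) div p\<^sup>2) mod p"

end

theory Submission
  imports Defs
begin

text \<open>
  For a vertex \<open>v\<close> of a 4-regular graph let \<open>P(v)\<close> be the number of ordered partitions of the edges of
  \<open>G - v\<close> into two spanning trees.

  First, \<open>P(v)\<close> does not depend on \<open>v\<close>. If \<open>x\<close> is a further vertex, then \<open>P(v)\<close> is the sum of the
  corresponding numbers for the three graphs in which \<open>x\<close> is removed and its four half-edges are joined
  in pairs (the recursion of the Martin polynomial). This reduces the claim to graphs with the two
  vertices \<open>v\<close> and \<open>w\<close>; loops appear on the way and have to be admitted.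

  Second, if \<open>G\<close> has at least 5 vertices, then the number of zeros over the field with two elements is
  congruent to \<open>P(v)\<close> modulo 8. At a vertex of degree 3 in \<open>G - v\<close>, eliminate the three variables of its
  edges by means of Dodgson's identity: the number of zeros is 4 times a sum of values of a polynomial,
  hence, modulo 8, it is 4 times the coefficient of the product of all variables, and this coefficient
  counts partitions of the remaining edges into a spanning tree and a spanning 2-forest. If there is no
  such vertex, then \<open>v\<close> has two neighbours of degree 2 in \<open>G - v\<close>, and both numbers are divisible by 8.

  Graphs with 4 vertices may violate the congruence, and graphs with at most 3 vertices have fewer than 4
  zeros; both are treated directly.
\<close>

section \<open>Connectivity and rooted forests\<close>

text \<open>The count is needed modulo 8 because \<open>c2_invariant 2\<close> is the parity of its
  quotient by 4. A sum over all points over the field with two elements is, modulo 2, the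
  coefficient of the product of all variables in the reduced polynomial. For a product of two
  spanning forest polynomials this coefficient counts pairs of disjoint edge sets, and the edge
  count makes such pairs complementary; this is how partitions of the edges enter. The zero counts
  at \<open>v\<close> and at \<open>w\<close> are not compared directly. Splitting a vertex can
  produce loops and disconnected graphs, so the recursion is carried out for the integer P(v), where
  it holds exactly and not only modulo 8. The elimination also leaves sums of single forest
  polynomials. They are even unless the empty edge set is a forest of the required kind. For
  2-forests this can happen when only two vertices are left besides \<open>v\<close> and its
  neighbour, which is the origin of the exception at 4 vertices.\<close>

definition link :: "'v set set \<Rightarrow> ('v \<times> 'v) set" where
  "link R = {(u, w). {u, w} \<in> R}"

definition conn :: "'v set set \<Rightarrow> 'v \<Rightarrow> 'v \<Rightarrow> bool" where
  "conn R u w \<longleftrightarrow> (u, w) \<in> (link R)\<^sup>*"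

lemma conn_refl [simp]: "conn R u u"
  by (simp add: conn_def)

lemma conn_trans: "conn R u w \<Longrightarrow> conn R w z \<Longrightarrow> conn R u z"
  unfolding conn_def by (rule rtrancl_trans)

lemma conn_sym: "conn R u w \<Longrightarrow> conn R w u"
proof -
  have "sym (link R)" by (auto simp: sym_def link_def insert_commute)
  then show "conn R u w \<Longrightarrow> conn R w u"
    unfolding conn_def by (meson sym_rtrancl symD)
qed

lemma conn_commute: "conn R u w \<longleftrightarrow> conn R w u"
  using conn_sym by metis

lemma conn_edge: "{u, w} \<in> R \<Longrightarrow> conn R u w"
  unfolding conn_def link_def by auto

lemma conn_mono: "R \<subseteq> R' \<Longrightarrow> conn R u w \<Longrightarrow> conn R' u w"
  unfolding conn_def by (rule rtrancl_mono[THEN subsetD]) (auto simp: link_def)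

lemma conn_insert:
  "conn (insert {p, q} R) u w \<longleftrightarrow>
     conn R u w \<or> conn R u p \<and> conn R q w \<or> conn R u q \<and> conn R p w"
  (is "?L \<longleftrightarrow> ?R w")
proof
  assume ?L
  then have "(u, w) \<in> (link (insert {p, q} R))\<^sup>*" by (simp add: conn_def)
  then show "?R w"
  proof (induction rule: rtrancl_induct)
    case base
    then show ?case by simp
  next
    case (step y z)
    have "{y, z} \<in> R \<or> y = p \<and> z = q \<or> y = q \<and> z = p"
      using step(2) by (auto simp: link_def doubleton_eq_iff)
    moreover have "conn R y z" if "{y, z} \<in> R" using that by (rule conn_edge)
    ultimately show ?case using step(3) conn_trans conn_refl by metis
  qed
next
  assume "?R w"
  moreover have "conn (insert {p, q} R) p q" "conn (insert {p, q} R) q p"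
    by (auto intro!: conn_edge simp: insert_commute)
  moreover have "conn R a b \<Longrightarrow> conn (insert {p, q} R) a b" for a b
    by (rule conn_mono[rotated]) auto
  ultimately show ?L by (meson conn_trans)
qed

lemma conn_isolated:
  assumes "x \<notin> \<Union>R"
  shows "conn R x u \<longleftrightarrow> u = x" "conn R u x \<longleftrightarrow> u = x"
proof -
  have "u = x" if "(x, u) \<in> (link R)\<^sup>*" for u
    using that by (induction rule: rtrancl_induct) (use assms in \<open>auto simp: link_def\<close>)
  then show "conn R x u \<longleftrightarrow> u = x" by (auto simp: conn_def)
  then show "conn R u x \<longleftrightarrow> u = x" by (metis conn_commute)
qed

lemma conn_closed:
  assumes "conn R u w" "u \<in> U" "\<And>a b. {a, b} \<in> R \<Longrightarrow> a \<in> U \<Longrightarrow> b \<in> U"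
  shows "w \<in> U"
proof -
  have "(u, w) \<in> (link R)\<^sup>*" using assms(1) by (simp add: conn_def)
  then show ?thesis
    by (induction rule: rtrancl_induct) (use assms in \<open>auto simp: link_def\<close>)
qed

section \<open>Edge counts against numbers of roots\<close>

definition covers :: "'v set \<Rightarrow> 'v set set \<Rightarrow> 'v set \<Rightarrow> bool" where
  "covers W R Q \<longleftrightarrow> (\<forall>u\<in>W. \<exists>q\<in>Q. conn R u q)"

text \<open>Removing an edge cuts off at most one of its ends from the roots, so one of the two ends
  as an additional root restores the covering. Without edges, every vertex has to be a root
  itself.\<close>

lemma card_le_covers:
  assumes "finite F" "\<forall>e\<in>F. \<exists>p q. en e = {p, q}" "finite Q" "covers W (en ` F) Q"
  shows "card W \<le> card F + card Q"
  using assms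
proof (induction F arbitrary: Q rule: finite_induct)
  case empty
  then have "W \<subseteq> Q"
    by (auto simp: covers_def conn_isolated)
  then show ?case using empty by (simp add: card_mono)
next
  case (insert e F)
  obtain p q where e: "en e = {p, q}" using insert.prems by auto
  have cov: "\<exists>c\<in>Q. conn (en ` F) u c \<or> conn (en ` F) u p \<and> conn (en ` F) q c
      \<or> conn (en ` F) u q \<and> conn (en ` F) p c" if uW: "u \<in> W" for u
    using insert.prems(3) uW unfolding covers_def by (simp add: e conn_insert)
  have ex: "\<exists>r. covers W (en ` F) (insert r Q)"
  proof (cases "\<exists>c\<in>Q. conn (en ` F) q c")
    case True
    then have "covers W (en ` F) (insert p Q)"
      unfolding covers_def using cov by (metis conn_trans insertCI)
    then show ?thesis by blast
  next
    case False
    then have "covers W (en ` F) (insert q Q)"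
      unfolding covers_def using cov by (metis conn_trans insertCI)
    then show ?thesis by blast
  qed
  then obtain r where "covers W (en ` F) (insert r Q)" by blast
  then have "card W \<le> card F + card (insert r Q)"
    using insert by auto
  also have "\<dots> \<le> card F + (card Q + 1)"
    using card_insert_le_m1 by (simp add: card_insert_if insert.prems)
  finally show ?case using insert by simp
qed

text \<open>The number \<open>k\<close> of components is given separately, since the roots in \<open>Q\<close> may coincide.\<close>

definition rooted_forest :: "nat \<Rightarrow> 'v set \<Rightarrow> ('e \<Rightarrow> 'v set) \<Rightarrow> 'e set \<Rightarrow> 'v set \<Rightarrow> bool" where
  "rooted_forest k W en F Q \<longleftrightarrow> card F + k = card W \<and> covers W (en ` F) Q"

text \<open>Edge count and connectivity replace acyclicity, which makes a tree a rooted forest with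
  one root and keeps loops harmless. The agreement with acyclicity is
  \<open>spanning_trees_eq\<close>.\<close>

definition tree :: "'v set \<Rightarrow> ('e \<Rightarrow> 'v set) \<Rightarrow> 'e set \<Rightarrow> bool" where
  "tree V en S \<longleftrightarrow> card S + 1 = card V \<and> (\<forall>u\<in>V. \<forall>w\<in>V. conn (en ` S) u w)"

lemma tree_iff_rooted_forest:
  assumes "a \<in> W"
  shows "tree W en F \<longleftrightarrow> rooted_forest 1 W en F {a}"
proof -
  have "(\<forall>u\<in>W. \<forall>w\<in>W. conn (en ` F) u w) \<longleftrightarrow> (\<forall>u\<in>W. conn (en ` F) u a)"
    using assms conn_sym[of "en ` F"] conn_trans[of "en ` F" _ a] by blast
  then show ?thesis by (simp add: tree_def rooted_forest_def covers_def)
qed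

text \<open>If the ends stayed connected, the same roots would cover \<open>W\<close> with one edge
  fewer, against \<open>card_le_covers\<close>.\<close>

lemma bridge:
  assumes "finite F" "\<forall>e\<in>F. \<exists>p q. en e = {p, q}" "rooted_forest k W en F Q"
    and "finite Q" "card Q \<le> k" "e \<in> F" "en e = {p, q}"
  shows "\<not> conn (en ` (F - {e})) p q"
proof
  assume c: "conn (en ` (F - {e})) p q"
  have im: "en ` F = insert {p, q} (en ` (F - {e}))" using assms by auto
  have "conn (en ` F) u w \<longleftrightarrow> conn (en ` (F - {e})) u w" for u w
    unfolding im conn_insert using c by (meson conn_sym conn_trans)
  then have "covers W (en ` (F - {e})) Q" using assms(3) by (simp add: rooted_forest_def covers_def)
  then have "card W \<le> card (F - {e}) + card Q"
    using assms by (intro card_le_covers) auto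
  then show False using assms card_Suc_Diff1[of F e] by (simp add: rooted_forest_def)
qed

text \<open>One of two connected roots could be dropped, against
  \<open>card_le_covers\<close>.\<close>

lemma not_conn_roots:
  assumes "finite F" "\<forall>e\<in>F. \<exists>p q. en e = {p, q}" "rooted_forest k W en F Q"
    and "finite Q" "card Q \<le> k" "p \<in> Q" "q \<in> Q" "p \<noteq> q"
  shows "\<not> conn (en ` F) p q"
proof
  assume "conn (en ` F) p q"
  have "\<exists>r\<in>Q - {q}. conn (en ` F) u r" if uW: "u \<in> W" for u
  proof -
    obtain r where r: "r \<in> Q" "conn (en ` F) u r"
      using assms(3) uW by (auto simp: rooted_forest_def covers_def)
    show ?thesis
    proof (cases "r = q")
      case True
      then have "conn (en ` F) u p"
        using r conn_sym[OF \<open>conn (en ` F) p q\<close>] conn_trans by fast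
      then show ?thesis using assms(6,8) by blast
    qed (use r in blast)
  qed
  then have "covers W (en ` F) (Q - {q})" by (simp add: covers_def)
  then have "card W \<le> card F + card (Q - {q})"
    using assms by (intro card_le_covers) auto
  then show False using assms card_Suc_Diff1[of Q q] by (simp add: rooted_forest_def)
qed

text \<open>Parity version of: the differences of a potential along a path add up to the difference
  at its ends. The potential is the indicator function of \<open>C\<close>.\<close>

lemma odd_crossings:
  assumes fin: "finite F" and br: "\<And>e p q. e \<in> F \<Longrightarrow> en e = {p, q} \<Longrightarrow> \<not> conn (en ` (F - {e})) p q"
    and "conn (en ` F) p q"
  shows "odd (card {e \<in> F. \<not> conn (en ` (F - {e})) p q \<and> en e \<inter> C \<noteq> {} \<and> \<not> en e \<subseteq> C})
     \<longleftrightarrow> (p \<in> C) \<noteq> (q \<in> C)"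
proof -
  let ?X = "\<lambda>u. {e \<in> F. \<not> conn (en ` (F - {e})) p u \<and> en e \<inter> C \<noteq> {} \<and> \<not> en e \<subseteq> C}"
  have "(p, q) \<in> (link (en ` F))\<^sup>*" using assms(3) by (simp add: conn_def)
  then have "odd (card (?X q)) \<longleftrightarrow> (p \<in> C) \<noteq> (q \<in> C)"
  proof (induction rule: rtrancl_induct)
    case base
    then show ?case by simp
  next
    case (step u w)
    obtain e where e: "e \<in> F" "en e = {u, w}" using step(2) by (auto simp: link_def)
    have other: "conn (en ` (F - {f})) p u \<longleftrightarrow> conn (en ` (F - {f})) p w" if "f \<noteq> e" for f
    proof -
      have "conn (en ` (F - {f})) u w" using that e by (intro conn_edge) (metis Diff_iff image_eqI singletonD)
      then show ?thesis by (meson conn_sym conn_trans)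
    qed
    have nb: "\<not> conn (en ` (F - {e})) u w" using br e by blast
    have "conn (en ` F) p u" using step(1) by (simp add: conn_def)
    moreover have "en ` F = insert {u, w} (en ` (F - {e}))" using e by auto
    ultimately have "conn (en ` (F - {e})) p u \<or> conn (en ` (F - {e})) p w"
      by (auto simp: conn_insert)
    with nb have one: "conn (en ` (F - {e})) p u \<longleftrightarrow> \<not> conn (en ` (F - {e})) p w"
      by (meson conn_sym conn_trans)
    have finX: "finite (?X u)" "finite (?X w)" using fin by auto
    have cr: "(en e \<inter> C \<noteq> {} \<and> \<not> en e \<subseteq> C) \<longleftrightarrow> (u \<in> C) \<noteq> (w \<in> C)" using e by auto
    have off: "?X u - {e} = ?X w - {e}" using other by auto
    show ?case
    proof (cases "(u \<in> C) \<noteq> (w \<in> C)")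
      case True
      then have "e \<in> ?X u \<longleftrightarrow> e \<notin> ?X w" using cr one e by auto
      then have "?X w = insert e (?X u) \<and> e \<notin> ?X u \<or> ?X u = insert e (?X w) \<and> e \<notin> ?X w"
        using off by blast
      then have "card (?X w) = Suc (card (?X u)) \<or> card (?X u) = Suc (card (?X w))"
        using card_insert_disjoint[OF finX(1), of e] card_insert_disjoint[OF finX(2), of e] by argo
      then have "odd (card (?X u)) \<longleftrightarrow> even (card (?X w))" by (elim disjE) simp_all
      then show ?thesis using step.IH True by argo
    next
      case False
      then have "e \<notin> ?X u" "e \<notin> ?X w" using cr by blast+
      then have "?X u = ?X w" using off by blast
      then show ?thesis using step.IH False by argo
    qed
  qed
  then show ?thesis .
qed

section \<open>Attaching a star or new edges to a forest\<close>

lemma conn_star: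
  assumes "x \<notin> \<Union>R" "u \<noteq> x"
  shows "conn (R \<union> (\<lambda>a. {x, a}) ` Q) u x \<longleftrightarrow> (\<exists>a\<in>Q. conn R u a)" (is "conn ?S u x \<longleftrightarrow> _")
proof
  assume "conn ?S u x"
  then have "conn ?S x u" by (rule conn_sym)
  then have "u \<in> {u. u = x \<or> (\<exists>a\<in>Q. conn R u a)}"
  proof (rule conn_closed)
    fix b c assume e: "{b, c} \<in> ?S" and b: "b \<in> {u. u = x \<or> (\<exists>a\<in>Q. conn R u a)}"
    show "c \<in> {u. u = x \<or> (\<exists>a\<in>Q. conn R u a)}"
    proof (cases "{b, c} \<in> R")
      case True
      then have "b \<noteq> x" "conn R c b" using assms by (auto intro: conn_sym conn_edge)
      then show ?thesis using b conn_trans by fast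
    next
      case False
      then have "c = x \<or> c \<in> Q" using e by (auto simp: doubleton_eq_iff)
      then show ?thesis using conn_refl by fast
    qed
  qed simp
  then show "\<exists>a\<in>Q. conn R u a" using assms by simp
next
  assume "\<exists>a\<in>Q. conn R u a"
  then obtain a where a: "a \<in> Q" "conn R u a" by blast
  then have "conn ?S u a" by (meson Un_upper1 conn_mono)
  moreover have "conn ?S a x" using a by (intro conn_edge) (auto simp: insert_commute)
  ultimately show "conn ?S u x" by (rule conn_trans)
qed

text \<open>Deleting \<open>x\<close> from a tree leaves one component for each edge at
  \<open>x\<close>, containing the other end of that edge. The number of components is
  \<open>card I\<close> and not the number of ends: if two edges of \<open>I\<close> are parallel,
  both sides are false, the right one by \<open>card_le_covers\<close>.\<close>

lemma tree_star:
  assumes "finite W" "x \<notin> W" "finite F" "finite I" "F \<inter> I = {}"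
    and "\<And>e. e \<in> I \<Longrightarrow> en e = {x, a e}" "\<And>e. e \<in> F \<Longrightarrow> en e \<subseteq> W"
  shows "tree (insert x W) en (I \<union> F) \<longleftrightarrow> rooted_forest (card I) W en F (a ` I)"
proof -
  have im: "en ` (I \<union> F) = en ` F \<union> (\<lambda>b. {x, b}) ` (a ` I)" using assms(6) by (auto simp: image_iff)
  have xF: "x \<notin> \<Union>(en ` F)" using assms(2,7) by blast
  have "conn (en ` (I \<union> F)) u x \<longleftrightarrow> (\<exists>b\<in>a ` I. conn (en ` F) u b)" if "u \<in> W" for u
    unfolding im using that assms(2) by (intro conn_star[OF xF]) auto
  then have "covers (insert x W) (en ` (I \<union> F)) {x} \<longleftrightarrow> covers W (en ` F) (a ` I)"
    unfolding covers_def by (simp del: image_Un bex_simps)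
  moreover have "card (I \<union> F) + 1 = card (insert x W) \<longleftrightarrow> card F + card I = card W"
    using assms by (simp add: card_Un_disjoint Int_commute add.commute)
  ultimately show ?thesis
    using tree_iff_rooted_forest[of x "insert x W" en "I \<union> F"] by (simp add: rooted_forest_def)
qed

lemma tree_insert_edge:
  assumes "finite F" "e \<notin> F" "en' e = {p, q}" "p \<in> W" "\<And>f. f \<in> F \<Longrightarrow> en' f = en f"
  shows "tree W en' (insert e F) \<longleftrightarrow> rooted_forest 2 W en F {p, q}"
proof -
  have im: "en' ` (insert e F) = insert {p, q} (en ` F)" using assms by auto
  have "conn (insert {p, q} (en ` F)) u p \<longleftrightarrow> conn (en ` F) u p \<or> conn (en ` F) u q" for u
    unfolding conn_insert using conn_refl conn_trans by metis
  then have "covers W (en' ` (insert e F)) {p} \<longleftrightarrow> covers W (en ` F) {p, q}"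
    unfolding im covers_def by simp
  then show ?thesis
    using tree_iff_rooted_forest[of p W en' "insert e F"] assms by (simp add: rooted_forest_def)
qed

text \<open>Two edges have to merge three components into one. If no end of the first edge were
  connected in \<open>F\<close> with an end of the second, the two edges would lie in separate
  components of the result.\<close>

lemma tree_insert_two_edges:
  assumes "finite F" "e \<notin> F" "g \<notin> F" "e \<noteq> g" "en' e = {p, q}" "en' g = {r, s}"
    and "p \<in> W" "q \<in> W" "r \<in> W" "s \<in> W" "\<And>f. f \<in> F \<Longrightarrow> en' f = en f"
  shows "tree W en' (insert e (insert g F)) \<longleftrightarrow> rooted_forest 3 W en F {p, q, r, s} \<and>
    (conn (en ` F) p r \<or> conn (en ` F) p s \<or> conn (en ` F) q r \<or> conn (en ` F) q s)"
proof -
  let ?c = "conn (en ` F)"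
  let ?d = "conn (insert {r, s} (en ` F))"
  have d: "?d u w \<longleftrightarrow> ?c u w \<or> ?c u r \<and> ?c s w \<or> ?c u s \<and> ?c r w" for u w by (rule conn_insert)
  have im: "en' ` insert e (insert g F) = insert {p, q} (insert {r, s} (en ` F))" using assms by auto
  have cp: "conn (en' ` insert e (insert g F)) u p \<longleftrightarrow> ?d u p \<or> ?d u q" for u
    unfolding im conn_insert[of p q] using conn_refl conn_trans by metis
  have eq: "covers W (en' ` insert e (insert g F)) {p} \<longleftrightarrow> covers W (en ` F) {p, q, r, s} \<and>
    (?c p r \<or> ?c p s \<or> ?c q r \<or> ?c q s)" (is "?L \<longleftrightarrow> ?R \<and> ?X")
  proof (intro iffI conjI)
    assume L: ?L
    show ?R unfolding covers_def
    proof
      fix u assume "u \<in> W"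
      then have "?d u p \<or> ?d u q" using L cp by (simp add: covers_def)
      then show "\<exists>c\<in>{p, q, r, s}. ?c u c" by (auto simp: d)
    qed
    have "?d r p \<or> ?d r q" using L cp assms by (simp add: covers_def)
    then show ?X unfolding d using conn_commute[of "en ` F"] by metis
  next
    assume "?R \<and> ?X"
    then have R: ?R and X: ?X by auto
    have "?d r s" "?d s r" by (auto intro!: conn_edge simp: insert_commute)
    moreover have cd: "?c u w \<Longrightarrow> ?d u w" for u w by (simp add: d)
    ultimately have "?d r p \<or> ?d r q" "?d s p \<or> ?d s q"
      using X conn_commute[of "en ` F"] conn_trans[of "insert {r, s} (en ` F)"] by metis+
    then have "?d u p \<or> ?d u q" if "u \<in> W" for u
      using R that cd conn_trans[of "insert {r, s} (en ` F)" u] unfolding covers_def by blast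
    then show ?L using cp by (simp add: covers_def)
  qed
  have "tree W en' (insert e (insert g F)) \<longleftrightarrow> rooted_forest 1 W en' (insert e (insert g F)) {p}"
    using assms by (intro tree_iff_rooted_forest)
  also have "\<dots> \<longleftrightarrow> card F + 3 = card W \<and> covers W (en' ` insert e (insert g F)) {p}"
    using assms by (simp add: rooted_forest_def numeral_3_eq_3)
  finally show ?thesis using eq by (auto simp: rooted_forest_def)
qed

text \<open>Both sides equal 2 if exactly two of the four terminals lie in a common component,
  and 0 otherwise.\<close>

lemma four_terminals:
  fixes W :: "'v set" and en :: "'e \<Rightarrow> 'v set"
  assumes "finite F" "\<forall>e\<in>F. \<exists>p q. en e = {p, q}"
  defines "tri \<equiv> \<lambda>p q r. of_bool (rooted_forest 3 W en F {p, q, r}) :: nat"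
    and "two \<equiv> \<lambda>p q r s. of_bool (rooted_forest 3 W en F {p, q, r, s} \<and>
      (conn (en ` F) p r \<or> conn (en ` F) p s \<or> conn (en ` F) q r \<or> conn (en ` F) q s)) :: nat"
  assumes "p \<in> W" "q \<in> W" "r \<in> W" "s \<in> W"
  shows "tri p q r + tri p q s + tri p r s + tri q r s = two p q r s + two p r q s + two p s q r"
proof (cases "rooted_forest 3 W en F {p, q, r, s}")
  case False
  then have "\<not> rooted_forest 3 W en F Q" if "Q \<subseteq> {p, q, r, s}" for Q
    using that unfolding rooted_forest_def covers_def by (meson subsetD)
  moreover have "{p, r, q, s} = {p, q, r, s}" "{p, s, q, r} = {p, q, r, s}" by auto
  ultimately show ?thesis using False by (simp add: tri_def two_def)
next
  case True
  let ?c = "conn (en ` F)"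
  note S = conn_commute[of "en ` F"] and T = conn_trans[of "en ` F"]
  have perm: "{p, r, q, s} = {p, q, r, s}" "{p, s, q, r} = {p, q, r, s}" by auto
  have cov: "?c u p \<or> ?c u q \<or> ?c u r \<or> ?c u s" if "u \<in> W" for u
    using True that by (auto simp: rooted_forest_def covers_def)
  have card: "card F + 3 = card W" using True by (simp add: rooted_forest_def)
  have cov': "?c u a \<or> ?c u b \<or> ?c u c \<or> ?c u d" if "{a, b, c, d} = {p, q, r, s}" "u \<in> W" for a b c d u
  proof -
    have "p \<in> {a, b, c, d}" "q \<in> {a, b, c, d}" "r \<in> {a, b, c, d}" "s \<in> {a, b, c, d}"
      unfolding that(1) by simp_all
    then show ?thesis using cov[OF that(2)] by auto
  qed
  have tri: "rooted_forest 3 W en F {a, b, c} \<longleftrightarrow> ?c d a \<or> ?c d b \<or> ?c d c"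
    if abcd: "{a, b, c, d} = {p, q, r, s}" for a b c d
  proof -
    have "d \<in> {p, q, r, s}" unfolding abcd[symmetric] by simp
    then have dW: "d \<in> W" using assms(5-8) by auto
    have "covers W (en ` F) {a, b, c} \<longleftrightarrow> ?c d a \<or> ?c d b \<or> ?c d c"
      unfolding covers_def using dW cov'[OF abcd] T by blast
    then show ?thesis using card by (simp add: rooted_forest_def)
  qed
  \<comment> \<open>By the edge count there are three components, too many for two roots.\<close>
  have no2: "\<not> (\<forall>u\<in>W. ?c u a \<or> ?c u b)" for a b
  proof
    assume "\<forall>u\<in>W. ?c u a \<or> ?c u b"
    then have "covers W (en ` F) {a, b}" by (simp add: covers_def)
    then have "card W \<le> card F + card {a, b}" using assms by (intro card_le_covers) auto
    moreover have "card {a, b} \<le> 2" by (simp add: card_insert_if)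
    ultimately show False using card by simp
  qed
  \<comment> \<open>A component with three of the terminals, or two components with two each, would
    leave two roots that cover \<open>W\<close>. Hence at most one of the six pairs of terminals is
    connected.\<close>
  have d1: "\<not> (?c a b \<and> ?c a c)" if "{a, b, c, d} = {p, q, r, s}" for a b c d
    using no2[of a d] cov'[OF that] T S by meson
  have d2: "\<not> (?c a b \<and> ?c c d)" if "{a, b, c, d} = {p, q, r, s}" for a b c d
    using no2[of a c] cov'[OF that] T S by meson
  have t: "rooted_forest 3 W en F {p, q, r} \<longleftrightarrow> ?c p s \<or> ?c q s \<or> ?c r s"
    "rooted_forest 3 W en F {p, q, s} \<longleftrightarrow> ?c p r \<or> ?c q r \<or> ?c r s"
    "rooted_forest 3 W en F {p, r, s} \<longleftrightarrow> ?c p q \<or> ?c q r \<or> ?c q s"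
    "rooted_forest 3 W en F {q, r, s} \<longleftrightarrow> ?c p q \<or> ?c p r \<or> ?c p s"
    using tri[of p q r s] tri[of p q s r] tri[of p r s q] tri[of q r s p] S
    by (auto simp: insert_commute)
  have ex: "\<not> (?c p q \<and> ?c p r)" "\<not> (?c p q \<and> ?c p s)" "\<not> (?c p r \<and> ?c p s)"
    "\<not> (?c p q \<and> ?c q r)" "\<not> (?c p q \<and> ?c q s)" "\<not> (?c q r \<and> ?c q s)"
    "\<not> (?c p r \<and> ?c q r)" "\<not> (?c p r \<and> ?c r s)" "\<not> (?c q r \<and> ?c r s)"
    "\<not> (?c p s \<and> ?c q s)" "\<not> (?c p s \<and> ?c r s)" "\<not> (?c q s \<and> ?c r s)"
    "\<not> (?c p q \<and> ?c r s)" "\<not> (?c p r \<and> ?c q s)" "\<not> (?c p s \<and> ?c q r)"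
    using d1[of p q r s] d1[of p q s r] d1[of p r s q] d1[of q p r s] d1[of q p s r] d1[of q r s p]
      d1[of r p q s] d1[of r p s q] d1[of r q s p] d1[of s p q r] d1[of s p r q] d1[of s q r p]
      d2[of p q r s] d2[of p r q s] d2[of p s q r] S[of q p] S[of r p] S[of s p] S[of r q] S[of s q] S[of s r]
    by (simp_all add: insert_commute)
  have s2: "?c r q = ?c q r" "?c s q = ?c q s" "?c s r = ?c r s" using S by metis+
  show ?thesis
    unfolding tri_def two_def perm t s2 using True ex by (auto simp: of_bool_def)
qed

section \<open>Partitions into two spanning trees\<close>

text \<open>The subset convolution at \<open>A\<close>. For 0/1-valued functions it counts the
  ordered partitions of \<open>A\<close> into two sets of the given kinds.\<close>

definition conv :: "('e set \<Rightarrow> nat) \<Rightarrow> ('e set \<Rightarrow> nat) \<Rightarrow> 'e set \<Rightarrow> nat" where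
  "conv g h A = (\<Sum>S\<in>Pow A. g S * h (A - S))"

lemma sum_Pow_insert:
  fixes g :: "'e set \<Rightarrow> 'b::comm_monoid_add"
  assumes "finite A" "e \<notin> A"
  shows "(\<Sum>S\<in>Pow (insert e A). g S) = (\<Sum>S\<in>Pow A. g S) + (\<Sum>S\<in>Pow A. g (insert e S))"
proof -
  have "Pow A \<inter> insert e ` Pow A = {}" "inj_on (insert e) (Pow A)"
    using assms by (auto simp: inj_on_def)
  then show ?thesis using assms by (simp add: Pow_insert sum.union_disjoint sum.reindex)
qed

lemma conv_empty: "conv g h {} = g {} * h {}"
  by (simp add: conv_def)

lemma conv_insert:
  assumes "finite A" "e \<notin> A"
  shows "conv g h (insert e A) = conv g (\<lambda>S. h (insert e S)) A + conv (\<lambda>S. g (insert e S)) h A"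
proof -
  have "insert e A - S = insert e (A - S)" "insert e A - insert e S = A - S" if "S \<in> Pow A" for S
    using that assms by auto
  then show ?thesis unfolding conv_def sum_Pow_insert[OF assms] by simp
qed

lemma conv_cong:
  assumes "\<And>S. S \<subseteq> A \<Longrightarrow> g S = g' S" "\<And>S. S \<subseteq> A \<Longrightarrow> h S = h' S"
  shows "conv g h A = conv g' h' A"
  unfolding conv_def using assms by (intro sum.cong) auto

lemma conv_add: "conv (\<lambda>S. g S + g' S) h A = conv g h A + conv g' h A"
    "conv g (\<lambda>S. h S + h' S) A = conv g h A + conv g h' A"
  by (simp_all add: conv_def algebra_simps sum.distrib)

lemma conv_union:
  assumes "finite D" "finite A" "D \<inter> A = {}"
  shows "conv g h (D \<union> A) = (\<Sum>I\<in>Pow D. conv (\<lambda>F. g (I \<union> F)) (\<lambda>F. h ((D - I) \<union> F)) A)"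
  using assms
proof (induction D arbitrary: g h rule: finite_induct)
  case empty
  then show ?case by simp
next
  case (insert e D)
  have D: "insert e D - I = insert e (D - I)" "insert e D - insert e I = D - I" if "I \<in> Pow D" for I
    using that insert by auto
  have "conv g h (insert e D \<union> A) = conv g (\<lambda>S. h (insert e S)) (D \<union> A) + conv (\<lambda>S. g (insert e S)) h (D \<union> A)"
    using insert by (simp add: conv_insert)
  also have "\<dots> = (\<Sum>I\<in>Pow (insert e D). conv (\<lambda>F. g (I \<union> F)) (\<lambda>F. h ((insert e D - I) \<union> F)) A)"
    using insert by (simp add: sum_Pow_insert D)
  finally show ?case .
qed

definition tree_pairs :: "'v set \<Rightarrow> ('e \<Rightarrow> 'v set) \<Rightarrow> 'e set \<Rightarrow> nat" where
  "tree_pairs V en E = conv (\<lambda>S. of_bool (tree V en S)) (\<lambda>S. of_bool (tree V en S)) E"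

text \<open>By \<open>tree_star\<close>, the indicator of those \<open>F\<close> that become trees
  when a new vertex is attached along the edges in \<open>I\<close>; numerical so that it can be
  convolved.\<close>

definition forests :: "'v set \<Rightarrow> ('e \<Rightarrow> 'v set) \<Rightarrow> ('e \<Rightarrow> 'v) \<Rightarrow> 'e set \<Rightarrow> 'e set \<Rightarrow> nat" where
  "forests W en a I F = of_bool (rooted_forest (card I) W en F (a ` I))"

lemma tree_pairs_star:
  assumes "finite W" "x \<notin> W" "finite D" "finite A" "D \<inter> A = {}"
    and "\<And>e. e \<in> D \<Longrightarrow> en e = {x, a e}" "\<And>e. e \<in> A \<Longrightarrow> en e \<subseteq> W"
  shows "tree_pairs (insert x W) en (D \<union> A) =
    (\<Sum>I\<in>Pow D. conv (forests W en a I) (forests W en a (D - I)) A)"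
proof -
  have "of_bool (tree (insert x W) en (I \<union> F)) = forests W en a I F"
    if "I \<subseteq> D" "F \<subseteq> A" for I F
  proof -
    have "tree (insert x W) en (I \<union> F) \<longleftrightarrow> rooted_forest (card I) W en F (a ` I)"
      using that assms(3-5) by (intro tree_star[OF assms(1,2)] assms(6,7)) (auto dest: finite_subset)
    then show ?thesis by (simp add: forests_def numeral_2_eq_2)
  qed
  then show ?thesis
    unfolding tree_pairs_def using assms
    by (subst conv_union) (auto intro!: sum.cong conv_cong)
qed

lemma forests_empty: "W \<noteq> {} \<Longrightarrow> forests W en a {} F = 0"
  by (auto simp: forests_def rooted_forest_def covers_def)

lemma forests_singleton: "a e \<in> W \<Longrightarrow> forests W en a {e} F = of_bool (tree W en F)"
  using tree_iff_rooted_forest[of "a e" W en F] by (simp add: forests_def numeral_2_eq_2)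

text \<open>Forests with \<open>card I\<close> and \<open>card J\<close> components have
  \<open>2 * card W - card I - card J\<close> edges in total.\<close>

lemma conv_forests_eq_0:
  assumes "finite A" "card A + card I + card J \<noteq> 2 * card W"
  shows "conv (forests W en a I) (forests W en a J) A = 0"
proof -
  have "forests W en a I S * forests W en a J (A - S) = 0" if "S \<subseteq> A" for S
  proof -
    have "card S + card (A - S) = card A" using that assms(1)
      by (metis card_Diff_subset card_mono finite_subset le_add_diff_inverse)
    then show ?thesis using assms(2) by (auto simp: forests_def rooted_forest_def)
  qed
  then show ?thesis unfolding conv_def by (intro sum.neutral) blast
qed

lemma tree_pairs_eq_0:
  assumes "finite E" "card E + 2 \<noteq> 2 * card V"
  shows "tree_pairs V en E = 0"
proof -
  have "\<not> (tree V en S \<and> tree V en (E - S))" if "S \<subseteq> E" for S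
  proof -
    have "card S + card (E - S) = card E" using that assms(1)
      by (metis card_Diff_subset card_mono finite_subset le_add_diff_inverse)
    then show ?thesis using assms(2) by (auto simp: tree_def)
  qed
  then show ?thesis unfolding tree_pairs_def conv_def by (intro sum.neutral) force
qed

lemma tree_no_loop:
  assumes "tree V en S" "finite S" "\<forall>e\<in>S. \<exists>p q. en e = {p, q}" "e \<in> S" "u \<in> V"
  shows "en e \<noteq> {u}"
proof
  assume "en e = {u}"
  then show False
    using bridge[of S en 1 V "{u}" e u u] assms tree_iff_rooted_forest[of u V en S] by auto
qed

lemma tree_pairs_loop:
  assumes "finite E" "\<forall>e\<in>E. \<exists>p q. en e = {p, q}" "e \<in> E" "en e = {u}" "u \<in> V"
  shows "tree_pairs V en E = 0"
proof -
  have "\<not> (tree V en S \<and> tree V en (E - S))" if "S \<subseteq> E" for S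
  proof -
    have "e \<in> S \<or> e \<in> E - S" using assms by blast
    moreover have "finite S" "finite (E - S)" using that assms finite_subset by auto
    ultimately show ?thesis
      using tree_no_loop[of V en S e u] tree_no_loop[of V en "E - S" e u] that assms by blast
  qed
  then show ?thesis unfolding tree_pairs_def conv_def by (intro sum.neutral) force
qed

text \<open>By \<open>tree_insert_two_edges\<close>, the indicator of those \<open>F\<close> that
  become trees when both links, from \<open>a e\<close> to \<open>a f\<close> and from
  \<open>a g\<close> to \<open>a h\<close>, are added.\<close>

definition link_two :: "'v set \<Rightarrow> ('e \<Rightarrow> 'v set) \<Rightarrow> ('e \<Rightarrow> 'v) \<Rightarrow> 'e \<Rightarrow> 'e \<Rightarrow> 'e \<Rightarrow> 'e \<Rightarrow> 'e set \<Rightarrow> nat" where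
  "link_two W en a e f g h F = of_bool (rooted_forest 3 W en F {a e, a f, a g, a h} \<and>
      (conn (en ` F) (a e) (a g) \<or> conn (en ` F) (a e) (a h) \<or>
       conn (en ` F) (a f) (a g) \<or> conn (en ` F) (a f) (a h)))"

text \<open>The left side describes three of the four edges at a removed vertex in one tree. The
  right side describes both links of a pairing in one tree, summed over the three pairings. This
  exchange is the core of the recursion.\<close>

lemma forests_four:
  assumes "finite F" "\<forall>e\<in>F. \<exists>p q. en e = {p, q}" "distinct [e1, e2, e3, e4]"
    and "a e1 \<in> W" "a e2 \<in> W" "a e3 \<in> W" "a e4 \<in> W"
  shows "forests W en a {e1, e2, e3} F + forests W en a {e1, e2, e4} F
       + forests W en a {e1, e3, e4} F + forests W en a {e2, e3, e4} F
    = link_two W en a e1 e2 e3 e4 F + link_two W en a e1 e3 e2 e4 F + link_two W en a e1 e4 e2 e3 F"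
proof -
  have "card {e1, e2, e3} = 3" "card {e1, e2, e4} = 3" "card {e1, e3, e4} = 3" "card {e2, e3, e4} = 3"
    using assms(3) by auto
  then show ?thesis
    using four_terminals[OF assms(1,2,4-7)] unfolding forests_def link_two_def by simp
qed

text \<open>One summand for each distribution of the two links over the two trees. By
  \<open>forests_singleton\<close>, \<open>forests W en a {e}\<close> is just the indicator of the
  trees on \<open>W\<close>.\<close>

lemma tree_pairs_two_links:
  assumes "finite A" "\<And>d. d \<in> A \<Longrightarrow> en' d = en d" "e \<notin> A" "g \<notin> A" "distinct [e, f, g, h]"
    and "en' e = {a e, a f}" "en' g = {a g, a h}"
    and "a e \<in> W" "a f \<in> W" "a g \<in> W" "a h \<in> W"
  shows "tree_pairs W en' (insert e (insert g A)) =
     conv (forests W en a {e, f}) (forests W en a {g, h}) A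
   + conv (forests W en a {g, h}) (forests W en a {e, f}) A
   + conv (forests W en a {e}) (link_two W en a e f g h) A
   + conv (link_two W en a e f g h) (forests W en a {e}) A"
proof -
  have t: "of_bool (tree W en' F) = forests W en a {e} F"
    "of_bool (tree W en' (insert e F)) = forests W en a {e, f} F"
    "of_bool (tree W en' (insert g F)) = forests W en a {g, h} F"
    "of_bool (tree W en' (insert e (insert g F))) = link_two W en a e f g h F"
    "of_bool (tree W en' (insert g (insert e F))) = link_two W en a e f g h F"
    if F: "F \<subseteq> A" for F
  proof -
    have fin: "finite F" and en: "\<And>d. d \<in> F \<Longrightarrow> en' d = en d" and nin: "e \<notin> F" "g \<notin> F"
      using F assms finite_subset by auto
    have im: "en' ` F = en ` F" using en by simp
    show "of_bool (tree W en' F) = forests W en a {e} F"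
      using assms by (simp add: forests_singleton tree_def im)
    show "of_bool (tree W en' (insert e F)) = forests W en a {e, f} F"
      using assms(5) tree_insert_edge[where F = F and en = en and e = e, OF fin nin(1) assms(6,8) en] by (simp add: forests_def numeral_2_eq_2)
    show "of_bool (tree W en' (insert g F)) = forests W en a {g, h} F"
      using assms(5) tree_insert_edge[where F = F and en = en and e = g, OF fin nin(2) assms(7,10) en] by (simp add: forests_def numeral_2_eq_2)
    show "of_bool (tree W en' (insert e (insert g F))) = link_two W en a e f g h F"
      using assms(5) tree_insert_two_edges[where F = F and en = en and e = e and g = g, OF fin nin _ assms(6-11) en] by (simp add: link_two_def)
    then show "of_bool (tree W en' (insert g (insert e F))) = link_two W en a e f g h F"
      by (simp add: insert_commute)
  qed
  have "tree_pairs W en' (insert e (insert g A)) =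
    conv (\<lambda>F. of_bool (tree W en' F)) (\<lambda>F. of_bool (tree W en' (insert e (insert g F)))) A
    + conv (\<lambda>F. of_bool (tree W en' (insert g F))) (\<lambda>F. of_bool (tree W en' (insert e F))) A
    + (conv (\<lambda>F. of_bool (tree W en' (insert e F))) (\<lambda>F. of_bool (tree W en' (insert g F))) A
    + conv (\<lambda>F. of_bool (tree W en' (insert e (insert g F)))) (\<lambda>F. of_bool (tree W en' F)) A)"
    unfolding tree_pairs_def using assms by (simp add: conv_insert)
  also have "\<dots> = conv (forests W en a {e}) (link_two W en a e f g h) A
   + conv (forests W en a {g, h}) (forests W en a {e, f}) A
   + (conv (forests W en a {e, f}) (forests W en a {g, h}) A
   + conv (link_two W en a e f g h) (forests W en a {e}) A)"
    using t by (intro arg_cong2[where f = "(+)"] conv_cong) auto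
  finally show ?thesis by simp
qed

lemma tree_pairs_one_link:
  assumes "finite A" "\<And>d. d \<in> A \<Longrightarrow> en' d = en d" "e \<notin> A" "b \<noteq> c"
    and "en' e = {a b, a c}" "a b \<in> W"
  shows "tree_pairs W en' (insert e A) =
     conv (forests W en a {b, c}) (forests W en a {b}) A
   + conv (forests W en a {b}) (forests W en a {b, c}) A"
proof -
  have t: "of_bool (tree W en' F) = forests W en a {b} F"
    "of_bool (tree W en' (insert e F)) = forests W en a {b, c} F"
    if F: "F \<subseteq> A" for F
  proof -
    have fin: "finite F" and en: "\<And>d. d \<in> F \<Longrightarrow> en' d = en d" and nin: "e \<notin> F"
      using F assms finite_subset by auto
    have im: "en' ` F = en ` F" using en by simp
    show "of_bool (tree W en' F) = forests W en a {b} F"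
      using assms by (simp add: forests_singleton tree_def im)
    show "of_bool (tree W en' (insert e F)) = forests W en a {b, c} F"
      using assms(4) tree_insert_edge[where F = F and en = en and e = e, OF fin nin(1) assms(5,6) en] by (simp add: forests_def numeral_2_eq_2)
  qed
  have "tree_pairs W en' (insert e A) =
    conv (\<lambda>F. of_bool (tree W en' F)) (\<lambda>F. of_bool (tree W en' (insert e F))) A
    + conv (\<lambda>F. of_bool (tree W en' (insert e F))) (\<lambda>F. of_bool (tree W en' F)) A"
    unfolding tree_pairs_def using assms by (simp add: conv_insert)
  also have "\<dots> = conv (forests W en a {b}) (forests W en a {b, c}) A
     + conv (forests W en a {b, c}) (forests W en a {b}) A"
    using t by (intro arg_cong2[where f = "(+)"] conv_cong) auto
  finally show ?thesis by simp
qed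

lemma tree_pairs_cong:
  assumes "\<And>d. d \<in> A \<Longrightarrow> en' d = en d"
  shows "tree_pairs W en' A = tree_pairs W en A"
proof -
  have "tree W en' S = tree W en S" if "S \<subseteq> A" for S
  proof -
    have "en' ` S = en ` S" using that assms by (intro image_cong) auto
    then show ?thesis by (simp add: tree_def)
  qed
  then show ?thesis unfolding tree_pairs_def by (intro conv_cong) auto
qed

section \<open>Splitting a vertex of a quartic graph\<close>

text \<open>A loop is an edge whose set of ends is a singleton, and the second summand of the degree
  counts it twice. Connectivity and looplessness are left out because splitting a vertex can destroy
  both.\<close>

definition quartic :: "'v set \<Rightarrow> ('e \<Rightarrow> 'v set) \<Rightarrow> 'e set \<Rightarrow> bool" where
  "quartic V en E \<longleftrightarrow> finite V \<and> finite E \<and> (\<forall>e\<in>E. \<exists>p\<in>V. \<exists>q\<in>V. en e = {p, q}) \<and>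
     card E = 2 * card V \<and> (\<forall>u\<in>V. (\<Sum>e\<in>E. of_bool (u \<in> en e) + of_bool (en e = {u})) = (4::nat))"

definition tree_pairs_at :: "'v set \<Rightarrow> ('e \<Rightarrow> 'v set) \<Rightarrow> 'e set \<Rightarrow> 'v \<Rightarrow> nat" where
  "tree_pairs_at V en E v = tree_pairs (V - {v}) en {e \<in> E. v \<notin> en e}"

text \<open>The two links reuse the names \<open>e\<close> and \<open>g\<close>; the users remove
  \<open>f\<close> and \<open>h\<close> from the edge set. A link is a loop if its two ends
  coincide.\<close>

definition split_ends :: "('e \<Rightarrow> 'v set) \<Rightarrow> ('e \<Rightarrow> 'v) \<Rightarrow> 'e \<Rightarrow> 'e \<Rightarrow> 'e \<Rightarrow> 'e \<Rightarrow> ('e \<Rightarrow> 'v set)" where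
  "split_ends en a e f g h = en(e := {a e, a f}, g := {a g, a h})"

lemma quartic_incident_le:
  assumes "quartic V en E" "v \<in> V"
  shows "card {e \<in> E. v \<in> en e} \<le> 4"
proof -
  have fin: "finite E" using assms by (simp add: quartic_def)
  have "card {e \<in> E. v \<in> en e} = (\<Sum>e\<in>E. of_bool (v \<in> en e))"
    using fin by (simp add: Int_def)
  also have "\<dots> \<le> (\<Sum>e\<in>E. of_bool (v \<in> en e) + of_bool (en e = {v}))" by (intro sum_mono) simp
  also have "\<dots> = 4" using assms by (simp add: quartic_def)
  finally show ?thesis .
qed

lemma quartic_degree:
  assumes "quartic V en E" "x \<in> V" "\<And>e. e \<in> E \<Longrightarrow> en e \<noteq> {x}"
  shows "card {e \<in> E. x \<in> en e} = 4"
proof -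
  have "card {e \<in> E. x \<in> en e} = (\<Sum>e\<in>E. of_bool (x \<in> en e))"
    using assms(1) by (simp add: quartic_def Int_def)
  also have "\<dots> = (\<Sum>e\<in>E. of_bool (x \<in> en e) + of_bool (en e = {x}))"
    using assms(3) by (intro sum.cong) auto
  also have "\<dots> = 4" using assms(1,2) by (simp add: quartic_def)
  finally show ?thesis .
qed

text \<open>If no edge joins \<open>x\<close> to \<open>v\<close>, a distribution 2 + 2 of the edges
  at \<open>x\<close> over the two trees corresponds to one link in each tree, for exactly one
  pairing. The distributions 3 + 1 and 1 + 3 correspond to both links in one tree by
  \<open>forests_four\<close>. Edges from \<open>x\<close> to \<open>v\<close> are absent from both
  sides, and these cases are compared separately.\<close>

lemma tree_pairs_at_split:
  fixes a :: "'e \<Rightarrow> 'v"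
  assumes q: "quartic V en E" and x: "x \<in> V" and v: "v \<in> V" "x \<noteq> v" and w: "w \<in> V" "w \<noteq> x" "w \<noteq> v"
    and D: "{e \<in> E. x \<in> en e} = {e1, e2, e3, e4}" and dist: "distinct [e1, e2, e3, e4]"
    and a: "\<And>e. e \<in> {e1, e2, e3, e4} \<Longrightarrow> en e = {x, a e}"
    and ax: "\<And>e. e \<in> {e1, e2, e3, e4} \<Longrightarrow> a e \<noteq> x"
  shows "tree_pairs_at V en E v =
     tree_pairs_at (V - {x}) (split_ends en a e1 e2 e3 e4) (E - {e2, e4}) v
   + tree_pairs_at (V - {x}) (split_ends en a e1 e3 e2 e4) (E - {e3, e4}) v
   + tree_pairs_at (V - {x}) (split_ends en a e1 e4 e2 e3) (E - {e4, e3}) v"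
proof -
  define W where "W = V - {v, x}"
  define A where "A = {e \<in> E. v \<notin> en e \<and> x \<notin> en e}"
  define c where "c = forests W en a"
  define t where "t = (\<lambda>F. of_bool (tree W en F) :: nat)"
  define D' where "D' = {e \<in> {e1, e2, e3, e4}. a e \<noteq> v}"
  have finV: "finite V" and finE: "finite E" and ends: "\<And>e. e \<in> E \<Longrightarrow> \<exists>p\<in>V. \<exists>q\<in>V. en e = {p, q}"
    and cE: "card E = 2 * card V"
    using q by (auto simp: quartic_def)
  have finA: "finite A" and finW: "finite W" using finE finV by (auto simp: A_def W_def)
  \<comment> \<open>The third vertex \<open>w\<close> keeps \<open>W\<close> nonempty, so both trees
    must use an edge at \<open>x\<close>.\<close>
  have Wne: "W \<noteq> {}" using w by (auto simp: W_def)
  have Din: "{e1, e2, e3, e4} \<subseteq> E" using D by blast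
  have aV: "a e \<in> V" if eD: "e \<in> {e1, e2, e3, e4}" for e
  proof -
    have "e \<in> E" using eD Din by (rule subsetD[rotated])
    then obtain p q where "p \<in> V" "q \<in> V" "en e = {p, q}" using ends[of e] by blast
    then show ?thesis using a[OF eD] by (auto simp: doubleton_eq_iff)
  qed
  have aW: "a e \<in> W" if "e \<in> {e1, e2, e3, e4}" "a e \<noteq> v" for e
    using aV[OF that(1)] ax[OF that(1)] that by (simp add: W_def)
  have nA: "e \<notin> A" if "e \<in> {e1, e2, e3, e4}" for e using a[OF that] by (simp add: A_def)
  have ct: "c {e} = t" if "e \<in> {e1, e2, e3, e4}" "a e \<noteq> v" for e
    using aW[OF that] by (auto simp: c_def t_def forests_singleton)
  have Aends: "\<forall>e\<in>A. \<exists>p q. en e = {p, q}" using ends by (force simp: A_def)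
  have AW: "en e \<subseteq> W" if eA: "e \<in> A" for e
  proof -
    have "e \<in> E" "v \<notin> en e" "x \<notin> en e" using eA by (simp_all add: A_def)
    moreover obtain p q where "p \<in> V" "q \<in> V" "en e = {p, q}" using ends[OF \<open>e \<in> E\<close>] by blast
    ultimately show ?thesis by (auto simp: W_def)
  qed
  have Ev: "{e \<in> E. v \<notin> en e} = D' \<union> A" and disj: "D' \<inter> A = {}"
  proof -
    have "e \<in> {e1, e2, e3, e4}" if "e \<in> E" "x \<in> en e" for e using D that by blast
    moreover have "v \<in> en e \<longleftrightarrow> a e = v" if "e \<in> {e1, e2, e3, e4}" for e using a[OF that] v by auto
    ultimately show "{e \<in> E. v \<notin> en e} = D' \<union> A"
      using Din unfolding D'_def A_def by blast
    show "D' \<inter> A = {}" using nA by (auto simp: D'_def)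
  qed
  have VW: "V - {v} = insert x W" "V - {x} - {v} = W" using x v by (auto simp: W_def)
  have L: "tree_pairs_at V en E v = (\<Sum>I\<in>Pow D'. conv (c I) (c (D' - I)) A)"
    unfolding tree_pairs_at_def Ev VW c_def
    using finW finA disj AW a by (intro tree_pairs_star) (auto simp: W_def D'_def)
  have c0: "conv (c {}) f A = 0" "conv f (c {}) A = 0" for f
    using Wne by (simp_all add: c_def conv_def forests_empty)
  \<comment> \<open>A link with an end at \<open>v\<close> disappears together with
    \<open>v\<close>; the cases record which links survive.\<close>
  have T: "tree_pairs_at (V - {x}) (split_ends en a e f g h) (E - {f, h}) v =
    (if a e \<noteq> v \<and> a f \<noteq> v
     then if a g \<noteq> v \<and> a h \<noteq> v
       then conv (c {e, f}) (c {g, h}) A + conv (c {g, h}) (c {e, f}) A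
         + conv t (link_two W en a e f g h) A + conv (link_two W en a e f g h) t A
       else conv (c {e, f}) t A + conv t (c {e, f}) A
     else if a g \<noteq> v \<and> a h \<noteq> v then conv (c {g, h}) t A + conv t (c {g, h}) A
       else conv t t A)" if efgh: "{e, f, g, h} = {e1, e2, e3, e4}" "distinct [e, f, g, h]" for e f g h
  proof -
    let ?en = "split_ends en a e f g h"
    have inD: "e \<in> {e1, e2, e3, e4}" "f \<in> {e1, e2, e3, e4}" "g \<in> {e1, e2, e3, e4}" "h \<in> {e1, e2, e3, e4}"
      unfolding efgh(1)[symmetric] by simp_all
    have enA: "?en d = en d" if "d \<in> A" for d
      using that nA inD unfolding split_ends_def by (metis fun_upd_apply)
    have ee: "?en e = {a e, a f}" "?en g = {a g, a h}" using efgh(2) by (auto simp: split_ends_def)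
    have E: "E = {d \<in> E. x \<notin> en d} \<union> {e, f, g, h}" using D Din unfolding efgh(1) by blast
    have sp: "{d \<in> E - {f, h}. v \<notin> ?en d} =
       (if a e \<noteq> v \<and> a f \<noteq> v then {e} else {}) \<union> (if a g \<noteq> v \<and> a h \<noteq> v then {g} else {}) \<union> A"
      (is "?X = ?Y")
    proof (rule set_eqI)
      fix d
      consider "d = e" | "d = g" | "d = f \<or> d = h" | "d \<notin> {e, f, g, h}" by blast
      then show "d \<in> ?X \<longleftrightarrow> d \<in> ?Y"
      proof cases
        case 1
        then show ?thesis using ee inD Din efgh nA[of e] by auto
      next
        case 2
        then show ?thesis using ee inD Din efgh nA[of g] by auto
      next
        case 3
        then show ?thesis using inD efgh nA[of f] nA[of h] by auto
      next
        case 4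
        then have "?en d = en d" by (simp add: split_ends_def)
        moreover have "d \<in> E \<Longrightarrow> x \<notin> en d" using 4 E by blast
        ultimately show ?thesis using 4 by (auto simp: A_def)
      qed
    qed
    have ne: "e \<notin> A" "g \<notin> A" using nA inD by blast+
    note at = tree_pairs_at_def[of "V - {x}" ?en "E - {f, h}" v, unfolded VW sp]
    show ?thesis
    proof (cases "a e \<noteq> v \<and> a f \<noteq> v")
      case True
      note ef = this
      show ?thesis
      proof (cases "a g \<noteq> v \<and> a h \<noteq> v")
        case True
        have "tree_pairs W ?en (insert e (insert g A)) = conv (c {e, f}) (c {g, h}) A
          + conv (c {g, h}) (c {e, f}) A + conv (c {e}) (link_two W en a e f g h) A
          + conv (link_two W en a e f g h) (c {e}) A"
          unfolding c_def using True ef inD efgh(2) aW ne enA ee finA by (intro tree_pairs_two_links) auto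
        then show ?thesis using True ef ct[OF inD(1)]
          unfolding at by (auto simp: insert_commute)
      next
        case False
        have "tree_pairs W ?en (insert e A) = conv (c {e, f}) (c {e}) A + conv (c {e}) (c {e, f}) A"
          unfolding c_def using ef inD efgh(2) aW ne enA ee finA by (intro tree_pairs_one_link) auto
        then show ?thesis using False ef ct[OF inD(1)]
          unfolding at by (auto simp: insert_commute)
      qed
    next
      case False
      note ef = this
      show ?thesis
      proof (cases "a g \<noteq> v \<and> a h \<noteq> v")
        case True
        have "tree_pairs W ?en (insert g A) = conv (c {g, h}) (c {g}) A + conv (c {g}) (c {g, h}) A"
          unfolding c_def using True inD efgh(2) aW ne enA ee finA by (intro tree_pairs_one_link) auto
        then show ?thesis using True ef ct[OF inD(3)]
          unfolding at by (auto simp: insert_commute)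
      next
        case False
        have "tree_pairs W ?en A = tree_pairs W en A" using enA by (rule tree_pairs_cong)
        then show ?thesis using False ef
          unfolding at by (auto simp: tree_pairs_def t_def)
      qed
    qed
  qed
  have cardA: "card A + card D' + 4 \<ge> 2 * card V"
  proof -
    have "card E = card {e \<in> E. v \<in> en e} + card {e \<in> E. v \<notin> en e}"
      using finE by (subst card_Un_disjoint[symmetric]) (auto intro: arg_cong[where f = card])
    moreover have "card {e \<in> E. v \<notin> en e} = card D' + card A"
      unfolding Ev using finA disj by (intro card_Un_disjoint) (auto simp: D'_def)
    ultimately show ?thesis using quartic_incident_le[OF q v(1)] cE by linarith
  qed
  have cardW: "card W + 2 = card V"
  proof -
    have "card (V - {v, x}) = card V - card {v, x}" using x v finV by (intro card_Diff_subset) auto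
    moreover have "card {v, x} \<le> card V" using x v finV by (intro card_mono) auto
    ultimately show ?thesis using v by (simp add: W_def)
  qed
  \<comment> \<open>With at least three edges from \<open>x\<close> to \<open>v\<close>, too many
    edges remain in \<open>A\<close> for two trees on \<open>W\<close>.\<close>
  have Z1: "conv t t A = 0" if "card D' \<le> 1"
  proof -
    have "tree_pairs W en A = 0" using finA that cardA cardW by (intro tree_pairs_eq_0) linarith+
    then show ?thesis by (simp add: tree_pairs_def t_def)
  qed
  \<comment> \<open>With exactly two edges from \<open>x\<close> to \<open>v\<close>, the pairing
    that joins them makes a loop at \<open>v\<close>. The loop uses up degree of \<open>v\<close>,
    so too many edges avoid \<open>v\<close>.\<close>
  have Z2: "conv (c {e, f}) t A = 0" "conv t (c {e, f}) A = 0"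
    if "card D' = 2" "e \<noteq> f" "e \<in> {e1, e2, e3, e4}" "a e \<noteq> v" for e f
  proof -
    have "conv (c {e, f}) (c {e}) A = 0" "conv (c {e}) (c {e, f}) A = 0"
      unfolding c_def using finA that cardA cardW by (intro conv_forests_eq_0; simp)+
    then show "conv (c {e, f}) t A = 0" "conv t (c {e, f}) A = 0" using ct that by auto
  qed
  have four: "c {e1, e2, e3} F + c {e1, e2, e4} F + c {e1, e3, e4} F + c {e2, e3, e4} F
      = link_two W en a e1 e2 e3 e4 F + link_two W en a e1 e3 e2 e4 F + link_two W en a e1 e4 e2 e3 F"
    if "F \<subseteq> A" "D' = {e1, e2, e3, e4}" for F
  proof -
    have "a e \<noteq> v" if "e \<in> {e1, e2, e3, e4}" for e
      using that \<open>D' = {e1, e2, e3, e4}\<close> unfolding D'_def by blast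
    then have "a e \<in> W" if "e \<in> {e1, e2, e3, e4}" for e using aW that by blast
    then show ?thesis unfolding c_def
      using dist Aends that finite_subset[OF that(1) finA] by (intro forests_four) auto
  qed
  have four1: "conv t (c {e1, e2, e3}) A + conv t (c {e1, e2, e4}) A + conv t (c {e1, e3, e4}) A + conv t (c {e2, e3, e4}) A
      = conv t (link_two W en a e1 e2 e3 e4) A + conv t (link_two W en a e1 e3 e2 e4) A + conv t (link_two W en a e1 e4 e2 e3) A"
    if "D' = {e1, e2, e3, e4}"
    unfolding conv_add[symmetric] by (rule conv_cong) (auto simp: four that)
  have four2: "conv (c {e1, e2, e3}) t A + conv (c {e1, e2, e4}) t A + conv (c {e1, e3, e4}) t A + conv (c {e2, e3, e4}) t A
      = conv (link_two W en a e1 e2 e3 e4) t A + conv (link_two W en a e1 e3 e2 e4) t A + conv (link_two W en a e1 e4 e2 e3) t A"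
    if "D' = {e1, e2, e3, e4}"
    unfolding conv_add[symmetric] by (rule conv_cong) (auto simp: four that)
  have T1: "{e1, e2, e3, e4} = {e1, e2, e3, e4}" "{e1, e3, e2, e4} = {e1, e2, e3, e4}"
    "{e1, e4, e2, e3} = {e1, e2, e3, e4}" by auto
  have T2: "distinct [e1, e2, e3, e4]" "distinct [e1, e3, e2, e4]" "distinct [e1, e4, e2, e3]"
    using dist by auto
  note TT = T[OF T1(1) T2(1)] T[OF T1(2) T2(2)] T[OF T1(3) T2(3)]
  have ne: "e1 \<noteq> e2" "e1 \<noteq> e3" "e1 \<noteq> e4" "e2 \<noteq> e3" "e2 \<noteq> e4" "e3 \<noteq> e4"
    "e2 \<noteq> e1" "e3 \<noteq> e1" "e4 \<noteq> e1" "e3 \<noteq> e2" "e4 \<noteq> e2" "e4 \<noteq> e3" using dist by auto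
  let ?ins = "\<lambda>e X. if a e \<noteq> v then insert e X else X"
  have D'_eq: "D' = ?ins e1 (?ins e2 (?ins e3 (?ins e4 {})))"
    by (auto simp: D'_def)
  show ?thesis
    \<comment> \<open>Sixteen cases, according to which of the four edges at \<open>x\<close> lead
      to \<open>v\<close>.\<close>
    unfolding L TT using four1 four2 Z1 Z2 ct
    by (cases "a e1 = v"; cases "a e2 = v"; cases "a e3 = v"; cases "a e4 = v"; simp add: D'_eq sum_Pow_insert insert_Diff_if ne c0)
qed

text \<open>Every vertex other than \<open>x\<close> keeps its half-edges: the four released at
  \<open>x\<close> are only rejoined in pairs. Two vertices' worth of half-edges, that is two edges,
  are lost with \<open>x\<close>.\<close>

lemma quartic_split:
  fixes a :: "'e \<Rightarrow> 'v"
  assumes q: "quartic V en E" and x: "x \<in> V"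
    and D: "{d \<in> E. x \<in> en d} = {e, f, g, h}" and dist: "distinct [e, f, g, h]"
    and a: "\<And>d. d \<in> {e, f, g, h} \<Longrightarrow> en d = {x, a d}"
    and ax: "\<And>d. d \<in> {e, f, g, h} \<Longrightarrow> a d \<noteq> x"
  shows "quartic (V - {x}) (split_ends en a e f g h) (E - {f, h})"
proof -
  let ?en = "split_ends en a e f g h"
  have finV: "finite V" and finE: "finite E" and ends: "\<And>e. e \<in> E \<Longrightarrow> \<exists>p\<in>V. \<exists>q\<in>V. en e = {p, q}"
    and cE: "card E = 2 * card V"
    and deg: "\<And>u. u \<in> V \<Longrightarrow> (\<Sum>e\<in>E. of_bool (u \<in> en e) + of_bool (en e = {u})) = (4::nat)"
    using q by (auto simp: quartic_def)
  have Din: "{e, f, g, h} \<subseteq> E" using D by blast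
  have ee: "?en e = {a e, a f}" "?en g = {a g, a h}" using dist by (auto simp: split_ends_def)
  have aV: "a d \<in> V - {x}" if dD: "d \<in> {e, f, g, h}" for d
  proof -
    have "d \<in> E" using dD Din by (rule subsetD[rotated])
    then obtain p q where "p \<in> V" "q \<in> V" "en d = {p, q}" using ends[of d] by blast
    then show ?thesis using a[OF dD] ax[OF dD] by (auto simp: doubleton_eq_iff)
  qed
  define B where "B = E - {e, f, g, h}"
  have B: "d \<in> E" "x \<notin> en d" "?en d = en d" if "d \<in> B" for d
    using that D by (auto simp: B_def split_ends_def)
  have E1: "E = insert e (insert f (insert g (insert h B)))" using Din by (auto simp: B_def)
  have E2: "E - {f, h} = insert e (insert g B)" using Din dist by (auto simp: B_def)
  have nB: "e \<notin> B" "f \<notin> B" "g \<notin> B" "h \<notin> B" "finite B" using finE by (auto simp: B_def)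
  have ends': "\<exists>p\<in>V - {x}. \<exists>q\<in>V - {x}. ?en d = {p, q}" if dE: "d \<in> E - {f, h}" for d
  proof -
    consider "d = e" | "d = g" | "d \<in> B" using dE unfolding E2 by blast
    then show ?thesis
    proof cases
      case 1
      have "a e \<in> V - {x}" "a f \<in> V - {x}" by (simp_all only: aV insertI1 insertI2)
      then show ?thesis using 1 ee by blast
    next
      case 2
      have "a g \<in> V - {x}" "a h \<in> V - {x}" by (simp_all only: aV insertI1 insertI2)
      then show ?thesis using 2 ee by blast
    next
      case 3
      obtain p q where "p \<in> V" "q \<in> V" "en d = {p, q}" using ends[OF B(1)[OF 3]] by blast
      then show ?thesis using B[OF 3] by auto
    qed
  qed
  have card: "card (E - {f, h}) = 2 * card (V - {x})"
  proof -
    have "card (E - {f, h}) = card E - 2"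
      using card_Diff_subset[of "{f, h}" E] Din dist by simp
    then show ?thesis using cE x finV by simp
  qed
  have deg': "(\<Sum>d\<in>E - {f, h}. of_bool (u \<in> ?en d) + of_bool (?en d = {u})) = (4::nat)"
    if u: "u \<in> V - {x}" for u
  proof -
    let ?p = "\<lambda>d. of_bool (u \<in> en d) + of_bool (en d = {u}) :: nat"
    let ?p' = "\<lambda>d. of_bool (u \<in> ?en d) + of_bool (?en d = {u}) :: nat"
    have pD: "?p d = of_bool (a d = u)" if "d \<in> {e, f, g, h}" for d
      using a[OF that] ax[OF that] u by (auto simp: of_bool_def)
    have pB: "sum ?p' B = sum ?p B" using B by (intro sum.cong) auto
    have ps: "?p e = of_bool (a e = u)" "?p f = of_bool (a f = u)"
      "?p g = of_bool (a g = u)" "?p h = of_bool (a h = u)" by (simp_all only: pD insertI1 insertI2)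
    have p': "?p' e = of_bool (a e = u) + of_bool (a f = u)" "?p' g = of_bool (a g = u) + of_bool (a h = u)"
      unfolding ee by (auto simp: of_bool_def)
    have "sum ?p' (E - {f, h}) = ?p' e + (?p' g + sum ?p' B)"
      unfolding E2 using nB dist by simp
    also have "\<dots> = ?p e + (?p f + (?p g + (?p h + sum ?p B)))"
      unfolding p' ps pB by simp
    also have "\<dots> = sum ?p E" unfolding E1 using nB dist by simp
    finally show ?thesis using deg[of u] u by simp
  qed
  show ?thesis unfolding quartic_def using finV finE ends' card deg' by blast
qed

text \<open>If all four edges meet \<open>v\<close>, they already exhaust its degree, so none of
  them is a loop at \<open>v\<close> and each one also meets \<open>w\<close>.\<close>

lemma quartic_two_vertices:
  assumes q: "quartic {v, w} en E" and "v \<noteq> w" and no: "{e \<in> E. v \<notin> en e} = {}"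
  shows "{e \<in> E. w \<notin> en e} = {}"
proof -
  have finE: "finite E" and cE: "card E = 4"
    and ends: "\<And>e. e \<in> E \<Longrightarrow> \<exists>p\<in>{v, w}. \<exists>q\<in>{v, w}. en e = {p, q}"
    and deg: "(\<Sum>e\<in>E. of_bool (v \<in> en e) + of_bool (en e = {v})) = (4::nat)"
    using q assms(2) by (auto simp: quartic_def)
  have "(\<Sum>e\<in>E. of_bool (v \<in> en e) + of_bool (en e = {v})) = (\<Sum>e\<in>E. 1 + of_bool (en e = {v}) :: nat)"
    using no by (intro sum.cong) auto
  also have "\<dots> = 4 + (\<Sum>e\<in>E. of_bool (en e = {v}))" unfolding sum.distrib using cE by simp
  finally have "(\<Sum>e\<in>E. of_bool (en e = {v})) = (0::nat)" using deg by simp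
  then have nl: "en e \<noteq> {v}" if "e \<in> E" for e
    using that finE by (simp del: sum_of_bool_eq)
  have "w \<in> en e" if eE: "e \<in> E" for e
    using ends[OF eE] nl[OF eE] by auto
  then show ?thesis by blast
qed

theorem tree_pairs_at_eq:
  fixes V :: "'v set" and en :: "'e \<Rightarrow> 'v set"
  assumes "quartic V en E" "v \<in> V" "w \<in> V"
  shows "tree_pairs_at V en E v = tree_pairs_at V en E w"
  using assms
proof (induction "card V" arbitrary: V en E rule: less_induct)
  case less
  note q = less.prems(1)
  have finV: "finite V" and finE: "finite E" and ends: "\<And>e. e \<in> E \<Longrightarrow> \<exists>p\<in>V. \<exists>q\<in>V. en e = {p, q}"
    using q by (auto simp: quartic_def)
  consider "v = w" | "v \<noteq> w" "V = {v, w}" | x where "v \<noteq> w" "x \<in> V" "x \<noteq> v" "x \<noteq> w"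
    using less.prems by blast
  then show ?case
  proof cases
    case 1
    then show ?thesis by simp
  next
    case 2
    \<comment> \<open>On a single vertex the empty edge set is the only tree.\<close>
    have one: "tree_pairs_at V en E u = of_bool ({e \<in> E. u \<notin> en e} = {})" if u: "V - {u} = {z}" for u z
    proof (cases "{e \<in> E. u \<notin> en e} = {}")
      case True
      then show ?thesis unfolding tree_pairs_at_def u True
        by (simp add: tree_pairs_def conv_empty tree_def)
    next
      case False
      then have "card {e \<in> E. u \<notin> en e} \<noteq> 0" using finE by simp
      then show ?thesis using False finE unfolding tree_pairs_at_def u
        by (subst tree_pairs_eq_0) auto
    qed
    have "V - {v} = {w}" "V - {w} = {v}" using 2 by auto
    moreover have "{e \<in> E. v \<notin> en e} = {} \<longleftrightarrow> {e \<in> E. w \<notin> en e} = {}"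
    proof -
      have "quartic {v, w} en E" "quartic {w, v} en E" using q 2(2) by (simp_all add: insert_commute)
      then show ?thesis using quartic_two_vertices[of v w en E] quartic_two_vertices[of w v en E] 2(1) by argo
    qed
    ultimately show ?thesis using one by simp
  next
    case 3
    note x = this
    show ?thesis
    proof (cases "\<exists>e\<in>E. en e = {x}")
      case True
      then obtain e where e: "e \<in> E" "en e = {x}" by blast
      \<comment> \<open>The loop at \<open>x\<close> survives the deletion of either vertex, and no
        tree contains it.\<close>
      have "tree_pairs_at V en E u = 0" if "x \<noteq> u" for u
        unfolding tree_pairs_at_def
      proof (rule tree_pairs_loop)
        show "\<forall>e\<in>{e \<in> E. u \<notin> en e}. \<exists>p q. en e = {p, q}" using ends by blast
      qed (use finE e x that in auto)
      then show ?thesis using x by simp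
    next
      case False
      have "card {e \<in> E. x \<in> en e} = 4" using quartic_degree[OF q x(2)] False by blast
      moreover obtain es where "distinct es" "set es = {e \<in> E. x \<in> en e}"
        using finite_distinct_list[of "{e \<in> E. x \<in> en e}"] finE by auto
      ultimately have "length es = 4" using distinct_card by metis
      then obtain e1 e2 e3 e4 where "es = [e1, e2, e3, e4]"
        by (auto simp: numeral_eq_Suc length_Suc_conv)
      then have D: "{e \<in> E. x \<in> en e} = {e1, e2, e3, e4}" and dist: "distinct [e1, e2, e3, e4]"
        using \<open>distinct es\<close> \<open>set es = _\<close> by auto
      have "\<exists>b. en e = {x, b} \<and> b \<noteq> x" if eD: "e \<in> {e1, e2, e3, e4}" for e
      proof -
        have e: "e \<in> E" "x \<in> en e" using eD unfolding D[symmetric] by auto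
        obtain p q where pq: "en e = {p, q}" using ends[OF e(1)] by blast
        have "en e \<noteq> {x}" using False e by blast
        then show ?thesis using e pq by auto
      qed
      then obtain a where a: "\<And>e. e \<in> {e1, e2, e3, e4} \<Longrightarrow> en e = {x, a e}"
        and ax: "\<And>e. e \<in> {e1, e2, e3, e4} \<Longrightarrow> a e \<noteq> x" by metis
      have P: "{e1, e3, e2, e4} = {e1, e2, e3, e4}" "{e1, e4, e2, e3} = {e1, e2, e3, e4}" by auto
      have IH: "tree_pairs_at (V - {x}) en' E' v = tree_pairs_at (V - {x}) en' E' w"
        if "quartic (V - {x}) en' E'" for en' and E' :: "'e set"
        using less.hyps[OF _ that] x less.prems card_Diff1_less[OF finV x(2)] by simp
      have q1: "quartic (V - {x}) (split_ends en a e1 e2 e3 e4) (E - {e2, e4})"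
        using dist by (intro quartic_split[OF q x(2) D _ a ax]) auto
      have q2: "quartic (V - {x}) (split_ends en a e1 e3 e2 e4) (E - {e3, e4})"
        using dist by (intro quartic_split[OF q x(2) D[folded P(1)] _ a[folded P(1)] ax[folded P(1)]]) auto
      have q3: "quartic (V - {x}) (split_ends en a e1 e4 e2 e3) (E - {e4, e3})"
        using dist by (intro quartic_split[OF q x(2) D[folded P(2)] _ a[folded P(2)] ax[folded P(2)]]) auto
      have "tree_pairs_at V en E v =
          tree_pairs_at (V - {x}) (split_ends en a e1 e2 e3 e4) (E - {e2, e4}) v
        + tree_pairs_at (V - {x}) (split_ends en a e1 e3 e2 e4) (E - {e3, e4}) v
        + tree_pairs_at (V - {x}) (split_ends en a e1 e4 e2 e3) (E - {e4, e3}) v"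
        using x less.prems by (intro tree_pairs_at_split[OF q x(2) _ _ _ _ _ D dist a ax, where w = w]) auto
      moreover have "tree_pairs_at V en E w =
          tree_pairs_at (V - {x}) (split_ends en a e1 e2 e3 e4) (E - {e2, e4}) w
        + tree_pairs_at (V - {x}) (split_ends en a e1 e3 e2 e4) (E - {e3, e4}) w
        + tree_pairs_at (V - {x}) (split_ends en a e1 e4 e2 e3) (E - {e4, e3}) w"
        using x less.prems by (intro tree_pairs_at_split[OF q x(2) _ _ _ _ _ D dist a ax, where w = v]) auto
      ultimately show ?thesis using IH[OF q1] IH[OF q2] IH[OF q3] by simp
    qed
  qed
qed

section \<open>Dodgson's identity modulo 2\<close>

text \<open>Modulo 2, its cardinality is the value of a spanning forest polynomial at the point
  whose coordinates vanish exactly on \<open>Z\<close>: the monomial of \<open>F\<close> is the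
  product over \<open>A - F\<close> and survives iff \<open>Z \<subseteq> F\<close>.\<close>

definition forests_above ::
    "nat \<Rightarrow> 'v set \<Rightarrow> ('e \<Rightarrow> 'v set) \<Rightarrow> 'e set \<Rightarrow> 'e set \<Rightarrow> 'v set \<Rightarrow> 'e set set" where
  "forests_above k W en A Z Q = {F. Z \<subseteq> F \<and> F \<subseteq> A \<and> rooted_forest k W en F Q}"

lemma finite_forests_above: "finite A \<Longrightarrow> finite (forests_above k W en A Z Q)"
  by (rule finite_subset[of _ "Pow A"]) (auto simp: forests_above_def)

lemma odd_card_Sigma:
  assumes "finite I" "\<And>i. i \<in> I \<Longrightarrow> finite (B i)"
  shows "odd (card (Sigma I B)) \<longleftrightarrow> odd (card {i \<in> I. odd (card (B i))})"
  using assms by (subst card_SigmaI) (auto simp: even_sum_iff)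

text \<open>Moving an edge \<open>e\<close> from a
  spanning tree \<open>T\<close> to a 3-forest \<open>F\<close> is a bijection between triples \<open>(F, T, e)\<close> and triples
  \<open>(F', G, e)\<close> with 2-forests \<open>F'\<close> and \<open>G\<close>; the numbers of admissible \<open>e\<close> for fixed \<open>(F, T)\<close> and for
  fixed \<open>(F', G)\<close> are known modulo 2.\<close>

lemma dodgson_mod_2:
  fixes W :: "'v set" and en :: "'e \<Rightarrow> 'v set" and Z :: "'e set"
  assumes finA: "finite A" and ends: "\<And>e. e \<in> A \<Longrightarrow> \<exists>s\<in>W. \<exists>t\<in>W. en e = {s, t}"
    and W: "p \<in> W" "q \<in> W" "r \<in> W"
  defines "N \<equiv> \<lambda>k Q. forests_above k W en A Z Q"
  shows "even (card (N 1 {p}) * card (N 3 {p, q, r}) + card (N 2 {p, q}) * card (N 2 {p, r})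
    + card {F \<in> N 2 {p, r}. conn (en ` F) q r})"
proof -
  define cross where "cross = (\<lambda>e C. en e \<inter> C \<noteq> {} \<and> \<not> en e \<subseteq> C)"
  define comp where "comp = (\<lambda>F. {u. conn (en ` F) u r})"
  \<comment> \<open>\<open>BL\<close> consists of the edges on the path of \<open>T\<close> from
    \<open>p\<close> to \<open>r\<close> that cross the boundary of the component of
    \<open>r\<close> in \<open>F\<close>. In \<open>BR\<close> the path belongs to the 2-forest
    \<open>F\<close> and leads from \<open>r\<close> to the root it is connected with,
    \<open>p\<close> or \<open>q\<close>; the component is that of \<open>r\<close> in
    \<open>G\<close>.\<close>
  define BL where "BL = (\<lambda>(F, T). {e \<in> T. \<not> conn (en ` (T - {e})) p r \<and> cross e (comp F)})"
  define BR where "BR = (\<lambda>(F, G). {e \<in> F. cross e (comp G) \<and>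
     (conn (en ` F) r p \<and> \<not> conn (en ` (F - {e})) p r \<or> conn (en ` F) r q \<and> \<not> conn (en ` (F - {e})) q r)})"
  have NI: "F \<in> N k Q \<longleftrightarrow> Z \<subseteq> F \<and> F \<subseteq> A \<and> card F + k = card W \<and> covers W (en ` F) Q" for F k Q
    by (simp add: N_def forests_above_def rooted_forest_def)
  have finN: "finite (N k Q)" for k Q using finA by (simp add: N_def finite_forests_above)
  have fin: "finite F" if "F \<in> N k Q" for F k Q using that finA finite_subset by (auto simp: NI)
  have pairs: "\<forall>e\<in>F. \<exists>s t. en e = {s, t}" if "F \<in> N k Q" for F k Q
    using that ends by (fastforce simp: NI)
  have rf: "rooted_forest k W en F Q" if "F \<in> N k Q" for F k Q
    using that by (simp add: rooted_forest_def NI)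
  have br: "\<not> conn (en ` (F - {e})) s t" if "F \<in> N k Q" "finite Q" "card Q \<le> k" "e \<in> F" "en e = {s, t}"
    for F k Q e s t
    using bridge[OF fin[OF that(1)] pairs[OF that(1)] rf[OF that(1)]] that by blast
  have nc: "\<not> conn (en ` F) s t" if "F \<in> N k Q" "finite Q" "card Q \<le> k" "s \<in> Q" "t \<in> Q" "s \<noteq> t"
    for F k Q s t
    using not_conn_roots[OF fin[OF that(1)] pairs[OF that(1)] rf[OF that(1)]] that by blast
  have lb: "k \<le> card Q" if "F \<in> N k Q" "finite Q" for F k Q
    using card_le_covers[OF fin[OF that(1)] pairs[OF that(1)] that(2)] that(1) by (force simp: NI)
  have c2: "card {a, b} \<le> 2" for a b :: 'v by (simp add: card_insert_if)
  have c3: "card {a, b, c} \<le> 3" for a b c :: 'v by (simp add: card_insert_if)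
  have ins: "conn (en ` insert e F) u w \<longleftrightarrow> conn (en ` F) u w \<or> conn (en ` F) u s \<and> conn (en ` F) t w
      \<or> conn (en ` F) u t \<and> conn (en ` F) s w" if "en e = {s, t}" for e F s t u w
    using conn_insert[of s t "en ` F" u w] that by simp
  have crossE: "\<exists>s t. en e = {s, t} \<and> s \<in> W \<and> t \<in> W \<and> conn (en ` F) s r \<and> \<not> conn (en ` F) t r"
    if eA: "e \<in> A" and cr: "cross e (comp F)" for e F
  proof -
    obtain s t where "s \<in> W" "t \<in> W" "en e = {s, t}" using ends[OF eA] by blast
    moreover have "{s, t} = {t, s}" by auto
    ultimately show ?thesis using cr unfolding cross_def comp_def by auto
  qed
  have crossI: "cross e (comp F)" if "en e = {s, t}" "conn (en ` F) s r" "\<not> conn (en ` F) t r" for e F s t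
    using that by (auto simp: cross_def comp_def)
  have cross_notin: "e \<notin> F" if ecr: "e \<in> A" "cross e (comp F)" for e F
  proof
    assume eF: "e \<in> F"
    obtain s t where st: "en e = {s, t}" "conn (en ` F) s r" "\<not> conn (en ` F) t r"
      using crossE[OF ecr] by blast
    have "conn (en ` F) t s" using eF st(1) by (intro conn_edge) (metis image_eqI insert_commute)
    then show False using st conn_trans by fast
  qed
  have fwd: "insert e F \<in> N 2 {p, q} \<and> T - {e} \<in> N 2 {p, r} \<and> e \<in> BR (insert e F, T - {e}) \<and> e \<notin> F"
    if F: "F \<in> N 3 {p, q, r}" and T: "T \<in> N 1 {p}" and e: "e \<in> BL (F, T)" for F T e
  proof -
    have eT: "e \<in> T" and sep: "\<not> conn (en ` (T - {e})) p r" and cr: "cross e (comp F)"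
      using e by (auto simp: BL_def)
    have eA: "e \<in> A" using eT T by (auto simp: NI)
    have eF: "e \<notin> F" using cross_notin eA cr by blast
    obtain s t where st: "en e = {s, t}" "s \<in> W" "t \<in> W" "conn (en ` F) s r" "\<not> conn (en ` F) t r"
      using crossE[OF eA cr] by blast
    \<comment> \<open>The roots may coincide a priori, but a forest with three components needs
      three roots.\<close>
    have "3 \<le> card {p, q, r}" using lb[OF F] by simp
    then have dist: "p \<noteq> q" "p \<noteq> r" "q \<noteq> r" by (auto simp: card_insert_if split: if_splits)
    have ncF: "\<not> conn (en ` F) p r" "\<not> conn (en ` F) q r" using nc[OF F _ c3] dist by auto
    have tpq: "conn (en ` F) t p \<or> conn (en ` F) t q" using F st by (auto simp: NI covers_def)
    let ?F = "insert e F"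
    have "\<exists>c\<in>{p, q}. conn (en ` ?F) u c" if u: "u \<in> W" for u
    proof -
      have "conn (en ` F) u p \<or> conn (en ` F) u q \<or> conn (en ` F) u r" using F u by (auto simp: NI covers_def)
      moreover have "conn (en ` F) u s" if "conn (en ` F) u r" using that st(4) conn_sym conn_trans by fast
      ultimately show ?thesis using tpq by (auto simp: ins[OF st(1)] simp del: image_insert)
    qed
    then have cov: "covers W (en ` ?F) {p, q}" by (simp add: covers_def)
    have F2: "?F \<in> N 2 {p, q}" using F eF eA cov fin[OF F] by (auto simp: NI)
    have rpq: "conn (en ` F) t c \<Longrightarrow> conn (en ` ?F) r c" for c
      using conn_sym[OF st(4)] by (auto simp: ins[OF st(1)] simp del: image_insert)
    have Fe: "?F - {e} = F" using eF by simp
    let ?G = "T - {e}"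
    have TG: "T = insert e ?G" using eT by auto
    have "conn (en ` T) r p" using T W by (auto simp: NI covers_def)
    then have rp: "conn (en ` ?G) r s \<and> conn (en ` ?G) t p \<or> conn (en ` ?G) r t \<and> conn (en ` ?G) s p"
      using sep conn_sym TG ins[OF st(1), of ?G r p] by metis
    have "conn (en ` ?G) u p \<or> conn (en ` ?G) u r" if u: "u \<in> W" for u
    proof -
      have "conn (en ` T) u p" using T u by (auto simp: NI covers_def)
      then have "conn (en ` ?G) u p \<or> conn (en ` ?G) u s \<or> conn (en ` ?G) u t"
        using TG ins[OF st(1), of ?G u p] by metis
      then show ?thesis using rp conn_sym conn_trans by fast
    qed
    then have covG: "covers W (en ` ?G) {p, r}" by (simp add: covers_def)
    have eZ: "e \<notin> Z" using F eF by (auto simp: NI)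
    have "card ?G + 2 = card W" using T eT fin[OF T] card_Suc_Diff1[of T e] by (auto simp: NI)
    then have G2: "?G \<in> N 2 {p, r}" using T eZ covG by (auto simp: NI)
    have crG: "cross e (comp ?G)"
    proof -
      have "conn (en ` ?G) s r \<and> \<not> conn (en ` ?G) t r \<or> conn (en ` ?G) t r \<and> \<not> conn (en ` ?G) s r"
        using rp sep conn_sym conn_trans by meson
      moreover have "en e = {t, s}" using st(1) by auto
      ultimately show ?thesis using crossI st(1) by blast
    qed
    have "e \<in> BR (?F, ?G)"
      unfolding BR_def using crG rpq tpq ncF Fe by auto
    then show ?thesis using F2 G2 eF by blast
  qed
  have bwd: "F - {e} \<in> N 3 {p, q, r} \<and> insert e G \<in> N 1 {p} \<and> e \<in> BL (F - {e}, insert e G) \<and> e \<notin> G \<and> e \<in> F"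
    if F: "F \<in> N 2 {p, q}" and G: "G \<in> N 2 {p, r}" and e: "e \<in> BR (F, G)" for F G e
  proof -
    have eF: "e \<in> F" and cr: "cross e (comp G)"
      and alt: "\<exists>c\<in>{p, q}. conn (en ` F) r c \<and> \<not> conn (en ` (F - {e})) c r"
      using e by (auto simp: BR_def)
    have eA: "e \<in> A" using eF F by (auto simp: NI)
    have eG: "e \<notin> G" using cross_notin eA cr by blast
    obtain s t where st: "en e = {s, t}" "s \<in> W" "t \<in> W" "conn (en ` G) s r" "\<not> conn (en ` G) t r"
      using crossE[OF eA cr] by blast
    have "2 \<le> card {p, r}" using lb[OF G] by simp
    then have pr: "p \<noteq> r" by auto
    have ncG: "\<not> conn (en ` G) p r" using nc[OF G _ c2] pr by auto
    have tp: "conn (en ` G) t p" using G st by (auto simp: NI covers_def)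
    have "conn (en ` insert e G) u p" if u: "u \<in> W" for u
    proof -
      have "conn (en ` G) u p \<or> conn (en ` G) u r" using G u by (auto simp: NI covers_def)
      moreover have "conn (en ` G) u s" if "conn (en ` G) u r" using that st(4) conn_sym conn_trans by fast
      ultimately show ?thesis using tp by (auto simp: ins[OF st(1)] simp del: image_insert)
    qed
    then have "covers W (en ` insert e G) {p}" by (simp add: covers_def)
    then have T1: "insert e G \<in> N 1 {p}" using G eG eA fin[OF G] by (auto simp: NI)
    have Ge: "insert e G - {e} = G" using eG by simp
    let ?F = "F - {e}"
    have FF: "F = insert e ?F" using eF by auto
    obtain c where c: "c \<in> {p, q}" "conn (en ` F) r c" "\<not> conn (en ` ?F) c r" using alt by blast
    have rc: "conn (en ` ?F) r s \<and> conn (en ` ?F) t c \<or> conn (en ` ?F) r t \<and> conn (en ` ?F) s c"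
      using c(2,3) conn_sym FF ins[OF st(1), of ?F r c] by metis
    have "\<exists>d\<in>{p, q, r}. conn (en ` ?F) u d" if u: "u \<in> W" for u
    proof -
      obtain d where d: "d \<in> {p, q}" "conn (en ` F) u d" using F u unfolding NI covers_def by blast
      then have "conn (en ` ?F) u d \<or> conn (en ` ?F) u s \<or> conn (en ` ?F) u t"
        using FF ins[OF st(1), of ?F u d] by metis
      then have "conn (en ` ?F) u d \<or> conn (en ` ?F) u r \<or> conn (en ` ?F) u c"
        using rc conn_sym conn_trans by fast
      then show ?thesis using c(1) d(1) by blast
    qed
    then have cov: "covers W (en ` ?F) {p, q, r}" by (simp add: covers_def)
    have eZ: "e \<notin> Z" using G eG by (auto simp: NI)
    have "card ?F + 3 = card W" using F eF fin[OF F] card_Suc_Diff1[of F e] by (auto simp: NI)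
    then have F3: "?F \<in> N 3 {p, q, r}" using F eZ cov by (auto simp: NI)
    have "cross e (comp ?F)"
    proof -
      have "conn (en ` ?F) s r \<and> \<not> conn (en ` ?F) t r \<or> conn (en ` ?F) t r \<and> \<not> conn (en ` ?F) s r"
        using rc c(3) conn_sym conn_trans by meson
      moreover have "en e = {t, s}" using st(1) by auto
      ultimately show ?thesis using crossI st(1) by blast
    qed
    then have "e \<in> BL (?F, insert e G)" unfolding BL_def using Ge ncG by simp
    then show ?thesis using F3 T1 eG eF by blast
  qed
  let ?L = "Sigma (N 3 {p, q, r} \<times> N 1 {p}) BL" and ?R = "Sigma (N 2 {p, q} \<times> N 2 {p, r}) BR"
  have "bij_betw (\<lambda>((F, T), e). ((insert e F, T - {e}), e)) ?L ?R"
  proof (rule bij_betw_byWitness[where f' = "\<lambda>((F, G), e). ((F - {e}, insert e G), e)"])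
    show "\<forall>x\<in>?L. (\<lambda>((F, G), e). ((F - {e}, insert e G), e)) ((\<lambda>((F, T), e). ((insert e F, T - {e}), e)) x) = x"
      using fwd by (auto simp: BL_def)
    show "\<forall>x\<in>?R. (\<lambda>((F, T), e). ((insert e F, T - {e}), e)) ((\<lambda>((F, G), e). ((F - {e}, insert e G), e)) x) = x"
      using bwd by (auto simp: BR_def)
    show "(\<lambda>((F, T), e). ((insert e F, T - {e}), e)) ` ?L \<subseteq> ?R" using fwd by fastforce
    show "(\<lambda>((F, G), e). ((F - {e}, insert e G), e)) ` ?R \<subseteq> ?L" using bwd by fastforce
  qed
  then have LR: "card ?L = card ?R" by (rule bij_betw_same_card)
  have oL: "odd (card (BL (F, T)))" if F: "F \<in> N 3 {p, q, r}" and T: "T \<in> N 1 {p}" for F T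
  proof -
    have "3 \<le> card {p, q, r}" using lb[OF F] by simp
    then have "p \<noteq> r" by (auto simp: card_insert_if split: if_splits)
    then have "\<not> conn (en ` F) p r" using nc[OF F _ c3] by auto
    \<comment> \<open>The path in \<open>T\<close> runs from outside the component of
      \<open>r\<close> to its inside, so it crosses the boundary an odd number of times.\<close>
    then have C: "p \<notin> comp F" "r \<in> comp F" by (auto simp: comp_def)
    have "conn (en ` T) p r" using T W conn_sym by (force simp: NI covers_def)
    moreover have "\<not> conn (en ` (T - {e})) s t" if "e \<in> T" "en e = {s, t}" for e s t
      using br[OF T] that by simp
    ultimately have "odd (card (BL (F, T))) \<longleftrightarrow> (p \<in> comp F) \<noteq> (r \<in> comp F)"
      unfolding BL_def cross_def prod.case using fin[OF T] by (intro odd_crossings)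
    then show ?thesis using C by simp
  qed
  \<comment> \<open>The path in \<open>F\<close> has the end \<open>r\<close> inside
    \<open>comp G\<close>. The other end is outside if it is \<open>p\<close>, but it may be inside
    if it is \<open>q\<close>; then the number of crossings is even.\<close>
  have oR: "odd (card (BR (F, G))) \<longleftrightarrow> \<not> (conn (en ` F) r q \<and> conn (en ` G) q r)"
    if F: "F \<in> N 2 {p, q}" and G: "G \<in> N 2 {p, r}" for F G
  proof -
    have "2 \<le> card {p, r}" "2 \<le> card {p, q}" using lb[OF G] lb[OF F] by simp_all
    then have d: "p \<noteq> r" "p \<noteq> q" by auto
    have C: "p \<notin> comp G" "r \<in> comp G" "q \<in> comp G \<longleftrightarrow> conn (en ` G) q r"
      using nc[OF G _ c2] d by (auto simp: comp_def)
    have pq: "\<not> conn (en ` F) p q" using nc[OF F _ c2] d by auto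
    have brF: "\<not> conn (en ` (F - {e})) s t" if "e \<in> F" "en e = {s, t}" for e s t
      using br[OF F _ c2] that by simp
    have rpq: "conn (en ` F) r p \<or> conn (en ` F) r q" using F W(3) by (auto simp: NI covers_def)
    have not_both: "\<not> (conn (en ` F) r p \<and> conn (en ` F) r q)"
      using pq conn_trans[OF conn_sym, of "en ` F" r p q] by blast
    show ?thesis
    proof (cases "conn (en ` F) r p")
      case True
      then have "BR (F, G) = {e \<in> F. \<not> conn (en ` (F - {e})) p r \<and> en e \<inter> comp G \<noteq> {} \<and> \<not> en e \<subseteq> comp G}"
        using not_both by (auto simp: BR_def cross_def)
      moreover have "odd (card {e \<in> F. \<not> conn (en ` (F - {e})) p r \<and> en e \<inter> comp G \<noteq> {} \<and> \<not> en e \<subseteq> comp G})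
        \<longleftrightarrow> (p \<in> comp G) \<noteq> (r \<in> comp G)"
        using fin[OF F] brF conn_sym[OF True] by (intro odd_crossings)
      ultimately show ?thesis using C True not_both by simp
    next
      case False
      then have q: "conn (en ` F) r q" using rpq by blast
      have "BR (F, G) = {e \<in> F. \<not> conn (en ` (F - {e})) q r \<and> en e \<inter> comp G \<noteq> {} \<and> \<not> en e \<subseteq> comp G}"
        using q False by (auto simp: BR_def cross_def)
      moreover have "odd (card {e \<in> F. \<not> conn (en ` (F - {e})) q r \<and> en e \<inter> comp G \<noteq> {} \<and> \<not> en e \<subseteq> comp G})
        \<longleftrightarrow> (q \<in> comp G) \<noteq> (r \<in> comp G)"
        using fin[OF F] brF conn_sym[OF q] by (intro odd_crossings)
      ultimately show ?thesis using C q by simp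
    qed
  qed
  \<comment> \<open>When \<open>q\<close> and \<open>r\<close> are connected, they are
    interchangeable as roots. So the exceptional \<open>F\<close> and the exceptional
    \<open>G\<close> form the same set, and the exceptional pairs form its square.\<close>
  define Y where "Y = {F \<in> N 2 {p, r}. conn (en ` F) q r}"
  have Y: "Y = {F \<in> N 2 {p, q}. conn (en ` F) r q}"
  proof -
    have "(\<exists>c\<in>{p, r}. conn (en ` F) u c) \<longleftrightarrow> (\<exists>c\<in>{p, q}. conn (en ` F) u c)"
      if "conn (en ` F) q r" for F u
      using conn_trans[OF _ that, of u] conn_trans[OF _ conn_sym[OF that], of u] by auto
    then have "conn (en ` F) q r \<Longrightarrow> F \<in> N 2 {p, r} \<longleftrightarrow> F \<in> N 2 {p, q}" for F by (simp only: NI covers_def)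
    then show ?thesis unfolding Y_def using conn_commute[of _ q r] by blast
  qed
  have finB: "finite (BL i)" if "i \<in> N 3 {p, q, r} \<times> N 1 {p}" for i using that fin by (auto simp: BL_def)
  have finB': "finite (BR i)" if "i \<in> N 2 {p, q} \<times> N 2 {p, r}" for i using that fin by (auto simp: BR_def)
  have "odd (card ?L) \<longleftrightarrow> odd (card (N 3 {p, q, r} \<times> N 1 {p}))"
  proof -
    have "{i \<in> N 3 {p, q, r} \<times> N 1 {p}. odd (card (BL i))} = N 3 {p, q, r} \<times> N 1 {p}" using oL by auto
    then show ?thesis using odd_card_Sigma[of "N 3 {p, q, r} \<times> N 1 {p}" BL] finN finB by simp
  qed
  moreover have "odd (card ?R) \<longleftrightarrow> odd (card (N 2 {p, q} \<times> N 2 {p, r} - Y \<times> Y))"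
  proof -
    have "{i \<in> N 2 {p, q} \<times> N 2 {p, r}. odd (card (BR i))} = N 2 {p, q} \<times> N 2 {p, r} - Y \<times> Y"
      using oR unfolding Y[THEN arg_cong[where f = "\<lambda>X. X \<times> Y"]] by (auto simp: Y_def)
    then show ?thesis using odd_card_Sigma[of "N 2 {p, q} \<times> N 2 {p, r}" BR] finN finB' by simp
  qed
  moreover have "card (N 2 {p, q} \<times> N 2 {p, r} - Y \<times> Y) + card (Y \<times> Y) = card (N 2 {p, q} \<times> N 2 {p, r})"
  proof -
    have sub: "Y \<times> Y \<subseteq> N 2 {p, q} \<times> N 2 {p, r}" using Y by (auto simp: Y_def)
    have "finite (N 2 {p, q} \<times> N 2 {p, r})" using finN by simp
    then show ?thesis using sub by (metis card_Diff_subset card_mono finite_subset le_add_diff_inverse2)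
  qed
  ultimately have "odd (card (N 1 {p}) * card (N 3 {p, q, r})) \<longleftrightarrow>
      odd (card (N 2 {p, q}) * card (N 2 {p, r}) + card Y * card Y)"
    using LR unfolding card_cartesian_product by (metis even_add mult.commute)
  \<comment> \<open>A square has the parity of its base, hence the linear last term of the
    statement.\<close>
  then show ?thesis unfolding Y_def[symmetric] by auto
qed

section \<open>Counting zeros at a vertex of degree 3\<close>

definition trees_above :: "'v set \<Rightarrow> ('e \<Rightarrow> 'v set) \<Rightarrow> 'e set \<Rightarrow> 'e set \<Rightarrow> 'e set set" where
  "trees_above V en E Z = {T. Z \<subseteq> T \<and> T \<subseteq> E \<and> tree V en T}"

text \<open>A point of the affine space over the field with two elements is given by the set \<open>Z\<close> of its
  vanishing coordinates; the Kirchhoff polynomial then counts the spanning trees containing \<open>Z\<close>.\<close>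

definition zero_count :: "'v set \<Rightarrow> ('e \<Rightarrow> 'v set) \<Rightarrow> 'e set \<Rightarrow> nat" where
  "zero_count V en E = (\<Sum>Z\<in>Pow E. of_bool (even (card (trees_above V en E Z))))"

lemma sum_Pow_Un:
  fixes g :: "'e set \<Rightarrow> nat"
  assumes "finite D" "finite A" "D \<inter> A = {}"
  shows "(\<Sum>Z\<in>Pow (D \<union> A). g Z) = (\<Sum>Z\<in>Pow A. \<Sum>I\<in>Pow D. g (I \<union> Z))"
  using conv_union[OF assms, of g "\<lambda>_. 1"] unfolding conv_def
  by (simp add: sum.swap[of _ "Pow D"])

text \<open>The trees are sorted by the set \<open>I\<close> of their edges at \<open>x\<close>, and
  \<open>tree_star\<close> describes what is left of each.\<close>

lemma card_trees_above_star:
  assumes "finite W" "x \<notin> W" "finite D" "finite A" "D \<inter> A = {}"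
    and "\<And>e. e \<in> D \<Longrightarrow> en e = {x, a e}" "\<And>e. e \<in> A \<Longrightarrow> en e \<subseteq> W"
    and "Z1 \<subseteq> D" "Z \<subseteq> A"
  shows "card (trees_above (insert x W) en (D \<union> A) (Z1 \<union> Z)) =
    (\<Sum>I\<in>Pow D. of_bool (Z1 \<subseteq> I) * card (forests_above (card I) W en A Z (a ` I)))"
proof -
  have star: "tree (insert x W) en (I \<union> F) \<longleftrightarrow> rooted_forest (card I) W en F (a ` I)"
    if "I \<subseteq> D" "F \<subseteq> A" for I F
    using that assms(3-5) by (intro tree_star[OF assms(1,2)] assms(6,7)) (auto dest: finite_subset)
  let ?S = "SIGMA I:{I \<in> Pow D. Z1 \<subseteq> I}. forests_above (card I) W en A Z (a ` I)"
  have "bij_betw (\<lambda>(I, F). I \<union> F) ?S (trees_above (insert x W) en (D \<union> A) (Z1 \<union> Z))"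
  proof (rule bij_betw_byWitness[where f' = "\<lambda>T. (T \<inter> D, T \<inter> A)"])
    show "\<forall>y\<in>?S. (\<lambda>T. (T \<inter> D, T \<inter> A)) ((\<lambda>(I, F). I \<union> F) y) = y"
      using assms(5) by (auto simp: forests_above_def)
    show "\<forall>T\<in>trees_above (insert x W) en (D \<union> A) (Z1 \<union> Z). (\<lambda>(I, F). I \<union> F) (T \<inter> D, T \<inter> A) = T"
      by (auto simp: trees_above_def)
    show "(\<lambda>(I, F). I \<union> F) ` ?S \<subseteq> trees_above (insert x W) en (D \<union> A) (Z1 \<union> Z)"
      using star by (auto simp: trees_above_def forests_above_def)
    show "(\<lambda>T. (T \<inter> D, T \<inter> A)) ` trees_above (insert x W) en (D \<union> A) (Z1 \<union> Z) \<subseteq> ?S"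
    proof (rule image_subsetI)
      fix T assume T: "T \<in> trees_above (insert x W) en (D \<union> A) (Z1 \<union> Z)"
      then have "T = (T \<inter> D) \<union> (T \<inter> A)" by (auto simp: trees_above_def)
      then have "tree (insert x W) en ((T \<inter> D) \<union> (T \<inter> A))" using T by (simp add: trees_above_def)
      then have "rooted_forest (card (T \<inter> D)) W en (T \<inter> A) (a ` (T \<inter> D))" using star by simp
      then show "(T \<inter> D, T \<inter> A) \<in> ?S"
        using T assms(8,9) by (auto simp: trees_above_def forests_above_def)
    qed
  qed
  then have "card (trees_above (insert x W) en (D \<union> A) (Z1 \<union> Z)) = card ?S"
    by (simp add: bij_betw_same_card)
  also have "\<dots> = (\<Sum>I\<in>{I \<in> Pow D. Z1 \<subseteq> I}. card (forests_above (card I) W en A Z (a ` I)))"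
    using assms(3,4) by (subst card_SigmaI) (auto simp: finite_forests_above)
  also have "\<dots> = (\<Sum>I\<in>Pow D. of_bool (Z1 \<subseteq> I) * card (forests_above (card I) W en A Z (a ` I)))"
    using assms(3) by (intro sum.mono_neutral_cong_left) auto
  finally show ?thesis .
qed

text \<open>The eight terms test the points of the polynomial f0 (y1 y2 + y1 y3 + y2 y3) + (f2 + f3)
  y1 + (f1 + f3) y2 + (f1 + f2) y3 + g. The hypothesis is Dodgson's identity f0 g = f1 f2 + f1 f3 +
  f2 f3 modulo 2. If f0 is odd, the polynomial is therefore the second elementary symmetric one,
  translated by (f1, f2, f3), and has 4 zeros. If f0 is even, at most one of f1, f2, f3 is odd:
  either the polynomial is affine and nonconstant with 4 zeros, or it is constant with 0 or
  8.\<close>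

lemma even_count_eight:
  fixes f0 f1 f2 f3 g :: nat
  assumes "even (f0 * g + (f1 + f2) * (f1 + f3) + f1)"
  shows "[of_bool (even (3 * f0 + (f1 + f2) + (f1 + f3) + (f2 + f3) + g))
    + of_bool (even (f0 + (f1 + f2) + (f1 + f3) + g)) + of_bool (even (f0 + (f1 + f2) + (f2 + f3) + g))
    + of_bool (even (f0 + (f1 + f3) + (f2 + f3) + g)) + of_bool (even (f1 + f2 + g))
    + of_bool (even (f1 + f3 + g)) + of_bool (even (f2 + f3 + g)) + of_bool (even g)
    = 4 * (f0 + (1 + f0) * (f1 + f2 + f3))] (mod 8)" (is "[?L = 4 * ?h] (mod 8)")
proof -
  have "?L mod 8 = 4 * (?h mod 2)"
    using assms
    by (cases "even f0"; cases "even f1"; cases "even f2"; cases "even f3"; cases "even g")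
      (simp_all add: mod2_eq_if)
  then show ?thesis by (simp add: cong_def mult_mod_right)
qed

text \<open>The spanning 2-forests with \<open>p\<close> in one component and \<open>q\<close>,
  \<open>r\<close> in the other. The separation from \<open>p\<close> is implied by the edge count,
  see \<open>not_conn_roots\<close>.\<close>

definition split_forests :: "'v set \<Rightarrow> ('e \<Rightarrow> 'v set) \<Rightarrow> 'e set \<Rightarrow> 'v \<Rightarrow> 'v \<Rightarrow> 'v \<Rightarrow> 'e set set" where
  "split_forests W en A p q r = {F. F \<subseteq> A \<and> rooted_forest 2 W en F {p, r} \<and> conn (en ` F) q r}"

lemma split_forests_alt:
  "split_forests W en A p q r = {F. F \<subseteq> A \<and> rooted_forest 2 W en F {p, q} \<and> conn (en ` F) q r}"
proof -
  have "rooted_forest 2 W en F {p, r} \<longleftrightarrow> rooted_forest 2 W en F {p, q}" if "conn (en ` F) q r" for F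
    unfolding rooted_forest_def covers_def
    using conn_trans[OF _ that] conn_trans[OF _ conn_sym[OF that]] by auto
  then show ?thesis by (auto simp: split_forests_def)
qed

lemma split_forests_commute: "split_forests W en A p q r = split_forests W en A p r q"
  using split_forests_alt[of W en A p q r] by (auto simp: split_forests_def conn_commute[of _ q r])

text \<open>The two roots lie in different components, and the third vertex belongs to exactly one
  of them.\<close>

lemma rooted_forest_2_cases:
  assumes "finite F" "\<forall>e\<in>F. \<exists>s t. en e = {s, t}" "F \<subseteq> A" "r \<in> W"
  shows "of_bool (rooted_forest 2 W en F {p, q}) =
    (of_bool (F \<in> split_forests W en A p q r) + of_bool (F \<in> split_forests W en A q p r) :: nat)"
proof (cases "rooted_forest 2 W en F {p, q}")
  case False
  then show ?thesis
    using split_forests_alt[of W en A p q r] split_forests_alt[of W en A q p r] by (simp add: insert_commute)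
next
  case True
  have "card W \<le> card F + card {p, q}" using assms True by (intro card_le_covers) (auto simp: rooted_forest_def)
  then have "p \<noteq> q" using True by (auto simp: rooted_forest_def)
  then have "\<not> conn (en ` F) p q" using assms True by (intro not_conn_roots) auto
  then have "\<not> (conn (en ` F) p r \<and> conn (en ` F) q r)" using conn_sym conn_trans by fast
  moreover have "conn (en ` F) r p \<or> conn (en ` F) r q"
    using True assms by (auto simp: rooted_forest_def covers_def)
  then have "conn (en ` F) p r \<or> conn (en ` F) q r" using conn_sym by fast
  moreover have "F \<in> split_forests W en A p q r \<longleftrightarrow> conn (en ` F) q r"
    "F \<in> split_forests W en A q p r \<longleftrightarrow> conn (en ` F) p r"
    using True assms split_forests_alt[of W en A p q r] split_forests_alt[of W en A q p r]
    by (auto simp: insert_commute)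
  ultimately show ?thesis using True by auto
qed

text \<open>A pair is counted once for each \<open>Z \<subseteq> T \<inter> F\<close>, a power of 2
  that is odd only for disjoint sets. In polynomial terms, this extracts the coefficient of the
  product of all variables.\<close>

lemma sum_card_above_prod:
  fixes X Y :: "'e set set"
  assumes "finite A" "X \<subseteq> Pow A" "Y \<subseteq> Pow A"
  shows "[(\<Sum>Z\<in>Pow A. card {T \<in> X. Z \<subseteq> T} * card {F \<in> Y. Z \<subseteq> F}) =
    card {(T, F) \<in> X \<times> Y. T \<inter> F = {}}] (mod 2)"
proof -
  have finX: "finite X" "finite Y" using assms finite_subset by (metis finite_Pow_iff)+
  have "(\<Sum>Z\<in>Pow A. card {T \<in> X. Z \<subseteq> T} * card {F \<in> Y. Z \<subseteq> F}) =
    (\<Sum>Z\<in>Pow A. \<Sum>(T, F)\<in>X \<times> Y. of_bool (Z \<subseteq> T \<inter> F))"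
  proof (rule sum.cong[OF refl])
    fix Z
    have "card {T \<in> X. Z \<subseteq> T} * card {F \<in> Y. Z \<subseteq> F} = card ({T \<in> X. Z \<subseteq> T} \<times> {F \<in> Y. Z \<subseteq> F})"
      by (simp add: card_cartesian_product)
    also have "\<dots> = card ((X \<times> Y) \<inter> {(T, F). Z \<subseteq> T \<inter> F})" by (rule arg_cong[where f = card]) auto
    also have "\<dots> = (\<Sum>(T, F)\<in>X \<times> Y. of_bool (Z \<subseteq> T \<inter> F))"
      using finX by (simp add: split_def)
    finally show "card {T \<in> X. Z \<subseteq> T} * card {F \<in> Y. Z \<subseteq> F} = (\<Sum>(T, F)\<in>X \<times> Y. of_bool (Z \<subseteq> T \<inter> F))" .
  qed
  also have "\<dots> = (\<Sum>(T, F)\<in>X \<times> Y. \<Sum>Z\<in>Pow A. of_bool (Z \<subseteq> T \<inter> F))"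
    by (subst sum.swap) (simp add: split_def)
  also have "\<dots> = (\<Sum>(T, F)\<in>X \<times> Y. 2 ^ card (T \<inter> F))"
  proof (intro sum.cong refl, clarify)
    fix T F assume "T \<in> X" "F \<in> Y"
    then have "Pow A \<inter> {Z. Z \<subseteq> T \<inter> F} = Pow (T \<inter> F)" using assms by blast
    moreover have "(\<Sum>Z\<in>Pow A. of_bool (Z \<subseteq> T \<inter> F)) = card (Pow A \<inter> {Z. Z \<subseteq> T \<inter> F})"
      using assms(1) by simp
    moreover have "finite (T \<inter> F)" using \<open>T \<in> X\<close> assms(1,2) finite_subset[of T A] by auto
    ultimately show "(\<Sum>Z\<in>Pow A. of_bool (Z \<subseteq> T \<inter> F)) = (2::nat) ^ card (T \<inter> F)"
      by (simp only: card_Pow)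
  qed
  also have "[\<dots> = (\<Sum>(T, F)\<in>X \<times> Y. of_bool (T \<inter> F = {}))] (mod 2)"
  proof (rule cong_sum, clarify)
    fix T F assume "T \<in> X" "F \<in> Y"
    then have fin: "finite (T \<inter> F)" using assms(1,2) finite_subset[of T A] by auto
    show "[2 ^ card (T \<inter> F) = of_bool (T \<inter> F = {})] (mod (2::nat))"
      using fin by (cases "T \<inter> F = {}") (auto simp: cong_0_iff card_gt_0_iff)
  qed
  also have "(\<Sum>(T, F)\<in>X \<times> Y. of_bool (T \<inter> F = {})) = card {(T, F) \<in> X \<times> Y. T \<inter> F = {}}"
  proof -
    have "(X \<times> Y) \<inter> {z. fst z \<inter> snd z = {}} = {(T, F) \<in> X \<times> Y. T \<inter> F = {}}" by auto
    then show ?thesis using finX by (simp add: split_def del: disjoint_iff)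
  qed
  finally show ?thesis .
qed

text \<open>The version of \<open>sum_card_above_prod\<close> with one factor; here the members of
  \<open>X\<close> may have elements outside \<open>A\<close>.\<close>

lemma sum_card_above:
  fixes X :: "'e set set"
  assumes "finite A" and finX: "finite X"
  shows "[(\<Sum>Z\<in>Pow A. card {T \<in> X. Z \<subseteq> T}) = card {T \<in> X. T \<inter> A = {}}] (mod 2)"
proof -
  have "(\<Sum>Z\<in>Pow A. card {T \<in> X. Z \<subseteq> T}) = (\<Sum>Z\<in>Pow A. \<Sum>T\<in>X. of_bool (Z \<subseteq> T))"
    using finX by (simp add: Int_def)
  also have "\<dots> = (\<Sum>T\<in>X. \<Sum>Z\<in>Pow A. of_bool (Z \<subseteq> T))" by (rule sum.swap)
  also have "\<dots> = (\<Sum>T\<in>X. 2 ^ card (T \<inter> A))"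
  proof (intro sum.cong refl)
    fix T assume "T \<in> X"
    have "Pow A \<inter> {Z. Z \<subseteq> T} = Pow (T \<inter> A)" by blast
    moreover have "(\<Sum>Z\<in>Pow A. of_bool (Z \<subseteq> T)) = card (Pow A \<inter> {Z. Z \<subseteq> T})"
      using assms(1) by simp
    moreover have "finite (T \<inter> A)" using assms(1) by simp
    ultimately show "(\<Sum>Z\<in>Pow A. of_bool (Z \<subseteq> T)) = (2::nat) ^ card (T \<inter> A)"
      by (simp only: card_Pow)
  qed
  finally have eq: "(\<Sum>Z\<in>Pow A. card {T \<in> X. Z \<subseteq> T}) = (\<Sum>T\<in>X. 2 ^ card (T \<inter> A))" .
  have "[(\<Sum>T\<in>X. 2 ^ card (T \<inter> A)) = (\<Sum>T\<in>X. of_bool (T \<inter> A = {}))] (mod (2::nat))"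
  proof (rule cong_sum)
    fix T
    show "[2 ^ card (T \<inter> A) = of_bool (T \<inter> A = {})] (mod (2::nat))"
      using assms(1) by (cases "T \<inter> A = {}") (auto simp: cong_0_iff card_gt_0_iff)
  qed
  moreover have "(\<Sum>T\<in>X. of_bool (T \<inter> A = {})) = card (X \<inter> {T. T \<inter> A = {}})" using finX by simp
  moreover have "X \<inter> {T. T \<inter> A = {}} = {T \<in> X. T \<inter> A = {}}" by blast
  ultimately show ?thesis unfolding eq by metis
qed

lemma card_disjoint_pairs:
  assumes "finite A" "X \<subseteq> Pow A" "Y \<subseteq> Pow A"
    and "\<And>T F. T \<in> X \<Longrightarrow> F \<in> Y \<Longrightarrow> card T + card F = card A"
  shows "card {(T, F) \<in> X \<times> Y. T \<inter> F = {}} = conv (\<lambda>S. of_bool (S \<in> X)) (\<lambda>S. of_bool (S \<in> Y)) A"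
proof -
  have compl: "F = A - T" if "T \<in> X" "F \<in> Y" "T \<inter> F = {}" for T F
  proof (rule card_subset_eq)
    have "T \<subseteq> A" using that assms(2) by blast
    moreover from this have "finite T" using assms(1) finite_subset by blast
    ultimately show "card F = card (A - T)" using assms(4)[OF that(1,2)] by (simp add: card_Diff_subset)
  qed (use that assms in auto)
  have "{(T, F) \<in> X \<times> Y. T \<inter> F = {}} = (\<lambda>T. (T, A - T)) ` {T \<in> Pow A. T \<in> X \<and> A - T \<in> Y}"
  proof (intro equalityI subsetI)
    fix z assume "z \<in> {(T, F) \<in> X \<times> Y. T \<inter> F = {}}"
    then obtain T F where z: "z = (T, F)" "T \<in> X" "F \<in> Y" "T \<inter> F = {}" by auto
    then have "F = A - T" by (intro compl)
    then show "z \<in> (\<lambda>T. (T, A - T)) ` {T \<in> Pow A. T \<in> X \<and> A - T \<in> Y}" using z assms by auto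
  qed auto
  then have "card {(T, F) \<in> X \<times> Y. T \<inter> F = {}} = card {T \<in> Pow A. T \<in> X \<and> A - T \<in> Y}"
    by (simp add: card_image inj_on_def)
  also have "\<dots> = conv (\<lambda>S. of_bool (S \<in> X)) (\<lambda>S. of_bool (S \<in> Y)) A"
    unfolding conv_def of_bool_conj[symmetric] using assms(1) by (simp add: Int_def)
  finally show ?thesis .
qed

lemma conv_commute: "conv g h A = conv h g A"
  unfolding conv_def
  by (rule sum.reindex_bij_witness[where i = "\<lambda>S. A - S" and j = "\<lambda>S. A - S"]) (auto simp: double_diff mult.commute)

lemma card_forests_above_2:
  assumes "finite A" "\<And>e. e \<in> A \<Longrightarrow> \<exists>s\<in>W. \<exists>t\<in>W. en e = {s, t}" "r \<in> W"
  shows "card (forests_above 2 W en A Z {p, q}) =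
    card {F \<in> split_forests W en A p q r. Z \<subseteq> F} + card {F \<in> split_forests W en A q p r. Z \<subseteq> F}"
proof -
  have c: "of_bool (rooted_forest 2 W en F {p, q}) =
    (of_bool (F \<in> split_forests W en A p q r) + of_bool (F \<in> split_forests W en A q p r) :: nat)"
    if "F \<subseteq> A" for F
  proof (rule rooted_forest_2_cases)
    show "finite F" using that assms(1) by (rule finite_subset)
    show "\<forall>e\<in>F. \<exists>s t. en e = {s, t}" using that assms(2) by blast
  qed (use that assms in auto)
  have iff: "rooted_forest 2 W en F {p, q} \<longleftrightarrow> F \<in> split_forests W en A p q r \<or> F \<in> split_forests W en A q p r"
    "\<not> (F \<in> split_forests W en A p q r \<and> F \<in> split_forests W en A q p r)" if "F \<subseteq> A" for F
    using c[OF that] by (auto simp: of_bool_def split: if_splits)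
  have sub: "split_forests W en A a b c \<subseteq> Pow A" for a b c by (auto simp: split_forests_def)
  have "forests_above 2 W en A Z {p, q} =
    {F \<in> split_forests W en A p q r. Z \<subseteq> F} \<union> {F \<in> split_forests W en A q p r. Z \<subseteq> F}"
    using iff(1) unfolding forests_above_def by (auto simp: split_forests_def)
  moreover have "finite (split_forests W en A a b c)" for a b c
    using finite_subset[OF sub] assms(1) by simp
  moreover have "{F \<in> split_forests W en A p q r. Z \<subseteq> F} \<inter> {F \<in> split_forests W en A q p r. Z \<subseteq> F} = {}"
  proof (rule equals0I)
    fix F assume "F \<in> {F \<in> split_forests W en A p q r. Z \<subseteq> F} \<inter> {F \<in> split_forests W en A q p r. Z \<subseteq> F}"
    then have "F \<in> split_forests W en A p q r" "F \<in> split_forests W en A q p r" by auto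
    moreover from this have "F \<subseteq> A" by (simp add: split_forests_def)
    ultimately show False using iff(2)[of F] by blast
  qed
  ultimately show ?thesis by (simp add: card_Un_disjoint)
qed

text \<open>With the coordinates in \<open>A\<close> fixed, the eight choices at the star are
  settled by \<open>even_count_eight\<close>. There is no lower bound on \<open>card W\<close>, so
  that the lemma also serves graphs with 4 vertices.\<close>

lemma zero_count_cubic_aux:
  fixes W :: "'v set" and en :: "'e \<Rightarrow> 'v set" and a :: "'e \<Rightarrow> 'v"
  assumes finW: "finite W" and x: "x \<notin> W" and finA: "finite A"
    and ends: "\<And>e. e \<in> A \<Longrightarrow> \<exists>s\<in>W. \<exists>t\<in>W. en e = {s, t}"
    and dist: "distinct [e1, e2, e3]" and nA: "e1 \<notin> A" "e2 \<notin> A" "e3 \<notin> A"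
    and en: "en e1 = {x, a e1}" "en e2 = {x, a e2}" "en e3 = {x, a e3}"
    and aW: "a e1 \<in> W" "a e2 \<in> W" "a e3 \<in> W"
  defines "f0 \<equiv> \<lambda>Z. card {T \<in> {T. T \<subseteq> A \<and> tree W en T}. Z \<subseteq> T}"
    and "f1 \<equiv> \<lambda>Z. card {F \<in> split_forests W en A (a e1) (a e2) (a e3). Z \<subseteq> F}"
    and "f2 \<equiv> \<lambda>Z. card {F \<in> split_forests W en A (a e2) (a e1) (a e3). Z \<subseteq> F}"
    and "f3 \<equiv> \<lambda>Z. card {F \<in> split_forests W en A (a e3) (a e1) (a e2). Z \<subseteq> F}"
  shows "[zero_count (insert x W) en ({e1, e2, e3} \<union> A) =
    4 * (\<Sum>Z\<in>Pow A. f0 Z + (1 + f0 Z) * (f1 Z + f2 Z + f3 Z))] (mod 8)"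
proof -
  let ?D = "{e1, e2, e3}"
  have disj: "?D \<inter> A = {}" using nA by auto
  define g where "g = (\<lambda>Z. card (forests_above 3 W en A Z {a e1, a e2, a e3}))"
  have AW: "en e \<subseteq> W" if "e \<in> A" for e using ends[OF that] by auto
  have M: "card (trees_above (insert x W) en (?D \<union> A) (Z1 \<union> Z)) =
      (\<Sum>I\<in>Pow ?D. of_bool (Z1 \<subseteq> I) * card (forests_above (card I) W en A Z (a ` I)))"
    if "Z1 \<subseteq> ?D" "Z \<subseteq> A" for Z1 Z
    using en that by (intro card_trees_above_star finW x finA disj AW) auto
  have "[(\<Sum>I\<in>Pow ?D. of_bool (even (card (trees_above (insert x W) en (?D \<union> A) (I \<union> Z)))))
     = 4 * (f0 Z + (1 + f0 Z) * (f1 Z + f2 Z + f3 Z))] (mod 8)" if Z: "Z \<subseteq> A" for Z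
  proof -
    define c where "c = (\<lambda>I. card (forests_above (card I) W en A Z (a ` I)))"
    have "forests_above 0 W en A Z {} = {}"
      using aW by (auto simp: forests_above_def rooted_forest_def covers_def)
    then have c0: "c {} = 0" by (simp add: c_def)
    have c1: "c {e} = f0 Z" if "a e \<in> W" for e
    proof -
      have "forests_above 1 W en A Z {a e} = {T \<in> {T. T \<subseteq> A \<and> tree W en T}. Z \<subseteq> T}"
        using tree_iff_rooted_forest[OF that] by (auto simp: forests_above_def)
      then show ?thesis by (simp add: c_def f0_def)
    qed
    have c2: "c {e1, e2} = f1 Z + f2 Z" "c {e1, e3} = f1 Z + f3 Z" "c {e2, e3} = f2 Z + f3 Z"
      unfolding c_def f1_def f2_def f3_def
      using card_forests_above_2[OF finA ends aW(3), where Z = Z and p = "a e1" and q = "a e2"]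
        card_forests_above_2[OF finA ends aW(2), where Z = Z and p = "a e1" and q = "a e3"]
        card_forests_above_2[OF finA ends aW(1), where Z = Z and p = "a e2" and q = "a e3"] dist
        split_forests_commute[of W en A "a e1" "a e3" "a e2"] split_forests_commute[of W en A "a e2" "a e3" "a e1"]
        split_forests_commute[of W en A "a e3" "a e2" "a e1"]
      by (simp_all add: numeral_2_eq_2)
    have c3: "c {e1, e2, e3} = g Z" using dist by (simp add: c_def g_def numeral_3_eq_3)
    have ne: "e1 \<noteq> e2" "e1 \<noteq> e3" "e2 \<noteq> e3" "e2 \<noteq> e1" "e3 \<noteq> e1" "e3 \<noteq> e2" using dist by auto
    have M': "card (trees_above (insert x W) en (?D \<union> A) (Z1 \<union> Z)) =
        (\<Sum>I\<in>Pow ?D. of_bool (Z1 \<subseteq> I) * c I)" if "Z1 \<subseteq> ?D" for Z1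
      unfolding c_def by (rule M[OF that Z])
    let ?t = "\<lambda>Z1. card (trees_above (insert x W) en (?D \<union> A) (Z1 \<union> Z))"
    have pow3: "(\<Sum>I\<in>Pow ?D. \<phi> I) = \<phi> {} + \<phi> {e1} + \<phi> {e2} + \<phi> {e3} + \<phi> {e1, e2} + \<phi> {e1, e3}
        + \<phi> {e2, e3} + \<phi> {e1, e2, e3}" for \<phi> :: "'e set \<Rightarrow> nat"
      using ne by (simp add: sum_Pow_insert)
    have t: "?t {} = 3 * f0 Z + (f1 Z + f2 Z) + (f1 Z + f3 Z) + (f2 Z + f3 Z) + g Z"
      "?t {e1} = f0 Z + (f1 Z + f2 Z) + (f1 Z + f3 Z) + g Z"
      "?t {e2} = f0 Z + (f1 Z + f2 Z) + (f2 Z + f3 Z) + g Z"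
      "?t {e3} = f0 Z + (f1 Z + f3 Z) + (f2 Z + f3 Z) + g Z"
      "?t {e1, e2} = f1 Z + f2 Z + g Z" "?t {e1, e3} = f1 Z + f3 Z + g Z"
      "?t {e2, e3} = f2 Z + f3 Z + g Z" "?t {e1, e2, e3} = g Z"
      by (subst M', simp, unfold pow3, simp add: ne c0 c1 c2 c3 aW)+
    \<comment> \<open>\<open>dodgson_mod_2\<close> with the ends of \<open>e1\<close>,
      \<open>e2\<close>, \<open>e3\<close> as \<open>p\<close>, \<open>q\<close>, \<open>r\<close>;
      its last term is \<open>f1 Z\<close>.\<close>
    have dod: "even (f0 Z * g Z + (f1 Z + f2 Z) * (f1 Z + f3 Z) + f1 Z)"
    proof -
      have "card {F \<in> forests_above 2 W en A Z {a e1, a e3}. conn (en ` F) (a e2) (a e3)} = f1 Z"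
        unfolding f1_def by (rule arg_cong[where f = card]) (auto simp: forests_above_def split_forests_def)
      moreover have "card (forests_above 1 W en A Z {a e1}) = f0 Z" using c1[OF aW(1)] by (simp add: c_def)
      moreover have "card (forests_above 2 W en A Z {a e1, a e2}) = f1 Z + f2 Z"
        "card (forests_above 2 W en A Z {a e1, a e3}) = f1 Z + f3 Z"
        using c2(1,2) dist by (simp_all add: c_def numeral_2_eq_2)
      ultimately show ?thesis
        using dodgson_mod_2[where en = en and Z = Z, OF finA ends aW] by (simp add: g_def)
    qed
    show ?thesis unfolding pow3 t using even_count_eight[OF dod] .
  qed
  then have "[(\<Sum>Z\<in>Pow A. \<Sum>I\<in>Pow ?D. of_bool (even (card (trees_above (insert x W) en (?D \<union> A) (I \<union> Z)))))
     = (\<Sum>Z\<in>Pow A. 4 * (f0 Z + (1 + f0 Z) * (f1 Z + f2 Z + f3 Z)))] (mod 8)"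
    by (intro cong_sum) auto
  then show ?thesis
    unfolding zero_count_def using sum_Pow_Un[OF _ finA disj] by (simp add: sum_distrib_left)
qed

theorem zero_count_cubic:
  fixes W :: "'v set" and en :: "'e \<Rightarrow> 'v set" and a :: "'e \<Rightarrow> 'v"
  assumes finW: "finite W" and x: "x \<notin> W" and finA: "finite A"
    and ends: "\<And>e. e \<in> A \<Longrightarrow> \<exists>s\<in>W. \<exists>t\<in>W. en e = {s, t}"
    and dist: "distinct [e1, e2, e3]" and nA: "e1 \<notin> A" "e2 \<notin> A" "e3 \<notin> A"
    and en: "en e1 = {x, a e1}" "en e2 = {x, a e2}" "en e3 = {x, a e3}"
    and aW: "a e1 \<in> W" "a e2 \<in> W" "a e3 \<in> W"
    and cardA: "card A + 3 = 2 * card W" and cardW: "3 \<le> card W"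
  shows "[zero_count (insert x W) en ({e1, e2, e3} \<union> A) =
    tree_pairs (insert x W) en ({e1, e2, e3} \<union> A)] (mod 8)"
proof -
  let ?D = "{e1, e2, e3}"
  define X where "X = {T. T \<subseteq> A \<and> tree W en T}"
  define Y1 where "Y1 = split_forests W en A (a e1) (a e2) (a e3)"
  define Y2 where "Y2 = split_forests W en A (a e2) (a e1) (a e3)"
  define Y3 where "Y3 = split_forests W en A (a e3) (a e1) (a e2)"
  note Ys = Y1_def Y2_def Y3_def
  let ?f = "\<lambda>X Z. card {F \<in> X. Z \<subseteq> F}"
  let ?o = "\<lambda>X S. of_bool (S \<in> X) :: nat"
  have sub: "X \<subseteq> Pow A" "Y1 \<subseteq> Pow A" "Y2 \<subseteq> Pow A" "Y3 \<subseteq> Pow A"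
    by (auto simp: X_def Ys split_forests_def)
  have cX: "card T + 1 = card W" if "T \<in> X" for T using that by (simp add: X_def tree_def)
  have cY: "card F + 2 = card W" if "F \<in> Y1 \<or> F \<in> Y2 \<or> F \<in> Y3" for F
    using that by (auto simp: Ys split_forests_def rooted_forest_def)
  \<comment> \<open>The bound on \<open>card W\<close> enters here: on two vertices the empty set
    can be a 2-forest of the required kind, and the sums of single factors would then
    contribute.\<close>
  have ne: "{} \<notin> X" "{} \<notin> Y1" "{} \<notin> Y2" "{} \<notin> Y3" using cX[of "{}"] cY[of "{}"] cardW by auto
  have even1: "even (\<Sum>Z\<in>Pow A. ?f X Z)" "even (\<Sum>Z\<in>Pow A. ?f Y1 Z)"
    "even (\<Sum>Z\<in>Pow A. ?f Y2 Z)" "even (\<Sum>Z\<in>Pow A. ?f Y3 Z)"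
  proof -
    have "even (\<Sum>Z\<in>Pow A. ?f X Z)" if X: "X \<subseteq> Pow A" "{} \<notin> X" for X
    proof -
      have "finite X" using X(1) finA finite_subset by (metis finite_Pow_iff)
      moreover have "{T \<in> X. T \<inter> A = {}} = {}"
      proof (rule equals0I)
        fix T assume "T \<in> {T \<in> X. T \<inter> A = {}}"
        then have "T \<in> X" "T \<inter> A = {}" by auto
        then have "T = {}" using X(1) by blast
        then show False using \<open>T \<in> X\<close> X(2) by simp
      qed
      ultimately have "[(\<Sum>Z\<in>Pow A. ?f X Z) = 0] (mod 2)"
        using sum_card_above[OF finA, of X] by (metis card.empty)
      then show ?thesis unfolding cong_0_iff .
    qed
    then show "even (\<Sum>Z\<in>Pow A. ?f X Z)" "even (\<Sum>Z\<in>Pow A. ?f Y1 Z)"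
      "even (\<Sum>Z\<in>Pow A. ?f Y2 Z)" "even (\<Sum>Z\<in>Pow A. ?f Y3 Z)" using sub ne by blast+
  qed
  have pr: "[(\<Sum>Z\<in>Pow A. ?f X Z * ?f Y Z) = conv (?o X) (?o Y) A] (mod 2)"
    if "Y = Y1 \<or> Y = Y2 \<or> Y = Y3" for Y
  proof -
    have "Y \<subseteq> Pow A" using that sub by blast
    moreover have "card T + card F = card A" if "T \<in> X" "F \<in> Y" for T F
    proof -
      have "card F + 2 = card W" using cY that(2) \<open>Y = Y1 \<or> Y = Y2 \<or> Y = Y3\<close> by blast
      then show ?thesis using cX[OF that(1)] cardA by linarith
    qed
    ultimately show ?thesis
      using sum_card_above_prod[OF finA sub(1), of Y] card_disjoint_pairs[OF finA sub(1), of Y] by simp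
  qed
  let ?B = "conv (?o X) (?o Y1) A + conv (?o X) (?o Y2) A + conv (?o X) (?o Y3) A"
  have sum: "[(\<Sum>Z\<in>Pow A. ?f X Z + (1 + ?f X Z) * (?f Y1 Z + ?f Y2 Z + ?f Y3 Z)) = ?B] (mod 2)"
  proof -
    let ?S = "(\<Sum>Z\<in>Pow A. ?f X Z) + (\<Sum>Z\<in>Pow A. ?f Y1 Z) + (\<Sum>Z\<in>Pow A. ?f Y2 Z) + (\<Sum>Z\<in>Pow A. ?f Y3 Z)"
    let ?P = "(\<Sum>Z\<in>Pow A. ?f X Z * ?f Y1 Z) + (\<Sum>Z\<in>Pow A. ?f X Z * ?f Y2 Z) + (\<Sum>Z\<in>Pow A. ?f X Z * ?f Y3 Z)"
    have eq: "(\<Sum>Z\<in>Pow A. ?f X Z + (1 + ?f X Z) * (?f Y1 Z + ?f Y2 Z + ?f Y3 Z)) = ?S + ?P"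
      unfolding sum.distrib[symmetric] by (intro sum.cong refl) (simp add: algebra_simps)
    have "[?S = 0] (mod 2)" using even1 by (simp add: cong_0_iff)
    moreover have "[?P = ?B] (mod 2)" using pr by (intro cong_add) auto
    ultimately have "[?S + ?P = 0 + ?B] (mod 2)" by (rule cong_add)
    then show ?thesis unfolding eq add_0 .
  qed
  \<comment> \<open>Given a tree and a 2-forest that isolates the end of one star edge from the
    other two ends, the 2-forest must receive that star edge and one of the two others, and the tree
    the remaining one. These two choices and the order of the trees give the factor 4.\<close>
  have "tree_pairs (insert x W) en (?D \<union> A) = 4 * ?B"
  proof -
    have AW: "en e \<subseteq> W" if "e \<in> A" for e using ends[OF that] by auto
    define c where "c = forests W en a"
    have L: "tree_pairs (insert x W) en (?D \<union> A) = (\<Sum>I\<in>Pow ?D. conv (c I) (c (?D - I)) A)"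
      unfolding c_def using finW x finA AW en nA by (intro tree_pairs_star) auto
    have c0: "conv (c {}) f A = 0" "conv f (c {}) A = 0" for f
    proof -
      have "W \<noteq> {}" using aW by blast
      then show "conv (c {}) f A = 0" "conv f (c {}) A = 0" by (simp_all add: c_def conv_def forests_empty)
    qed
    have cX: "conv (c {e}) h A = conv (?o X) h A" if "a e \<in> W" for e h
      using that by (intro conv_cong) (auto simp: c_def forests_singleton X_def)
    have pair: "c {e, f} F = ?o (split_forests W en A (a e) (a f) (a g)) F + ?o (split_forests W en A (a f) (a e) (a g)) F"
      if "e \<noteq> f" "a g \<in> W" "F \<subseteq> A" for e f g F
    proof -
      have "of_bool (rooted_forest 2 W en F {a e, a f}) =
        (?o (split_forests W en A (a e) (a f) (a g)) F + ?o (split_forests W en A (a f) (a e) (a g)) F)"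
      proof (rule rooted_forest_2_cases)
        show "finite F" using that(3) finA by (rule finite_subset)
        show "\<forall>e\<in>F. \<exists>s t. en e = {s, t}" using that(3) ends by blast
      qed (use that in auto)
      then show ?thesis using that(1) by (simp add: c_def forests_def numeral_2_eq_2)
    qed
    have ne: "e1 \<noteq> e2" "e1 \<noteq> e3" "e2 \<noteq> e3" "e2 \<noteq> e1" "e3 \<noteq> e1" "e3 \<noteq> e2" using dist by auto
    have c2: "conv h (c {e1, e2}) A = conv h (?o Y1) A + conv h (?o Y2) A"
      "conv h (c {e1, e3}) A = conv h (?o Y1) A + conv h (?o Y3) A"
      "conv h (c {e2, e3}) A = conv h (?o Y2) A + conv h (?o Y3) A" for h
      unfolding conv_add(2)[symmetric] Ys
      using pair[OF ne(1) aW(3)] pair[OF ne(2) aW(2)] pair[OF ne(3) aW(1)]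
        split_forests_commute[of W en A "a e1" "a e3" "a e2"] split_forests_commute[of W en A "a e2" "a e3" "a e1"]
        split_forests_commute[of W en A "a e3" "a e2" "a e1"]
      by (intro conv_cong; simp)+
    have c2': "conv (c {e1, e2}) h A = conv h (?o Y1) A + conv h (?o Y2) A"
      "conv (c {e1, e3}) h A = conv h (?o Y1) A + conv h (?o Y3) A"
      "conv (c {e2, e3}) h A = conv h (?o Y2) A + conv h (?o Y3) A" for h
      unfolding conv_commute[of _ h] by (rule c2)+
    have cXY: "conv (c {e}) (?o Y) A = conv (?o X) (?o Y) A" if "a e \<in> W" for e Y
      using cX[OF that] by simp
    have "tree_pairs (insert x W) en (?D \<union> A) =
       conv (c {e1}) (c {e2, e3}) A + conv (c {e2}) (c {e1, e3}) A + conv (c {e3}) (c {e1, e2}) A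
       + conv (c {e1, e2}) (c {e3}) A + conv (c {e1, e3}) (c {e2}) A + conv (c {e2, e3}) (c {e1}) A"
      unfolding L using ne by (simp add: sum_Pow_insert insert_Diff_if c0)
    then show ?thesis unfolding c2 c2' by (simp add: cXY aW)
  qed
  moreover have "[zero_count (insert x W) en (?D \<union> A) = 4 * ?B] (mod 8)"
  proof -
    have "[zero_count (insert x W) en (?D \<union> A) =
      4 * (\<Sum>Z\<in>Pow A. ?f X Z + (1 + ?f X Z) * (?f Y1 Z + ?f Y2 Z + ?f Y3 Z))] (mod 8)"
      unfolding X_def Ys using assms by (intro zero_count_cubic_aux) auto
    moreover have "[4 * (\<Sum>Z\<in>Pow A. ?f X Z + (1 + ?f X Z) * (?f Y1 Z + ?f Y2 Z + ?f Y3 Z)) = 4 * ?B] (mod 8)"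
      using cong_cmult_leftI[OF sum, of 4] by simp
    ultimately show ?thesis by (rule cong_trans)
  qed
  ultimately show ?thesis by simp
qed

section \<open>Spanning trees and zeros of the Kirchhoff polynomial\<close>

text \<open>Counterpart of \<open>card_le_covers\<close>: removing a bridge creates a component
  without a root, where a new root can be placed. Both bounds together determine the edge count of a
  connected acyclic graph.\<close>

lemma forest_card:
  assumes "finite F" "finite V" "\<And>e. e \<in> F \<Longrightarrow> \<exists>p\<in>V. \<exists>q\<in>V. en e = {p, q}"
    and "\<And>e p q. e \<in> F \<Longrightarrow> en e = {p, q} \<Longrightarrow> \<not> conn (en ` (F - {e})) p q"
    and "Q \<subseteq> V" "\<And>b c. b \<in> Q \<Longrightarrow> c \<in> Q \<Longrightarrow> b \<noteq> c \<Longrightarrow> \<not> conn (en ` F) b c"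
  shows "card F + card Q \<le> card V"
  using assms
proof (induction F arbitrary: Q rule: finite_induct)
  case empty
  then show ?case by (simp add: card_mono)
next
  case (insert e F)
  obtain p q where pq: "p \<in> V" "q \<in> V" "en e = {p, q}" using insert.prems(2)[of e] by blast
  have e: "insert e F - {e} = F" using insert.hyps by auto
  have npq: "\<not> conn (en ` F) p q" using insert.prems(3)[of e p q] pq e by simp
  have mono: "conn (en ` F) b c \<Longrightarrow> conn (en ` insert e F) b c" for b c
    by (rule conn_mono[rotated]) auto
  have ins: "conn (en ` insert e F) b c \<longleftrightarrow> conn (en ` F) b c \<or> conn (en ` F) b p \<and> conn (en ` F) q c
     \<or> conn (en ` F) b q \<and> conn (en ` F) p c" for b c
    using conn_insert[of p q "en ` F" b c] pq by simp
  \<comment> \<open>If a root is connected with \<open>p\<close>, the other end \<open>q\<close> is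
    the new root; otherwise \<open>p\<close> is.\<close>
  have "\<exists>r\<in>V. \<forall>c\<in>Q. \<not> conn (en ` F) c r"
  proof (cases "\<exists>c\<in>Q. conn (en ` F) c p")
    case True
    then obtain c where c: "c \<in> Q" "conn (en ` F) c p" by blast
    have "\<not> conn (en ` F) b q" if b: "b \<in> Q" for b
    proof
      assume bq: "conn (en ` F) b q"
      show False
      proof (cases "b = c")
        case True
        then show False using npq bq c conn_sym conn_trans by fast
      next
        case False
        have "conn (en ` insert e F) b c" unfolding ins using bq conn_sym[OF c(2)] by blast
        then show False using insert.prems(5)[OF b c(1) False] by blast
      qed
    qed
    then show ?thesis using pq by blast
  qed (use pq in blast)
  then obtain r where r: "r \<in> V" "\<And>c. c \<in> Q \<Longrightarrow> \<not> conn (en ` F) c r" by blast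
  then have rQ: "r \<notin> Q" using conn_refl by fast
  have finQ: "finite Q" using insert.prems(4,1) by (rule finite_subset)
  have "card F + card (insert r Q) \<le> card V"
  proof (rule insert.IH)
    show "\<exists>p\<in>V. \<exists>q\<in>V. en f = {p, q}" if "f \<in> F" for f using insert.prems that by blast
    show "\<not> conn (en ` (F - {f})) s t" if "f \<in> F" "en f = {s, t}" for f s t
    proof
      assume "conn (en ` (F - {f})) s t"
      then have "conn (en ` (insert e F - {f})) s t" by (rule conn_mono[rotated]) auto
      then show False using insert.prems(3)[of f s t] that by blast
    qed
    show "\<not> conn (en ` F) b c" if bc: "b \<in> insert r Q" "c \<in> insert r Q" "b \<noteq> c" for b c
    proof -
      consider "b \<in> Q" "c \<in> Q" | "b = r" "c \<in> Q" | "b \<in> Q" "c = r" using bc by blast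
      then show ?thesis
      proof cases
        case 1
        then show ?thesis using insert.prems(5) mono bc(3) by blast
      qed (use r(2) conn_sym in fast)+
    qed
  qed (use insert.prems r in auto)
  then show ?case using insert.hyps rQ finQ by simp
qed

text \<open>When a step returns to a vertex of the path, the path is cut back to that vertex instead
  of being extended.\<close>

lemma conn_simple_path:
  assumes "conn (en ` S) u w"
  shows "\<exists>vs es. vs \<noteq> [] \<and> hd vs = u \<and> last vs = w \<and> distinct vs \<and> length vs = Suc (length es)
    \<and> set es \<subseteq> S \<and> (\<forall>i<length es. en (es ! i) = {vs ! i, vs ! Suc i})"
proof -
  have "(u, w) \<in> (link (en ` S))\<^sup>*" using assms by (simp add: conn_def)
  then show ?thesis
  proof (induction rule: rtrancl_induct)
    case base
    show ?case by (rule exI[of _ "[u]"], rule exI[of _ "[]"]) simp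
  next
    case (step y z)
    then obtain vs es where IH: "vs \<noteq> []" "hd vs = u" "last vs = y" "distinct vs" "length vs = Suc (length es)"
      "set es \<subseteq> S" "\<forall>i<length es. en (es ! i) = {vs ! i, vs ! Suc i}" by blast
    obtain f where f: "f \<in> S" "en f = {y, z}" using step(2) by (auto simp: link_def)
    show ?case
    proof (cases "z \<in> set vs")
      case True
      then obtain k where k: "k < length vs" "vs ! k = z" by (auto simp: in_set_conv_nth)
      have "last (take (Suc k) vs) = z" using k by (simp add: take_Suc_conv_app_nth)
      moreover have "set (take k es) \<subseteq> S" using IH(6) set_take_subset by fast
      moreover have "\<forall>i<length (take k es). en (take k es ! i) = {take (Suc k) vs ! i, take (Suc k) vs ! Suc i}"
        using IH(7) by simp
      ultimately show ?thesis using IH k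
        by (intro exI[of _ "take (Suc k) vs"] exI[of _ "take k es"]) auto
    next
      case False
      have "en ((es @ [f]) ! i) = {(vs @ [z]) ! i, (vs @ [z]) ! Suc i}" if "i < length (es @ [f])" for i
      proof (cases "i < length es")
        case True
        then show ?thesis using IH(5,7) by (simp add: nth_append)
      next
        case False
        then have "i = length es" using that by simp
        moreover have "vs ! length es = y" using IH(1,3,5) by (simp add: last_conv_nth)
        ultimately show ?thesis using f(2) IH(5) by (simp add: nth_append)
      qed
      then show ?thesis using IH False f(1)
        by (intro exI[of _ "vs @ [z]"] exI[of _ "es @ [f]"]) auto
    qed
  qed
qed

text \<open>A simple path that avoids \<open>e\<close> and joins its ends closes up with
  \<open>e\<close> to a cycle.\<close>

lemma bridge_if_acyclic:
  fixes H :: "('v, 'e) mgraph"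
  assumes ends: "\<And>e. e \<in> T \<Longrightarrow> card (ends H e) = 2"
    and acyc: "\<nexists>vs es. is_cycle (H\<lparr>edges := T\<rparr>) vs es" and e: "e \<in> T" "ends H e = {u, w}"
  shows "\<not> conn (ends H ` (T - {e})) u w"
proof
  assume "conn (ends H ` (T - {e})) u w"
  from conn_simple_path[OF this] obtain vs es where P: "vs \<noteq> []" "hd vs = u" "last vs = w" "distinct vs"
    "length vs = Suc (length es)" "set es \<subseteq> T - {e}"
    "\<forall>i<length es. ends H (es ! i) = {vs ! i, vs ! Suc i}" by blast
  have uw: "u \<noteq> w" using ends[OF e(1)] e(2) by auto
  have v0: "vs ! 0 = u" using P by (simp add: hd_conv_nth)
  have vl: "vs ! length es = w" using P by (simp add: last_conv_nth)
  \<comment> \<open>Since \<open>e\<close> is not a loop, the path has an edge, and the cycle has at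
    least the two edges that \<open>is_cycle\<close> demands.\<close>
  have len: "es \<noteq> []" using uw v0 vl by auto
  have "distinct es"
  proof (subst distinct_conv_nth, intro allI impI)
    fix i j assume ij: "i < length es" "j < length es" "i \<noteq> j"
    have "es ! i \<noteq> es ! j"
    proof
      assume "es ! i = es ! j"
      then have "{vs ! i, vs ! Suc i} = {vs ! j, vs ! Suc j}" using P(7) ij by metis
      then have "vs ! i = vs ! j \<or> vs ! i = vs ! Suc j \<and> vs ! Suc i = vs ! j" by (auto simp: doubleton_eq_iff)
      then show False using P(4,5) ij by (auto simp: nth_eq_iff_index_eq)
    qed
    then show "es ! i \<noteq> es ! j" .
  qed
  have "is_cycle (H\<lparr>edges := T\<rparr>) vs (es @ [e])"
    unfolding is_cycle_def
  proof (intro conjI allI impI)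
    show "length vs = length (es @ [e])" using P by simp
    show "2 \<le> length (es @ [e])" using len by (cases es) auto
    show "distinct vs" by (fact P(4))
    show "distinct (es @ [e])" using \<open>distinct es\<close> P(6) by auto
    show "set (es @ [e]) \<subseteq> edges (H\<lparr>edges := T\<rparr>)" using P(6) e(1) by auto
    fix i assume i: "i < length (es @ [e])"
    show "ends (H\<lparr>edges := T\<rparr>) ((es @ [e]) ! i) = {vs ! i, vs ! (Suc i mod length vs)}"
    proof (cases "i < length es")
      case True
      then show ?thesis using P(5,7) by (simp add: nth_append)
    next
      case False
      then have "i = length es" using i by simp
      then show ?thesis using P(5) e(2) v0 vl by (simp add: nth_append insert_commute)
    qed
  qed
  then show False using acyc by blast
qed

text \<open>The rest of the cycle, followed from \<open>vs ! 1\<close> around to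
  \<open>vs ! 0\<close>, bypasses its first edge.\<close>

lemma cycle_not_bridge:
  fixes H :: "('v, 'e) mgraph"
  assumes "is_cycle (H\<lparr>edges := T\<rparr>) vs es"
  shows "\<exists>e\<in>T. \<exists>u w. ends H e = {u, w} \<and> conn (ends H ` (T - {e})) u w"
proof -
  have C: "length vs = length es" "2 \<le> length es" "distinct es" "set es \<subseteq> T"
    "\<And>i. i < length es \<Longrightarrow> ends H (es ! i) = {vs ! i, vs ! (Suc i mod length vs)}"
    using assms by (auto simp: is_cycle_def)
  let ?e = "es ! 0" and ?n = "length es"
  have e: "?e \<in> T" "ends H ?e = {vs ! 0, vs ! 1}" 
  proof -
    have "0 < length es" "Suc 0 mod length vs = 1" using C(1,2) by auto
    then show "?e \<in> T" "ends H ?e = {vs ! 0, vs ! 1}" using C(4) nth_mem[of 0 es] C(5)[of 0] by auto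
  qed
  have edge: "conn (ends H ` (T - {?e})) (vs ! i) (vs ! (Suc i mod ?n))" if "0 < i" "i < ?n" for i
  proof (rule conn_edge)
    have "0 < ?n" using that by linarith
    then have "es ! i \<noteq> ?e" using that nth_eq_iff_index_eq[OF C(3) that(2)] by simp
    moreover have "es ! i \<in> T" using that C(4) nth_mem by blast
    ultimately show "{vs ! i, vs ! (Suc i mod ?n)} \<in> ends H ` (T - {?e})"
      using C(1) C(5)[OF that(2)] by (metis Diff_iff image_eqI singletonD)
  qed
  have "conn (ends H ` (T - {?e})) (vs ! 1) (vs ! Suc k)" if "Suc k < ?n" for k
    using that
  proof (induction k)
    case (Suc k)
    then have "conn (ends H ` (T - {?e})) (vs ! Suc k) (vs ! Suc (Suc k))" using edge[of "Suc k"] by simp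
    then show ?case using Suc conn_trans by fastforce
  qed simp
  from this[of "?n - 2"] have "conn (ends H ` (T - {?e})) (vs ! 1) (vs ! (?n - 1))"
    using C(2) by (simp add: Suc_diff_Suc numeral_2_eq_2)
  moreover have "conn (ends H ` (T - {?e})) (vs ! (?n - 1)) (vs ! 0)"
  proof -
    have "0 < ?n - 1" "?n - 1 < ?n" "Suc (?n - 1) = ?n" using C(2) by auto
    then show ?thesis using edge[of "?n - 1"] by simp
  qed
  ultimately have "conn (ends H ` (T - {?e})) (vs ! 0) (vs ! 1)" using conn_trans conn_sym by fast
  then show ?thesis using e by blast
qed

text \<open>In one direction the edge count lies between the bounds \<open>forest_card\<close> and
  \<open>card_le_covers\<close>. In the other direction the count makes every edge a bridge, whereas
  a cycle contains an edge that is none.\<close>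

lemma spanning_trees_eq:
  fixes H :: "('v, 'e) mgraph"
  assumes H: "multigraph H"
  shows "spanning_trees H = {T. T \<subseteq> edges H \<and> tree (vertices H) (ends H) T}"
proof -
  have "is_tree (H\<lparr>edges := T\<rparr>) \<longleftrightarrow> tree (vertices H) (ends H) T" if T: "T \<subseteq> edges H" for T
  proof -
    let ?V = "vertices H" and ?en = "ends H"
    have fin: "finite T" "finite ?V" using H T finite_subset by (auto simp: multigraph_def)
    have c2: "card (?en e) = 2" and sub: "?en e \<subseteq> ?V" if "e \<in> T" for e
      using H T that by (auto simp: multigraph_def)
    have pairs: "\<exists>p\<in>?V. \<exists>q\<in>?V. ?en e = {p, q}" if eT: "e \<in> T" for e
    proof -
      obtain p q where "?en e = {p, q}" using c2[OF eT] by (auto simp: card_2_iff)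
      then show ?thesis using sub[OF eT] by auto
    qed
    have "adjacency (H\<lparr>edges := T\<rparr>) = link (?en ` T)"
      by (auto simp: adjacency_def link_def image_iff)
    then have con: "connected_graph (H\<lparr>edges := T\<rparr>) \<longleftrightarrow> ?V \<noteq> {} \<and> (\<forall>u\<in>?V. \<forall>w\<in>?V. conn (?en ` T) u w)"
      by (simp add: connected_graph_def conn_def)
    show ?thesis
    proof
      assume t: "is_tree (H\<lparr>edges := T\<rparr>)"
      then have ne: "?V \<noteq> {}" and all: "\<forall>u\<in>?V. \<forall>w\<in>?V. conn (?en ` T) u w"
        and acyc: "\<nexists>vs es. is_cycle (H\<lparr>edges := T\<rparr>) vs es"
        using con by (auto simp: is_tree_def)
      obtain b where b: "b \<in> ?V" using ne by blast
      have "card T + card {b} \<le> card ?V"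
      proof (rule forest_card)
        show "\<not> conn (?en ` (T - {e})) p q" if "e \<in> T" "?en e = {p, q}" for e p q
          using bridge_if_acyclic[OF c2 acyc that] .
      qed (use fin pairs b in auto)
      moreover have "card ?V \<le> card T + card {b}"
      proof (rule card_le_covers)
        show "covers ?V (?en ` T) {b}" using all b by (simp add: covers_def)
      qed (use fin pairs in blast)+
      ultimately show "tree ?V ?en T" using all by (simp add: tree_def)
    next
      assume t: "tree ?V ?en T"
      then have ne: "?V \<noteq> {}" and all: "\<forall>u\<in>?V. \<forall>w\<in>?V. conn (?en ` T) u w" by (auto simp: tree_def)
      obtain b where b: "b \<in> ?V" using ne by blast
      have "\<not> conn (?en ` (T - {e})) u w" if "e \<in> T" "?en e = {u, w}" for e u w
      proof (rule bridge)
        show "rooted_forest 1 ?V ?en T {b}" using t tree_iff_rooted_forest[OF b] by blast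
        show "\<forall>e\<in>T. \<exists>p q. ?en e = {p, q}" using pairs by blast
      qed (use that fin in auto)
      then have "\<nexists>vs es. is_cycle (H\<lparr>edges := T\<rparr>) vs es" using cycle_not_bridge by blast
      then show "is_tree (H\<lparr>edges := T\<rparr>)" using con ne all by (simp add: is_tree_def)
    qed
  qed
  then show ?thesis unfolding spanning_trees_def by blast
qed

lemma card_kirchhoff_zeros_2:
  fixes H :: "('v, 'e) mgraph"
  assumes H: "multigraph H"
  shows "card (kirchhoff_zeros 2 H) = zero_count (vertices H) (ends H) (edges H)"
proof -
  let ?E = "edges H" and ?T = "trees_above (vertices H) (ends H) (edges H)"
  have finE: "finite ?E" using H by (simp add: multigraph_def)
  have finS: "finite (spanning_trees H)" unfolding spanning_trees_eq[OF H] using finE by simp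
  define zs where "zs = (\<lambda>\<alpha> :: 'e \<Rightarrow> int. {e \<in> ?E. \<alpha> e = 0})"
  define pt where "pt = (\<lambda>Z. restrict (\<lambda>e. if e \<in> Z then 0 else 1 :: int) ?E)"
  have val: "\<alpha> e = 0 \<or> \<alpha> e = 1" if "\<alpha> \<in> ?E \<rightarrow>\<^sub>E {0..<int 2}" "e \<in> ?E" for \<alpha> e
  proof -
    have "\<alpha> e \<in> {0..<2}" using that by (auto simp: PiE_iff)
    then show ?thesis by auto
  qed
  have kir: "kirchhoff H \<alpha> = int (card (?T (zs \<alpha>)))" if \<alpha>: "\<alpha> \<in> ?E \<rightarrow>\<^sub>E {0..<int 2}" for \<alpha>
  proof -
    \<comment> \<open>All coordinates are 0 or 1, so a monomial is 1 unless one of the vanishing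
      coordinates lies outside \<open>T\<close>.\<close>
    have "(\<Prod>e\<in>?E - T. \<alpha> e) = of_bool (zs \<alpha> \<subseteq> T)" for T
    proof (cases "zs \<alpha> \<subseteq> T")
      case True
      then have "\<alpha> e = 1" if "e \<in> ?E - T" for e using val[OF \<alpha>, of e] that by (auto simp: zs_def)
      then show ?thesis using True by simp
    next
      case False
      then obtain e where "e \<in> ?E - T" "\<alpha> e = 0" by (auto simp: zs_def)
      then show ?thesis using False finE by (auto simp: prod_zero_iff)
    qed
    then have "kirchhoff H \<alpha> = (\<Sum>T\<in>spanning_trees H. of_bool (zs \<alpha> \<subseteq> T))" by (simp add: kirchhoff_def)
    also have "\<dots> = int (card (spanning_trees H \<inter> {T. zs \<alpha> \<subseteq> T}))" using finS by simp
    also have "spanning_trees H \<inter> {T. zs \<alpha> \<subseteq> T} = ?T (zs \<alpha>)"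
      unfolding spanning_trees_eq[OF H] by (auto simp: trees_above_def)
    finally show ?thesis .
  qed
  have zp: "zs (pt Z) = Z" if "Z \<subseteq> ?E" for Z using that by (auto simp: zs_def pt_def)
  have pE: "pt Z \<in> ?E \<rightarrow>\<^sub>E {0..<int 2}" for Z by (auto simp: pt_def)
  have "bij_betw zs (kirchhoff_zeros 2 H) {Z \<in> Pow ?E. even (card (?T Z))}"
  proof (rule bij_betw_byWitness[where f' = pt])
    show "\<forall>\<alpha>\<in>kirchhoff_zeros 2 H. pt (zs \<alpha>) = \<alpha>"
    proof
      fix \<alpha> assume "\<alpha> \<in> kirchhoff_zeros 2 H"
      then have \<alpha>: "\<alpha> \<in> ?E \<rightarrow>\<^sub>E {0..<int 2}" by (simp add: kirchhoff_zeros_def)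
      show "pt (zs \<alpha>) = \<alpha>"
      proof
        fix e show "pt (zs \<alpha>) e = \<alpha> e"
          using val[OF \<alpha>, of e] \<alpha> by (cases "e \<in> ?E") (auto simp: pt_def zs_def PiE_def extensional_def)
      qed
    qed
    show "\<forall>Z\<in>{Z \<in> Pow ?E. even (card (?T Z))}. zs (pt Z) = Z" using zp by simp
    show "zs ` kirchhoff_zeros 2 H \<subseteq> {Z \<in> Pow ?E. even (card (?T Z))}"
    proof (rule image_subsetI)
      fix \<alpha> assume "\<alpha> \<in> kirchhoff_zeros 2 H"
      then have "\<alpha> \<in> ?E \<rightarrow>\<^sub>E {0..<int 2}" "[kirchhoff H \<alpha> = 0] (mod 2)" by (auto simp: kirchhoff_zeros_def)
      then have "even (card (?T (zs \<alpha>)))" using kir by (simp add: cong_0_iff)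
      then show "zs \<alpha> \<in> {Z \<in> Pow ?E. even (card (?T Z))}" by (auto simp: zs_def)
    qed
    show "pt ` {Z \<in> Pow ?E. even (card (?T Z))} \<subseteq> kirchhoff_zeros 2 H"
    proof (rule image_subsetI)
      fix Z assume Z: "Z \<in> {Z \<in> Pow ?E. even (card (?T Z))}"
      then have "kirchhoff H (pt Z) = int (card (?T Z))" using kir[OF pE] zp by simp
      then show "pt Z \<in> kirchhoff_zeros 2 H" using Z pE by (simp add: kirchhoff_zeros_def cong_0_iff)
    qed
  qed
  then have "card (kirchhoff_zeros 2 H) = card {Z \<in> Pow ?E. even (card (?T Z))}" by (rule bij_betw_same_card)
  also have "\<dots> = zero_count (vertices H) (ends H) ?E"
    unfolding zero_count_def using finE by (simp add: Int_def)
  finally show ?thesis .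
qed

section \<open>Vertices of degree 2\<close>

text \<open>Exchanging the two trees has no fixed point, as a given edge belongs to only one of
  them.\<close>

lemma tree_pairs_even:
  assumes "finite E" "E \<noteq> {}"
  shows "even (tree_pairs V en E)"
proof -
  obtain e A where "E = insert e A" "e \<notin> A" using assms by (meson Set.set_insert ex_in_conv)
  then have "tree_pairs V en E = 2 * conv (\<lambda>S. of_bool (tree V en S)) (\<lambda>S. of_bool (tree V en (insert e S))) A"
    using assms by (simp add: tree_pairs_def conv_insert conv_commute[of "\<lambda>S. of_bool (tree V en (insert e S))"])
  then show ?thesis by simp
qed

text \<open>Both trees must reach \<open>x\<close>, so each takes one of the two edges and has
  \<open>x\<close> as a leaf. The factor 2 is the choice of the assignment.\<close>

lemma tree_pairs_degree_two:
  assumes "finite W" "x \<notin> W" "finite A" "p \<noteq> p'" "p \<notin> A" "p' \<notin> A"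
    and "en p = {x, a p}" "en p' = {x, a p'}" "a p \<in> W" "a p' \<in> W" "\<And>e. e \<in> A \<Longrightarrow> en e \<subseteq> W"
  shows "tree_pairs (insert x W) en ({p, p'} \<union> A) = 2 * tree_pairs W en A"
proof -
  define c where "c = forests W en a"
  have W: "W \<noteq> {}" using assms by blast
  have L: "tree_pairs (insert x W) en ({p, p'} \<union> A) = (\<Sum>I\<in>Pow {p, p'}. conv (c I) (c ({p, p'} - I)) A)"
    unfolding c_def using assms(5-8) by (intro tree_pairs_star assms(1-3,11)) auto
  have c0: "conv (c {}) f A = 0" "conv f (c {}) A = 0" for f
    using W by (simp_all add: c_def conv_def forests_empty)
  have c1: "conv (c {p}) (c {p'}) A = tree_pairs W en A" "conv (c {p'}) (c {p}) A = tree_pairs W en A"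
    unfolding tree_pairs_def using assms by (auto intro!: conv_cong simp: c_def forests_singleton)
  show ?thesis unfolding L using assms(4) by (simp add: sum_Pow_insert insert_Diff_if c0 c1)
qed

lemma tree_pairs_degree_one:
  assumes "finite W" "x \<notin> W" "finite A" "p \<notin> A" "en p = {x, b}" "W \<noteq> {}" "\<And>e. e \<in> A \<Longrightarrow> en e \<subseteq> W"
  shows "tree_pairs (insert x W) en ({p} \<union> A) = 0"
proof -
  define c where "c = forests W en (\<lambda>_. b)"
  have "tree_pairs (insert x W) en ({p} \<union> A) = (\<Sum>I\<in>Pow {p}. conv (c I) (c ({p} - I)) A)"
    unfolding c_def using assms(4,5) by (intro tree_pairs_star assms(1-3,7)) auto
  moreover have "conv (c {}) f A = 0" "conv f (c {}) A = 0" for f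
    using assms(6) by (simp_all add: c_def conv_def forests_empty)
  ultimately show ?thesis by (simp add: sum_Pow_insert insert_Diff_if)
qed

text \<open>At a vertex of degree 2 the two variables enter the polynomial only through their sum,
  which over the field with two elements does not change when both are flipped. On \<open>Z\<close>
  this flip is the symmetric difference with \<open>{p, p'}\<close>.\<close>

lemma even_trees_above_toggle:
  fixes en :: "'e \<Rightarrow> 'v set" and a :: "'e \<Rightarrow> 'v"
  assumes "finite W" "x \<notin> W" "finite A" "p \<noteq> p'" "p \<notin> A" "p' \<notin> A"
    and "en p = {x, a p}" "en p' = {x, a p'}" "a p \<in> W" "a p' \<in> W" "\<And>e. e \<in> A \<Longrightarrow> en e \<subseteq> W"
    and Z: "Z \<subseteq> {p, p'} \<union> A"
  defines "N \<equiv> \<lambda>Z. card (trees_above (insert x W) en ({p, p'} \<union> A) Z)"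
  shows "even (N Z) \<longleftrightarrow> even (N ((Z - {p, p'}) \<union> ({p, p'} - Z)))"
proof -
  let ?D = "{p, p'}"
  define Z0 where "Z0 = Z \<inter> A"
  define c where "c = (\<lambda>I. card (forests_above (card I) W en A Z0 (a ` I)))"
  have pow: "(\<Sum>I\<in>Pow ?D. \<phi> I) = \<phi> {} + \<phi> {p} + \<phi> {p'} + \<phi> {p, p'}" for \<phi> :: "'e set \<Rightarrow> nat"
    using assms(4) by (simp add: sum_Pow_insert)
  have M: "N (Z1 \<union> Z0) = (\<Sum>I\<in>Pow ?D. of_bool (Z1 \<subseteq> I) * c I)" if "Z1 \<subseteq> ?D" for Z1
    unfolding N_def c_def using that assms(5-8) by (intro card_trees_above_star assms(1-3,11)) (auto simp: Z0_def)
  have "forests_above 0 W en A Z0 {} = {}"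
    using assms(9) by (auto simp: forests_above_def rooted_forest_def covers_def)
  then have c0: "c {} = 0" by (simp add: c_def)
  have c1: "c {e} = card (trees_above W en A Z0)" if "a e \<in> W" for e
    unfolding c_def using tree_iff_rooted_forest[OF that, of en] by (simp add: forests_above_def trees_above_def)
  have N: "even (N ({} \<union> Z0)) \<longleftrightarrow> even (c ?D)" "N ({p} \<union> Z0) = N ({p'} \<union> Z0)" "N (?D \<union> Z0) = c ?D"
    using M[of "{}", unfolded pow] M[of "{p}", unfolded pow] M[of "{p'}", unfolded pow] M[of ?D, unfolded pow]
      assms(4,9,10) by (simp_all add: c0 c1)
  consider "Z = {} \<union> Z0" | "Z = {p} \<union> Z0" | "Z = {p'} \<union> Z0" | "Z = ?D \<union> Z0"
    using Z by (fastforce simp: Z0_def)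
  then show ?thesis
  proof cases
    case 1
    then have "(Z - ?D) \<union> (?D - Z) = ?D \<union> Z0" using assms(5,6) by (auto simp: Z0_def)
    then show ?thesis using 1 N by metis
  next
    case 2
    then have "(Z - ?D) \<union> (?D - Z) = {p'} \<union> Z0" using assms(4-6) by (auto simp: Z0_def)
    then show ?thesis using 2 N by metis
  next
    case 3
    then have "(Z - ?D) \<union> (?D - Z) = {p} \<union> Z0" using assms(4-6) by (auto simp: Z0_def)
    then show ?thesis using 3 N by metis
  next
    case 4
    then have "(Z - ?D) \<union> (?D - Z) = {} \<union> Z0" using assms(5,6) by (auto simp: Z0_def)
    then show ?thesis using 4 N by metis
  qed
qed

text \<open>The symmetric difference with \<open>D\<close> exchanges the sets that contain
  \<open>p\<close> with those that avoid it.\<close>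

lemma sum_Pow_toggle:
  fixes \<phi> :: "'e set \<Rightarrow> nat"
  assumes "finite E" "p \<in> D" "D \<subseteq> E" "\<And>Z. Z \<subseteq> E \<Longrightarrow> \<phi> Z = \<phi> ((Z - D) \<union> (D - Z))"
  shows "(\<Sum>Z\<in>Pow E. \<phi> Z) = 2 * (\<Sum>Z\<in>Pow (E - {p}). \<phi> Z)"
proof -
  define A where "A = E - {p}"
  define D' where "D' = D - {p}"
  have E: "E = insert p A" "p \<notin> A" "finite A" using assms by (auto simp: A_def)
  have "(\<Sum>Z\<in>Pow A. \<phi> (insert p Z)) = (\<Sum>Z\<in>Pow A. \<phi> Z)"
  proof (rule sum.reindex_bij_witness[where i = "\<lambda>Z. (Z - D') \<union> (D' - Z)" and j = "\<lambda>Z. (Z - D') \<union> (D' - Z)"])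
    fix Z assume Z: "Z \<in> Pow A"
    show "(((Z - D') \<union> (D' - Z)) - D') \<union> (D' - ((Z - D') \<union> (D' - Z))) = Z" by auto
    show "(Z - D') \<union> (D' - Z) \<in> Pow A" using Z assms by (auto simp: A_def D'_def)
    have "insert p Z \<subseteq> E" using Z E by auto
    then have "\<phi> (insert p Z) = \<phi> ((insert p Z - D) \<union> (D - insert p Z))" by (rule assms(4))
    moreover have "(insert p Z - D) \<union> (D - insert p Z) = (Z - D') \<union> (D' - Z)"
      using Z assms(2) by (auto simp: A_def D'_def)
    ultimately show "\<phi> ((Z - D') \<union> (D' - Z)) = \<phi> (insert p Z)" by simp
  qed (auto simp: A_def D'_def assms(3)[THEN subsetD])
  then show ?thesis unfolding A_def[symmetric] using E by (simp add: sum_Pow_insert)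
qed

text \<open>The first flip reduces the count to the sets that avoid \<open>p\<close>; the second
  does not touch \<open>p\<close> and reduces it further to those that avoid \<open>q\<close>,
  whence the factor 4. Modulo 2 the remaining terms are 1 plus a tree count: the ones add up to a
  power of 2 that is even, and by \<open>sum_card_above\<close> only the trees inside
  \<open>{p, q}\<close> survive.\<close>

lemma zero_count_two_toggles:
  fixes en :: "'e \<Rightarrow> 'v set"
  assumes finE: "finite E" and D: "D1 \<subseteq> E" "D2 \<subseteq> E" "p \<in> D1" "p \<notin> D2" "q \<in> D2" "q \<notin> D1"
    and tog: "\<And>Z D. Z \<subseteq> E \<Longrightarrow> D \<in> {D1, D2} \<Longrightarrow>
      even (card (trees_above V en E Z)) \<longleftrightarrow> even (card (trees_above V en E ((Z - D) \<union> (D - Z))))"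
    and ne: "E - {p, q} \<noteq> {}"
  shows "[zero_count V en E = 4 * card {T \<in> trees_above V en E {}. T \<subseteq> {p, q}}] (mod 8)"
proof -
  let ?N = "\<lambda>Z. card (trees_above V en E Z)" and ?A = "E - {p, q}"
  let ?\<phi> = "\<lambda>Z. of_bool (even (?N Z)) :: nat"
  have A: "E - {p} - {q} = ?A" by auto
  have "zero_count V en E = 2 * (\<Sum>Z\<in>Pow (E - {p}). ?\<phi> Z)"
    unfolding zero_count_def using finE D tog[of _ D1] by (intro sum_Pow_toggle[where D = D1]) auto
  also have "(\<Sum>Z\<in>Pow (E - {p}). ?\<phi> Z) = 2 * (\<Sum>Z\<in>Pow ?A. ?\<phi> Z)"
  proof -
    have "(\<Sum>Z\<in>Pow (E - {p}). ?\<phi> Z) = 2 * (\<Sum>Z\<in>Pow (E - {p} - {q}). ?\<phi> Z)"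
    proof (rule sum_Pow_toggle[where D = D2])
      show "?\<phi> Z = ?\<phi> ((Z - D2) \<union> (D2 - Z))" if "Z \<subseteq> E - {p}" for Z
        using tog[of Z D2] that by auto
    qed (use finE D in auto)
    then show ?thesis unfolding A .
  qed
  finally have z: "zero_count V en E = 4 * (\<Sum>Z\<in>Pow ?A. ?\<phi> Z)" by simp
  let ?X = "trees_above V en E {}"
  have finX: "finite ?X" using finE by (auto simp: trees_above_def intro: finite_subset[of _ "Pow E"])
  have NX: "?N Z = card {T \<in> ?X. Z \<subseteq> T}" for Z
    by (rule arg_cong[where f = card]) (auto simp: trees_above_def)
  have "[(\<Sum>Z\<in>Pow ?A. ?\<phi> Z) = (\<Sum>Z\<in>Pow ?A. 1 + ?N Z)] (mod 2)"
    by (intro cong_sum) (auto simp: cong_def mod2_eq_if)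
  moreover have "[(\<Sum>Z\<in>Pow ?A. 1 + ?N Z) = 0 + card {T \<in> ?X. T \<subseteq> {p, q}}] (mod 2)"
  proof -
    have eq: "(\<Sum>Z\<in>Pow ?A. 1 + ?N Z) = 2 ^ card ?A + (\<Sum>Z\<in>Pow ?A. card {T \<in> ?X. Z \<subseteq> T})"
      unfolding sum.distrib NX using finE by (simp add: card_Pow)
    have X: "{T \<in> ?X. T \<inter> ?A = {}} = {T \<in> ?X. T \<subseteq> {p, q}}" by (auto simp: trees_above_def)
    have "[2 ^ card ?A = 0] (mod (2::nat))"
      using ne finE by (simp add: cong_0_iff card_gt_0_iff)
    moreover have "[(\<Sum>Z\<in>Pow ?A. card {T \<in> ?X. Z \<subseteq> T}) = card {T \<in> ?X. T \<subseteq> {p, q}}] (mod 2)"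
      using sum_card_above[of ?A ?X] finE finX unfolding X by simp
    ultimately show ?thesis unfolding eq by (rule cong_add)
  qed
  ultimately have "[(\<Sum>Z\<in>Pow ?A. ?\<phi> Z) = 0 + card {T \<in> ?X. T \<subseteq> {p, q}}] (mod 2)"
    by (rule cong_trans)
  then have "[4 * (\<Sum>Z\<in>Pow ?A. ?\<phi> Z) = 4 * (0 + card {T \<in> ?X. T \<subseteq> {p, q}})] (mod (4 * 2))"
    by (rule cong_cmult_leftI)
  then show ?thesis unfolding z by simp
qed

section \<open>Quartic graphs without loops\<close>

definition other_end :: "('e \<Rightarrow> 'v set) \<Rightarrow> 'v \<Rightarrow> 'e \<Rightarrow> 'v" where
  "other_end en x e = (SOME b. en e = {x, b} \<and> b \<noteq> x)"

lemma other_end: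
  assumes "card (en e) = 2" "x \<in> en e"
  shows "en e = {x, other_end en x e}" "other_end en x e \<noteq> x"
proof -
  obtain p q where "en e = {p, q}" "p \<noteq> q" using assms(1) by (auto simp: card_2_iff)
  then have "\<exists>b. en e = {x, b} \<and> b \<noteq> x" using assms(2) by auto
  then have "en e = {x, other_end en x e} \<and> other_end en x e \<noteq> x"
    unfolding other_end_def by (rule someI_ex)
  then show "en e = {x, other_end en x e}" "other_end en x e \<noteq> x" by auto
qed

locale quartic_graph =
  fixes V :: "'v set" and en :: "'e \<Rightarrow> 'v set" and E :: "'e set"
  assumes quartic: "quartic V en E"
    and two_ends: "e \<in> E \<Longrightarrow> card (en e) = 2"
    and connected: "u \<in> V \<Longrightarrow> w \<in> V \<Longrightarrow> conn (en ` E) u w"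
begin

lemma finV: "finite V" and finE: "finite E" and card_E: "card E = 2 * card V"
  and ends_in: "e \<in> E \<Longrightarrow> en e \<subseteq> V"
  using quartic by (auto simp: quartic_def)

lemma ends_other:
  assumes "e \<in> E" "x \<in> en e"
  shows "en e = {x, other_end en x e}" "other_end en x e \<noteq> x"
  using other_end[of en e x] two_ends assms by blast+

lemma both_ends: "e \<in> E \<Longrightarrow> x \<in> en e \<Longrightarrow> y \<in> en e \<Longrightarrow> x \<noteq> y \<Longrightarrow> en e = {x, y}"
  using ends_other(1)[of e x] by auto

lemma degree: "x \<in> V \<Longrightarrow> card {e \<in> E. x \<in> en e} = 4"
proof (rule quartic_degree[OF quartic])
  show "en e \<noteq> {x}" if "e \<in> E" for e using two_ends[OF that] by auto
qed

lemma card_avoiding: "v \<in> V \<Longrightarrow> card {e \<in> E. v \<notin> en e} + 4 = 2 * card V"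
proof -
  assume v: "v \<in> V"
  have "{e \<in> E. v \<notin> en e} = E - {e \<in> E. v \<in> en e}" by auto
  then have "card {e \<in> E. v \<notin> en e} = card E - card {e \<in> E. v \<in> en e}"
    using finE by (simp add: card_Diff_subset)
  moreover have "card {e \<in> E. v \<in> en e} \<le> card E" using finE by (intro card_mono) auto
  ultimately show ?thesis using degree[OF v] card_E by simp
qed

lemma closed_subset:
  assumes "v \<in> U" "U \<subseteq> V" "\<And>e u. e \<in> E \<Longrightarrow> u \<in> U \<Longrightarrow> u \<in> en e \<Longrightarrow> en e \<subseteq> U"
  shows "V = U"
proof (rule equalityI[OF subsetI])
  fix w assume "w \<in> V"
  then have "conn (en ` E) v w" using connected assms by blast
  then show "w \<in> U"
  proof (rule conn_closed)
    fix b c assume "{b, c} \<in> en ` E" "b \<in> U"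
    then obtain e where "e \<in> E" "en e = {b, c}" by auto
    then show "c \<in> U" using assms(3)[of e b] \<open>b \<in> U\<close> by auto
  qed (use assms in auto)
qed (use assms in auto)

section \<open>Neighbours of the deleted vertex\<close>

abbreviation between :: "'v \<Rightarrow> 'v \<Rightarrow> 'e set" where
  "between u w \<equiv> {e \<in> E. en e = {u, w}}"

text \<open>If all four edges at \<open>v\<close> led to one neighbour, these two vertices would be
  the whole graph. For two neighbours the multiplicities add up to at most 4, so one of them is 1 or
  both are 2. The neighbour then has degree 3 or 2 after the deletion of \<open>v\<close>.\<close>

lemma single_or_double:
  assumes v: "v \<in> V" and n: "3 \<le> card V"
  obtains (single) x where "x \<in> V" "x \<noteq> v" "card (between v x) = 1"
  | (double) x y where "x \<in> V" "y \<in> V" "x \<noteq> v" "y \<noteq> v" "x \<noteq> y"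
      "card (between v x) = 2" "card (between v y) = 2" "{e \<in> E. v \<in> en e} = between v x \<union> between v y"
proof -
  let ?D = "{e \<in> E. v \<in> en e}"
  have fin: "finite ?D" "finite (between v x)" for x using finE by auto
  have nbr: "other_end en v e \<in> V \<and> other_end en v e \<noteq> v \<and> e \<in> between v (other_end en v e)"
    if "e \<in> ?D" for e
    using that ends_other[of e v] ends_in[of e] by auto
  have "?D \<noteq> {}" using degree[OF v] by (metis card.empty zero_neq_numeral)
  then obtain e where e: "e \<in> ?D" by blast
  define x where "x = other_end en v e"
  have x: "x \<in> V" "x \<noteq> v" "e \<in> between v x" using nbr[OF e] by (auto simp: x_def)
  have sub: "between v u \<subseteq> ?D" for u by auto
  have cx: "card (between v x) \<noteq> 0" using x fin by auto
  show thesis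
  proof (cases "?D \<subseteq> between v x")
    case True
    then have eq: "between v x = ?D" using sub by blast
    have "between v x \<subseteq> {e \<in> E. x \<in> en e}" by auto
    then have eq2: "between v x = {e \<in> E. x \<in> en e}"
      using degree[OF v] degree[OF x(1)] eq finE by (intro card_subset_eq) auto
    have "V = {v, x}"
    proof (rule closed_subset)
      fix f u assume f: "f \<in> E" "u \<in> {v, x}" "u \<in> en f"
      then have "f \<in> between v x" using eq eq2 by blast
      then show "en f \<subseteq> {v, x}" by simp
    qed (use v x in auto)
    then have "card V \<le> 2" by (simp add: card_insert_if)
    then show ?thesis using n by simp
  next
    case False
    then obtain f where f: "f \<in> ?D" "f \<notin> between v x" by blast
    define y where "y = other_end en v f"
    have y: "y \<in> V" "y \<noteq> v" "f \<in> between v y" using nbr[OF f(1)] by (auto simp: y_def)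
    have xy: "x \<noteq> y" using f y by auto
    have disj: "between v x \<inter> between v y = {}" using xy x y by (auto simp: doubleton_eq_iff)
    have "card (between v x) + card (between v y) = card (between v x \<union> between v y)"
      using fin disj by (simp add: card_Un_disjoint)
    also have "\<dots> \<le> card ?D" using fin(1) by (intro card_mono) auto
    finally have le: "card (between v x) + card (between v y) \<le> 4" using degree[OF v] by simp
    have cy: "card (between v y) \<noteq> 0" using y fin by auto
    show ?thesis
    proof (cases "card (between v x) = 1 \<or> card (between v y) = 1")
      case True
      then show ?thesis using single x y by blast
    next
      case False
      then have c: "card (between v x) = 2" "card (between v y) = 2" using le cx cy by auto
      have "between v x \<union> between v y = ?D"
        using fin disj c degree[OF v] by (intro card_subset_eq) (auto simp: card_Un_disjoint)
      then show ?thesis using double[of x y] x y xy c by blast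
    qed
  qed
qed

lemma single_edge_structure:
  assumes v: "v \<in> V" and x: "x \<in> V" "x \<noteq> v" "card (between v x) = 1"
  obtains e1 e2 e3 A where "distinct [e1, e2, e3]" "e1 \<notin> A" "e2 \<notin> A" "e3 \<notin> A" "finite A"
    "{e \<in> E. v \<notin> en e} = {e1, e2, e3} \<union> A" "V - {v} = insert x (V - {v, x})"
    "\<forall>e\<in>{e1, e2, e3}. en e = {x, other_end en x e}"
    "\<forall>e\<in>{e1, e2, e3}. other_end en x e \<in> V - {v, x}"
    "\<forall>e\<in>A. \<exists>s\<in>V - {v, x}. \<exists>t\<in>V - {v, x}. en e = {s, t}"
    "card A + 3 = 2 * card (V - {v, x})" "A = {e \<in> E. v \<notin> en e \<and> x \<notin> en e}"
proof -
  let ?D = "{e \<in> E. x \<in> en e \<and> v \<notin> en e}" and ?A = "{e \<in> E. v \<notin> en e \<and> x \<notin> en e}" and ?W = "V - {v, x}"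
  have bt: "between v x = {e \<in> E. x \<in> en e \<and> v \<in> en e}"
    using both_ends[of _ v x] x by auto
  have "{e \<in> E. x \<in> en e} = ?D \<union> between v x" "?D \<inter> between v x = {}" by (auto simp: bt)
  then have "card ?D + card (between v x) = 4"
    using degree[OF x(1)] finE by (simp add: card_Un_disjoint)
  then have cD: "card ?D = 3" using x by simp
  then obtain e1 e2 e3 where D: "?D = {e1, e2, e3}" "distinct [e1, e2, e3]"
    by (auto simp: card_3_iff)
  have un: "{e \<in> E. v \<notin> en e} = {e1, e2, e3} \<union> ?A" unfolding D(1)[symmetric] by auto
  have "card {e \<in> E. v \<notin> en e} = card {e1, e2, e3} + card ?A"
    unfolding un using finE D(1) by (intro card_Un_disjoint) auto
  then have cA: "card ?A + 3 + 4 = 2 * card V" using card_avoiding[OF v] cD D(1) by simp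
  have "card ?W = card V - card {v, x}" using v x finV by (intro card_Diff_subset) auto
  moreover have "card {v, x} \<le> card V" using v x finV by (intro card_mono) auto
  ultimately have cW: "card ?W + 2 = card V" using x by simp
  have inD: "e \<in> E" "x \<in> en e" "v \<notin> en e" if "e \<in> {e1, e2, e3}" for e
    using that unfolding D(1)[symmetric] by auto
  have oe: "en e = {x, other_end en x e}" "other_end en x e \<noteq> x" if "e \<in> {e1, e2, e3}" for e
    using ends_other inD[OF that] by blast+
  have oW: "other_end en x e \<in> ?W" if "e \<in> {e1, e2, e3}" for e
    using oe[OF that] inD[OF that] ends_in[of e] by auto
  have Aends: "\<exists>s\<in>?W. \<exists>t\<in>?W. en e = {s, t}" if eA: "e \<in> ?A" for e
  proof -
    have e: "e \<in> E" "v \<notin> en e" "x \<notin> en e" using eA by auto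
    obtain s t where "en e = {s, t}" using two_ends[OF e(1)] by (auto simp: card_2_iff)
    then show ?thesis using e ends_in[OF e(1)] by auto
  qed
  have nA: "e1 \<notin> ?A" "e2 \<notin> ?A" "e3 \<notin> ?A" using inD by auto
  show thesis
  proof (rule that[OF D(2) nA _ un])
    show "\<forall>e\<in>{e1, e2, e3}. en e = {x, other_end en x e}" "\<forall>e\<in>{e1, e2, e3}. other_end en x e \<in> ?W"
      using oe oW by blast+
    show "\<forall>e\<in>?A. \<exists>s\<in>?W. \<exists>t\<in>?W. en e = {s, t}" using Aends by blast
    show "V - {v} = insert x ?W" using x by auto
    show "card ?A + 3 = 2 * card ?W" using cA cW by simp
  qed (use finE in auto)
qed

lemma zero_count_single:
  assumes v: "v \<in> V" and x: "x \<in> V" "x \<noteq> v" "card (between v x) = 1" and n: "5 \<le> card V"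
  shows "[zero_count (V - {v}) en {e \<in> E. v \<notin> en e} = tree_pairs_at V en E v] (mod 8)"
proof -
  obtain e1 e2 e3 A where S: "distinct [e1, e2, e3]" "e1 \<notin> A" "e2 \<notin> A" "e3 \<notin> A" "finite A"
    "{e \<in> E. v \<notin> en e} = {e1, e2, e3} \<union> A" "V - {v} = insert x (V - {v, x})"
    "\<forall>e\<in>{e1, e2, e3}. en e = {x, other_end en x e}"
    "\<forall>e\<in>{e1, e2, e3}. other_end en x e \<in> V - {v, x}"
    "\<forall>e\<in>A. \<exists>s\<in>V - {v, x}. \<exists>t\<in>V - {v, x}. en e = {s, t}"
    "card A + 3 = 2 * card (V - {v, x})" "A = {e \<in> E. v \<notin> en e \<and> x \<notin> en e}"
    by (rule single_edge_structure[OF v x]) (rule that; assumption)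
  have "3 \<le> card (V - {v, x})" using n v x finV card_Diff_subset[of "{v, x}" V] by simp
  then show ?thesis unfolding tree_pairs_at_def S(6,7)
    using finV S(1-5,8,9,11) S(10)[rule_format]
    by (intro zero_count_cubic[where a = "other_end en x"]) auto
qed

text \<open>Only one edge avoids both \<open>v\<close> and \<open>x\<close>, and it is the unique
  tree on the other two vertices. Thus \<open>f0\<close> in \<open>zero_count_cubic_aux\<close> is
  constantly 1, and the sum over the two sets \<open>Z\<close> is even.\<close>

lemma zero_count_single_4:
  assumes v: "v \<in> V" and x: "x \<in> V" "x \<noteq> v" "card (between v x) = 1" and n: "card V = 4"
  shows "[zero_count (V - {v}) en {e \<in> E. v \<notin> en e} = 0] (mod 8)"
proof -
  let ?W = "V - {v, x}"
  obtain e1 e2 e3 A where S: "distinct [e1, e2, e3]" "e1 \<notin> A" "e2 \<notin> A" "e3 \<notin> A" "finite A"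
    "{e \<in> E. v \<notin> en e} = {e1, e2, e3} \<union> A" "V - {v} = insert x ?W"
    "\<forall>e\<in>{e1, e2, e3}. en e = {x, other_end en x e}"
    "\<forall>e\<in>{e1, e2, e3}. other_end en x e \<in> ?W"
    "\<forall>e\<in>A. \<exists>s\<in>?W. \<exists>t\<in>?W. en e = {s, t}"
    "card A + 3 = 2 * card ?W" "A = {e \<in> E. v \<notin> en e \<and> x \<notin> en e}"
    by (rule single_edge_structure[OF v x]) (rule that; assumption)
  have cW: "card ?W = 2" using n v x finV card_Diff_subset[of "{v, x}" V] by simp
  then have "card A = 1" using S(11) by simp
  then obtain g where g: "A = {g}" by (auto simp: card_1_singleton_iff)
  have gE: "g \<in> E" using g S(12) by auto
  obtain s t where st: "s \<in> ?W" "t \<in> ?W" "en g = {s, t}" using S(10) g by blast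
  have "s \<noteq> t" using st two_ends[OF gE] by auto
  then have W: "?W = {s, t}" using st cW finV by (intro card_subset_eq[symmetric]) auto
  have "conn (en ` {g}) s t" using st by (intro conn_edge) auto
  then have "tree ?W en {g}" unfolding tree_def using cW W conn_sym by auto
  moreover have "\<not> tree ?W en {}" using cW by (simp add: tree_def)
  ultimately have X: "{T. T \<subseteq> A \<and> tree ?W en T} = {{g}}" using g by (auto simp: subset_singleton_iff)
  have f0: "card {T \<in> {T. T \<subseteq> A \<and> tree ?W en T}. Z \<subseteq> T} = 1" if "Z \<in> Pow A" for Z
  proof -
    have "{T \<in> {{g}}. Z \<subseteq> T} = {{g}}" using that g by auto
    then show ?thesis unfolding X by simp
  qed
  let ?h = "\<lambda>p q r Z. card {F \<in> split_forests ?W en A p q r. Z \<subseteq> F}"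
  let ?a = "other_end en x"
  let ?s = "\<lambda>Z. ?h (?a e1) (?a e2) (?a e3) Z + ?h (?a e2) (?a e1) (?a e3) Z + ?h (?a e3) (?a e1) (?a e2) Z"
  let ?f = "\<lambda>Z. card {T \<in> {T. T \<subseteq> A \<and> tree ?W en T}. Z \<subseteq> T}"
  have z: "[zero_count (insert x ?W) en ({e1, e2, e3} \<union> A) = 4 * (\<Sum>Z\<in>Pow A. ?f Z + (1 + ?f Z) * ?s Z)] (mod 8)"
    using finV S(1-5,8,9) S(10)[rule_format]
    by (intro zero_count_cubic_aux) auto
  have "(\<Sum>Z\<in>Pow A. ?f Z + (1 + ?f Z) * ?s Z) = (\<Sum>Z\<in>Pow A. 1 + (1 + 1) * ?s Z)"
    by (intro sum.cong refl) (simp only: f0)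
  moreover have "even (\<Sum>Z\<in>Pow A. 1 + (1 + 1) * k Z)" for k :: "'e set \<Rightarrow> nat"
    unfolding g by (simp add: sum_Pow_insert)
  ultimately have "even (\<Sum>Z\<in>Pow A. ?f Z + (1 + ?f Z) * ?s Z)" by (simp only:)
  then obtain k where "(\<Sum>Z\<in>Pow A. ?f Z + (1 + ?f Z) * ?s Z) = 2 * k" by (rule evenE)
  then have "[zero_count (insert x ?W) en ({e1, e2, e3} \<union> A) = 4 * (2 * k)] (mod 8)" using z by (simp only:)
  moreover have "[4 * (2 * k) = 0] (mod 8)" by (simp add: cong_0_iff)
  ultimately show ?thesis unfolding S(6,7) by (rule cong_trans)
qed

lemma double_edge_structure:
  assumes v: "v \<in> V" and x: "x \<in> V" "x \<noteq> v" "card (between v x) = 2"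
  obtains p p' A where "p \<noteq> p'" "{e \<in> E. x \<in> en e \<and> v \<notin> en e} = {p, p'}"
    "A = {e \<in> E. v \<notin> en e \<and> x \<notin> en e}" "{e \<in> E. v \<notin> en e} = {p, p'} \<union> A" "p \<notin> A" "p' \<notin> A" "finite A"
    "V - {v} = insert x (V - {v, x})" "en p = {x, other_end en x p}" "en p' = {x, other_end en x p'}"
    "other_end en x p \<in> V - {v, x}" "other_end en x p' \<in> V - {v, x}" "\<forall>e\<in>A. en e \<subseteq> V - {v, x}"
proof -
  let ?D = "{e \<in> E. x \<in> en e \<and> v \<notin> en e}" and ?A = "{e \<in> E. v \<notin> en e \<and> x \<notin> en e}"
  have bt: "between v x = {e \<in> E. x \<in> en e \<and> v \<in> en e}"
    using both_ends[of _ v x] x by auto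
  have "{e \<in> E. x \<in> en e} = ?D \<union> between v x" "?D \<inter> between v x = {}" by (auto simp: bt)
  then have "card ?D + card (between v x) = 4"
    using degree[OF x(1)] finE by (simp add: card_Un_disjoint)
  then have "card ?D = 2" using x by simp
  then obtain p p' where D: "?D = {p, p'}" "p \<noteq> p'" by (auto simp: card_2_iff)
  have inD: "e \<in> E" "x \<in> en e" "v \<notin> en e" if "e \<in> {p, p'}" for e
    using that unfolding D(1)[symmetric] by auto
  have oe: "en e = {x, other_end en x e}" "other_end en x e \<noteq> x" if "e \<in> {p, p'}" for e
    using ends_other inD[OF that] by blast+
  have oW: "other_end en x e \<in> V - {v, x}" if "e \<in> {p, p'}" for e
    using oe[OF that] inD[OF that] ends_in[of e] by auto
  show thesis
  proof (rule that[OF D(2) D(1) refl])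
    show "{e \<in> E. v \<notin> en e} = {p, p'} \<union> ?A" unfolding D(1)[symmetric] by auto
    show "p \<notin> ?A" "p' \<notin> ?A" using inD by auto
    show "V - {v} = insert x (V - {v, x})" using x by auto
    show "\<forall>e\<in>?A. en e \<subseteq> V - {v, x}" using ends_in by blast
  qed (use oe oW finE in auto)
qed

lemma double_toggle:
  assumes v: "v \<in> V" and x: "x \<in> V" "x \<noteq> v" "card (between v x) = 2" and Z: "Z \<subseteq> {e \<in> E. v \<notin> en e}"
  defines "D \<equiv> {e \<in> E. x \<in> en e \<and> v \<notin> en e}"
  shows "even (card (trees_above (V - {v}) en {e \<in> E. v \<notin> en e} Z)) \<longleftrightarrow>
    even (card (trees_above (V - {v}) en {e \<in> E. v \<notin> en e} ((Z - D) \<union> (D - Z))))"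
proof -
  obtain p p' A where S: "p \<noteq> p'" "{e \<in> E. x \<in> en e \<and> v \<notin> en e} = {p, p'}"
    "A = {e \<in> E. v \<notin> en e \<and> x \<notin> en e}" "{e \<in> E. v \<notin> en e} = {p, p'} \<union> A" "p \<notin> A" "p' \<notin> A" "finite A"
    "V - {v} = insert x (V - {v, x})" "en p = {x, other_end en x p}" "en p' = {x, other_end en x p'}"
    "other_end en x p \<in> V - {v, x}" "other_end en x p' \<in> V - {v, x}" "\<forall>e\<in>A. en e \<subseteq> V - {v, x}"
    by (rule double_edge_structure[OF v x]) (rule that; assumption)
  show ?thesis unfolding D_def S(2) unfolding S(4,8)
    using finV Z[unfolded S(4)] by (intro even_trees_above_toggle[OF _ _ S(7,1,5,6,9-12) S(13)[rule_format]]) auto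
qed

lemma double_tree_pairs:
  assumes v: "v \<in> V" and x: "x \<in> V" "x \<noteq> v" "card (between v x) = 2"
  shows "tree_pairs_at V en E v = 2 * tree_pairs (V - {v, x}) en {e \<in> E. v \<notin> en e \<and> x \<notin> en e}"
proof -
  obtain p p' A where S: "p \<noteq> p'" "{e \<in> E. x \<in> en e \<and> v \<notin> en e} = {p, p'}"
    "A = {e \<in> E. v \<notin> en e \<and> x \<notin> en e}" "{e \<in> E. v \<notin> en e} = {p, p'} \<union> A" "p \<notin> A" "p' \<notin> A" "finite A"
    "V - {v} = insert x (V - {v, x})" "en p = {x, other_end en x p}" "en p' = {x, other_end en x p'}"
    "other_end en x p \<in> V - {v, x}" "other_end en x p' \<in> V - {v, x}" "\<forall>e\<in>A. en e \<subseteq> V - {v, x}"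
    by (rule double_edge_structure[OF v x]) (rule that; assumption)
  show ?thesis unfolding tree_pairs_at_def S(4,8) S(3)[symmetric]
    using finV by (intro tree_pairs_degree_two[OF _ _ S(7,1,5,6,9-12) S(13)[rule_format]]) auto
qed

lemma double_card:
  assumes "v \<in> V" "x \<in> V" "x \<noteq> v" "card (between v x) = 2"
  shows "card {e \<in> E. x \<in> en e \<and> v \<notin> en e} = 2"
  by (rule double_edge_structure[OF assms]) simp

text \<open>Otherwise the two remaining edges at \<open>x\<close> and at \<open>y\<close> would be
  the same, and \<open>{v, x, y}\<close> would be a component with only three vertices. The edges
  \<open>p\<close> and \<open>q\<close> serve as the distinguished elements of the two
  flips.\<close>

lemma double_private_edges:
  assumes v: "v \<in> V" and x: "x \<in> V" "x \<noteq> v" "card (between v x) = 2"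
    and y: "y \<in> V" "y \<noteq> v" "card (between v y) = 2" "x \<noteq> y"
    and D: "{e \<in> E. v \<in> en e} = between v x \<union> between v y" and n: "4 \<le> card V"
  obtains p q where "p \<in> E" "x \<in> en p" "v \<notin> en p" "y \<notin> en p" "q \<in> E" "y \<in> en q" "v \<notin> en q" "x \<notin> en q"
proof -
  let ?X = "{e \<in> E. x \<in> en e \<and> v \<notin> en e}" and ?Y = "{e \<in> E. y \<in> en e \<and> v \<notin> en e}"
  have c: "card ?X = 2" "card ?Y = 2" using double_card v x y by auto
  have fin: "finite ?X" "finite ?Y" using finE by auto
  have "?X \<noteq> ?Y"
  proof
    assume eq: "?X = ?Y"
    have "V = {v, x, y}"
    proof (rule closed_subset)
      fix e u assume e: "e \<in> E" "u \<in> {v, x, y}" "u \<in> en e"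
      show "en e \<subseteq> {v, x, y}"
      proof (cases "v \<in> en e")
        case True
        then have "e \<in> between v x \<union> between v y" using D e(1) by blast
        then show ?thesis by auto
      next
        case False
        then have "e \<in> ?X \<or> e \<in> ?Y" using e by auto
        then have "x \<in> en e" "y \<in> en e" using eq by auto
        then have "en e = {x, y}" using both_ends e(1) y(4) by blast
        then show ?thesis by auto
      qed
    qed (use v x y in auto)
    then have "card V \<le> 3" by (simp add: card_insert_if)
    then show False using n by simp
  qed
  moreover have "?X = ?Y" if "?X \<subseteq> ?Y" using card_subset_eq[OF fin(2) that] c by simp
  moreover have "?X = ?Y" if "?Y \<subseteq> ?X" using card_subset_eq[OF fin(1) that] c by simp
  ultimately have "\<not> ?X \<subseteq> ?Y" "\<not> ?Y \<subseteq> ?X" by blast+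
  then obtain p q where "p \<in> ?X" "p \<notin> ?Y" "q \<in> ?Y" "q \<notin> ?X" by blast
  then show thesis using that[of p q] by blast
qed

lemma zero_count_double_aux:
  assumes v: "v \<in> V" and x: "x \<in> V" "x \<noteq> v" "card (between v x) = 2"
    and y: "y \<in> V" "y \<noteq> v" "card (between v y) = 2"
    and n: "4 \<le> card V"
    and p: "p \<in> E" "x \<in> en p" "v \<notin> en p" "y \<notin> en p" and q: "q \<in> E" "y \<in> en q" "v \<notin> en q" "x \<notin> en q"
  shows "[zero_count (V - {v}) en {e \<in> E. v \<notin> en e} =
    4 * card {T \<in> trees_above (V - {v}) en {e \<in> E. v \<notin> en e} {}. T \<subseteq> {p, q}}] (mod 8)"
proof (rule zero_count_two_toggles)
  let ?X = "{e \<in> E. x \<in> en e \<and> v \<notin> en e}" and ?Y = "{e \<in> E. y \<in> en e \<and> v \<notin> en e}"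
  show "?X \<subseteq> {e \<in> E. v \<notin> en e}" "?Y \<subseteq> {e \<in> E. v \<notin> en e}" by auto
  show "p \<in> ?X" "p \<notin> ?Y" "q \<in> ?Y" "q \<notin> ?X" using p q by auto
  show "{e \<in> E. v \<notin> en e} - {p, q} \<noteq> {}"
  proof
    assume "{e \<in> E. v \<notin> en e} - {p, q} = {}"
    then have "card {e \<in> E. v \<notin> en e} \<le> card {p, q}" by (intro card_mono) auto
    also have "\<dots> \<le> 2" by (simp add: card_insert_if)
    finally show False using card_avoiding[OF v] n by simp
  qed
  show "even (card (trees_above (V - {v}) en {e \<in> E. v \<notin> en e} Z)) \<longleftrightarrow>
    even (card (trees_above (V - {v}) en {e \<in> E. v \<notin> en e} ((Z - D) \<union> (D - Z))))"
    if "Z \<subseteq> {e \<in> E. v \<notin> en e}" "D \<in> {?X, ?Y}" for Z D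
    using that double_toggle[OF v x that(1)] double_toggle[OF v y that(1)] by blast
qed (use finE in auto)

text \<open>Both sides vanish modulo 8. A spanning tree of the graph without \<open>v\<close> has at
  least three edges and does not fit into \<open>{p, q}\<close>. In the number of tree pairs,
  \<open>x\<close> contributes a factor 2; then \<open>y\<close> either has one edge left, which
  gives 0, or two, which gives another 2, and exchanging the trees gives the third.\<close>

lemma zero_count_double:
  assumes v: "v \<in> V" and x: "x \<in> V" "x \<noteq> v" "card (between v x) = 2"
    and y: "y \<in> V" "y \<noteq> v" "card (between v y) = 2" "x \<noteq> y"
    and D: "{e \<in> E. v \<in> en e} = between v x \<union> between v y" and n: "5 \<le> card V"
  shows "[zero_count (V - {v}) en {e \<in> E. v \<notin> en e} = tree_pairs_at V en E v] (mod 8)"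
proof -
  have n4: "4 \<le> card V" using n by simp
  obtain p q where p: "p \<in> E" "x \<in> en p" "v \<notin> en p" "y \<notin> en p" and q: "q \<in> E" "y \<in> en q" "v \<notin> en q" "x \<notin> en q"
    by (rule double_private_edges[OF v x y D n4]) (rule that; assumption)
  let ?A = "{e \<in> E. v \<notin> en e \<and> x \<notin> en e}" and ?W = "V - {v, x}" and ?W2 = "V - {v, x, y}"
  have "\<not> T \<subseteq> {p, q}" if T: "T \<in> trees_above (V - {v}) en {e \<in> E. v \<notin> en e} {}" for T
  proof
    assume "T \<subseteq> {p, q}"
    then have "card T \<le> card {p, q}" by (intro card_mono) auto
    also have "\<dots> \<le> 2" by (simp add: card_insert_if)
    finally have "card T \<le> 2" .
    moreover have "card T + 1 = card V - 1" using T v finV by (simp add: trees_above_def tree_def)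
    ultimately show False using n by linarith
  qed
  then have e: "{T \<in> trees_above (V - {v}) en {e \<in> E. v \<notin> en e} {}. T \<subseteq> {p, q}} = {}" by blast
  have "[zero_count (V - {v}) en {e \<in> E. v \<notin> en e} = 0] (mod 8)"
    using zero_count_double_aux[OF v x y(1-3) n4 p q] unfolding e by simp
  moreover have "[tree_pairs_at V en E v = 0] (mod 8)"
  proof -
    let ?Y = "{e \<in> E. y \<in> en e \<and> v \<notin> en e}" and ?A2 = "{e \<in> E. v \<notin> en e \<and> x \<notin> en e \<and> y \<notin> en e}"
    define Yx where "Yx = {e \<in> ?Y. x \<notin> en e}"
    have A: "?A = Yx \<union> ?A2" by (auto simp: Yx_def)
    have W: "?W = insert y ?W2" using y by auto
    have W2: "?W2 \<noteq> {}"
    proof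
      assume "?W2 = {}"
      then have "card V \<le> card {v, x, y}" by (intro card_mono) auto
      also have "\<dots> \<le> 3" by (simp add: card_insert_if)
      finally show False using n by simp
    qed
    have A2W: "en e \<subseteq> ?W2" if "e \<in> ?A2" for e using that ends_in[of e] by auto
    have Yxe: "en e = {y, other_end en y e}" "other_end en y e \<in> ?W2" if "e \<in> Yx" for e
    proof -
      have eE: "e \<in> E" "y \<in> en e" "v \<notin> en e" "x \<notin> en e" using that by (auto simp: Yx_def)
      show oe: "en e = {y, other_end en y e}" using ends_other eE by blast
      have "other_end en y e \<noteq> y" using ends_other eE by blast
      then show "other_end en y e \<in> ?W2" using oe eE ends_in[of e] by auto
    qed
    have "q \<in> Yx" using q by (auto simp: Yx_def)
    moreover have "card Yx \<le> 2"
      using double_card[OF v y(1-3)] card_mono[of ?Y Yx] finE by (auto simp: Yx_def)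
    moreover have finYx: "finite Yx" using finE by (auto simp: Yx_def)
    ultimately have "card Yx = 1 \<or> card Yx = 2" by (metis One_nat_def card_0_eq empty_iff le_Suc_eq le_zero_eq numeral_2_eq_2)
    then have "[tree_pairs ?W en ?A = 0] (mod 4)"
    proof
      assume "card Yx = 1"
      then have Yx: "Yx = {q}" using \<open>q \<in> Yx\<close> by (auto simp: card_1_singleton_iff)
      have "tree_pairs (insert y ?W2) en ({q} \<union> ?A2) = 0"
        using finV finE W2 A2W q Yxe(1)[OF \<open>q \<in> Yx\<close>] by (intro tree_pairs_degree_one) auto
      then show ?thesis unfolding A W Yx by simp
    next
      assume "card Yx = 2"
      then obtain r s where Yx: "Yx = {r, s}" "r \<noteq> s" by (auto simp: card_2_iff)
      have rs: "r \<in> Yx" "s \<in> Yx" using Yx by auto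
      have "tree_pairs (insert y ?W2) en ({r, s} \<union> ?A2) = 2 * tree_pairs ?W2 en ?A2"
        using finV finE A2W Yx(2) Yxe[OF rs(1)] Yxe[OF rs(2)] rs
        by (intro tree_pairs_degree_two[where a = "other_end en y"]) (auto simp: Yx_def)
      moreover have "even (tree_pairs ?W2 en ?A2)"
      proof (rule tree_pairs_even)
        have "{e \<in> E. v \<notin> en e} \<subseteq> {e \<in> E. x \<in> en e \<and> v \<notin> en e} \<union> ?Y \<union> ?A2" by auto
        then have "card {e \<in> E. v \<notin> en e} \<le> card ({e \<in> E. x \<in> en e \<and> v \<notin> en e} \<union> ?Y \<union> ?A2)"
          using finE by (intro card_mono) auto
        also have "\<dots> \<le> card {e \<in> E. x \<in> en e \<and> v \<notin> en e} + card ?Y + card ?A2"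
          by (meson add_right_mono card_Un_le le_trans)
        finally have "2 * card V \<le> 4 + 4 + card ?A2"
          using card_avoiding[OF v] double_card[OF v x] double_card[OF v y(1-3)] by simp
        then have "card ?A2 \<noteq> 0" using n by simp
        then show "?A2 \<noteq> {}" by (metis card.empty)
      qed (use finE in auto)
      ultimately show ?thesis unfolding A W Yx(1) by (auto simp: cong_0_iff elim!: evenE)
    qed
    then have "[2 * tree_pairs ?W en ?A = 2 * 0] (mod (2 * 4))" by (rule cong_cmult_leftI)
    then show ?thesis unfolding double_tree_pairs[OF v x] by simp
  qed
  ultimately show ?thesis by (meson cong_sym cong_trans)
qed

text \<open>All edges avoiding \<open>v\<close> meet the fourth vertex \<open>z\<close>, so
  \<open>p\<close> and \<open>q\<close> join \<open>x\<close> and \<open>y\<close> to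
  \<open>z\<close>. Hence \<open>{p, q}\<close> is the one tree counted by
  \<open>zero_count_double_aux\<close>.\<close>

lemma zero_count_double_4:
  assumes v: "v \<in> V" and x: "x \<in> V" "x \<noteq> v" "card (between v x) = 2"
    and y: "y \<in> V" "y \<noteq> v" "card (between v y) = 2" "x \<noteq> y"
    and D: "{e \<in> E. v \<in> en e} = between v x \<union> between v y" and n: "card V = 4"
  shows "[zero_count (V - {v}) en {e \<in> E. v \<notin> en e} = 4] (mod 8)"
proof -
  have n4: "4 \<le> card V" using n by simp
  obtain p q where p: "p \<in> E" "x \<in> en p" "v \<notin> en p" "y \<notin> en p" and q: "q \<in> E" "y \<in> en q" "v \<notin> en q" "x \<notin> en q"
    by (rule double_private_edges[OF v x y D n4]) (rule that; assumption)
  have "card (V - {v, x, y}) = 1"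
    using v x y finV n by (subst card_Diff_subset) auto
  then obtain z where z: "V - {v, x, y} = {z}" by (auto simp: card_1_singleton_iff)
  then have zV: "z \<in> V" "z \<noteq> v" "z \<noteq> x" "z \<noteq> y" by auto
  have Vz: "V - {v} = {x, y, z}" using z x y by auto
  have "{e \<in> E. z \<in> en e} \<subseteq> {e \<in> E. v \<notin> en e}"
  proof (rule subsetI)
    fix e assume e: "e \<in> {e \<in> E. z \<in> en e}"
    have "v \<notin> en e"
    proof
      assume "v \<in> en e"
      then have "e \<in> between v x \<union> between v y" using D e by blast
      then show False using e zV by auto
    qed
    then show "e \<in> {e \<in> E. v \<notin> en e}" using e by simp
  qed
  moreover have "card {e \<in> E. v \<notin> en e} = 4" using card_avoiding[OF v] n by simp
  ultimately have "{e \<in> E. z \<in> en e} = {e \<in> E. v \<notin> en e}"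
    using finE degree[OF zV(1)] by (intro card_subset_eq) auto
  then have zpq: "z \<in> en p" "z \<in> en q" using p q by blast+
  have enp: "en p = {x, z}" "en q = {y, z}" using both_ends p q zpq zV by blast+
  have "p \<noteq> q" using p q by auto
  have "conn (en ` {p, q}) x z" "conn (en ` {p, q}) y z" using enp by (auto intro!: conn_edge)
  then have "tree (V - {v}) en {p, q}"
    unfolding Vz using \<open>p \<noteq> q\<close> zV y(4) by (subst tree_iff_rooted_forest[of z]) (auto simp: rooted_forest_def covers_def)
  moreover have "T = {p, q}" if "tree (V - {v}) en T" "T \<subseteq> {p, q}" for T
    using that \<open>p \<noteq> q\<close> v finV n by (intro card_subset_eq) (auto simp: tree_def)
  ultimately have "{T \<in> trees_above (V - {v}) en {e \<in> E. v \<notin> en e} {}. T \<subseteq> {p, q}} = {{p, q}}"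
    using p q by (auto simp: trees_above_def)
  then show ?thesis using zero_count_double_aux[OF v x y(1-3) n4 p q] by simp
qed

text \<open>On four vertices a single edge between \<open>v\<close> and \<open>x\<close> forces a
  single edge between the other two vertices, so the case distinction comes out alike at every
  vertex.\<close>

lemma single_everywhere_4:
  assumes v: "v \<in> V" and x: "x \<in> V" "x \<noteq> v" "card (between v x) = 1" and n: "card V = 4" and w: "w \<in> V"
  shows "\<exists>u\<in>V. u \<noteq> w \<and> card (between w u) = 1"
proof -
  let ?W = "V - {v, x}"
  obtain A where S: "\<forall>e\<in>A. \<exists>s\<in>?W. \<exists>t\<in>?W. en e = {s, t}"
    "card A + 3 = 2 * card ?W" "A = {e \<in> E. v \<notin> en e \<and> x \<notin> en e}"
    by (rule single_edge_structure[OF v x]) (rule that; assumption)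
  have cW: "card ?W = 2" using n v x finV card_Diff_subset[of "{v, x}" V] by simp
  then obtain s t where st: "?W = {s, t}" "s \<noteq> t" by (auto simp: card_2_iff)
  have "between s t = A"
  proof (intro equalityI subsetI)
    fix e assume "e \<in> between s t"
    then show "e \<in> A" using st unfolding S(3) by auto
  next
    fix e assume "e \<in> A"
    then obtain a b where ab: "a \<in> {s, t}" "b \<in> {s, t}" "en e = {a, b}" "e \<in> E" using S(1,3) st by blast
    have "a \<noteq> b" using two_ends[OF ab(4)] ab(3) by auto
    then show "e \<in> between s t" using ab by auto
  qed
  moreover have "card A = 1" using S(2) cW by simp
  ultimately have cst: "card (between s t) = 1" by simp
  have comm: "between a b = between b a" for a b by (auto simp: insert_commute)
  have stV: "s \<in> V" "t \<in> V" using st by auto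
  have c: "card (between x v) = 1" "card (between t s) = 1" unfolding comm[of x v] comm[of t s] using x cst by auto
  consider "w = v" | "w = x" | "w = s" | "w = t" using w st by blast
  then show ?thesis
  proof cases
    case 1
    then show ?thesis using x by blast
  next
    case 2
    then show ?thesis using v x(2) c(1) by (intro bexI[of _ v]) auto
  next
    case 3
    then show ?thesis using stV st(2) cst by (intro bexI[of _ t]) auto
  next
    case 4
    then show ?thesis using stV st(2) c(2) by blast
  qed
qed

text \<open>At most two edges avoid \<open>v\<close>, hence there are at most 4 points. With three
  vertices, the point that vanishes exactly at one of the two edges is not a zero, because that edge
  is the only tree containing itself.\<close>

lemma zero_count_small:
  assumes v: "v \<in> V" and n: "card V \<le> 3"
  shows "zero_count (V - {v}) en {e \<in> E. v \<notin> en e} < 4"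
proof -
  let ?E = "{e \<in> E. v \<notin> en e}" and ?N = "\<lambda>Z. card (trees_above (V - {v}) en {e \<in> E. v \<notin> en e} Z)"
  have fin: "finite ?E" using finE by auto
  have z: "zero_count (V - {v}) en ?E = card {Z \<in> Pow ?E. even (?N Z)}"
    unfolding zero_count_def using fin by (simp add: Int_def)
  have cE: "card ?E + 4 = 2 * card V" by (rule card_avoiding[OF v])
  show ?thesis
  proof (cases "card V = 3")
    case False
    then have "card ?E = 0" using cE n by linarith
    then have "?E = {}" using fin by simp
    then have "{Z \<in> Pow ?E. even (?N Z)} \<subseteq> {{}}" by blast
    then have "card {Z \<in> Pow ?E. even (?N Z)} \<le> card {{} :: 'e set}" by (intro card_mono) auto
    then show ?thesis unfolding z by simp
  next
    case True
    then have c2: "card ?E = 2" using cE by simp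
    then have "?E \<noteq> {}" by (metis card.empty zero_neq_numeral)
    then obtain g where g: "g \<in> E" "v \<notin> en g" by blast
    have cV: "card (V - {v}) = 2" using True v finV by simp
    have Vg: "V - {v} = en g"
      using g ends_in[OF g(1)] two_ends[OF g(1)] cV finV by (intro card_subset_eq[symmetric]) auto
    have "\<exists>s t. en g = {s, t}" using two_ends[OF g(1)] by (auto simp: card_2_iff)
    then obtain s t where st: "en g = {s, t}" by blast
    have "conn (en ` {g}) s t" using st by (intro conn_edge) auto
    then have tg: "tree (V - {v}) en {g}" unfolding tree_def using cV Vg st conn_sym by auto
    have only: "T = {g}" if "tree (V - {v}) en T" "g \<in> T" for T
    proof -
      have "card T = 1" using that cV by (simp add: tree_def)
      then show ?thesis using that by (auto simp: card_1_singleton_iff)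
    qed
    have "trees_above (V - {v}) en ?E {g} = {{g}}"
    proof (intro equalityI subsetI)
      fix T assume "T \<in> trees_above (V - {v}) en ?E {g}"
      then have "tree (V - {v}) en T" "g \<in> T" by (auto simp: trees_above_def)
      then have "T = {g}" by (rule only)
      then show "T \<in> {{g}}" by simp
    qed (use tg g in \<open>simp add: trees_above_def\<close>)
    then have "odd (?N {g})" by simp
    then have "{Z \<in> Pow ?E. even (?N Z)} \<subset> Pow ?E" using g by auto
    then have "card {Z \<in> Pow ?E. even (?N Z)} < card (Pow ?E)" using fin by (intro psubset_card_mono) auto
    then show ?thesis using c2 fin z by (simp add: card_Pow)
  qed
qed

lemma zero_count_5:
  assumes "v \<in> V" "5 \<le> card V"
  shows "[zero_count (V - {v}) en {e \<in> E. v \<notin> en e} = tree_pairs_at V en E v] (mod 8)"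
proof -
  have "3 \<le> card V" using assms by simp
  with assms(1) show ?thesis
  proof (cases rule: single_or_double)
    case (single x)
    then show ?thesis using zero_count_single assms by blast
  next
    case (double x y)
    then show ?thesis using zero_count_double assms by blast
  qed
qed

theorem zero_count_invariant:
  assumes v: "v \<in> V" and w: "w \<in> V"
  shows "(zero_count (V - {v}) en {e \<in> E. v \<notin> en e} div 4) mod 2 =
    (zero_count (V - {w}) en {e \<in> E. w \<notin> en e} div 4) mod 2" (is "(?z v div 4) mod 2 = (?z w div 4) mod 2")
proof -
  have mod8: "(m div 4) mod 2 = (k div 4) mod 2" if "[m = k] (mod 8)" for m k :: nat
    using that unfolding cong_def by presburger
  consider "card V \<le> 3" | "card V = 4" | "5 \<le> card V" by linarith
  then show ?thesis
  proof cases
    case 1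
    then show ?thesis using zero_count_small[OF v] zero_count_small[OF w] by simp
  next
    case 2
    then have n3: "3 \<le> card V" by simp
    have z: "[?z u = (if \<exists>x\<in>V. x \<noteq> u \<and> card (between u x) = 1 then 0 else 4)] (mod 8)" if u: "u \<in> V" for u
    proof (cases "\<exists>x\<in>V. x \<noteq> u \<and> card (between u x) = 1")
      case True
      then obtain x where "x \<in> V" "x \<noteq> u" "card (between u x) = 1" by blast
      then have "[?z u = 0] (mod 8)" using zero_count_single_4 u 2 by blast
      then show ?thesis using True by simp
    next
      case False
      have "[?z u = 4] (mod 8)"
        using u n3
      proof (cases rule: single_or_double)
        case (single x)
        then show ?thesis using False by blast
      next
        case (double x y)
        then show ?thesis using zero_count_double_4 u 2 by blast
      qed
      then show ?thesis by (simp only: False if_False)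
    qed
    have same: "(\<exists>x\<in>V. x \<noteq> v \<and> card (between v x) = 1) \<longleftrightarrow> (\<exists>x\<in>V. x \<noteq> w \<and> card (between w x) = 1)"
      using single_everywhere_4 v w 2 by blast
    have "[?z v = ?z w] (mod 8)" using z[OF v] cong_sym[OF z[OF w]] unfolding same by (rule cong_trans)
    then show ?thesis by (rule mod8)
  next
    case 3
    have "[?z v = ?z w] (mod 8)"
      using zero_count_5[OF v 3] cong_sym[OF zero_count_5[OF w 3]]
      unfolding tree_pairs_at_eq[OF quartic v w] by (rule cong_trans)
    then show ?thesis by (rule mod8)
  qed
qed

end

theorem theorem6p1:
  fixes G :: "('v, 'e) mgraph" and v w :: 'v
  assumes "multigraph G" and "connected_graph G" and "regular_graph 4 G"
    and "v \<in> vertices G" and "w \<in> vertices G"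
  shows "c2_invariant 2 (delete_vertex G v) = c2_invariant 2 (delete_vertex G w)"
proof -
  let ?V = "vertices G" and ?en = "ends G" and ?E = "edges G"
  have fin: "finite ?V" "finite ?E" and sub: "\<And>e. e \<in> ?E \<Longrightarrow> ?en e \<subseteq> ?V"
    and two: "\<And>e. e \<in> ?E \<Longrightarrow> card (?en e) = 2"
    using assms(1) by (auto simp: multigraph_def)
  have deg: "card {e \<in> ?E. u \<in> ?en e} = 4" if "u \<in> ?V" for u
    using assms(3) that by (simp add: regular_graph_def vertex_degree_def)
  have sum4: "(\<Sum>e\<in>?E. of_bool (u \<in> ?en e)) = (4::nat)" if "u \<in> ?V" for u
    using deg[OF that] fin by (simp add: Int_def)
  \<comment> \<open>Counting incidences in two ways yields the edge count required by
    \<open>quartic\<close>.\<close>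
  have "(\<Sum>u\<in>?V. \<Sum>e\<in>?E. of_bool (u \<in> ?en e)) = (\<Sum>e\<in>?E. \<Sum>u\<in>?V. of_bool (u \<in> ?en e) :: nat)"
    by (rule sum.swap)
  moreover have "(\<Sum>u\<in>?V. of_bool (u \<in> ?en e)) = (2::nat)" if "e \<in> ?E" for e
  proof -
    have "?V \<inter> {u. u \<in> ?en e} = ?en e" using sub[OF that] by auto
    then show ?thesis using fin two[OF that] by simp
  qed
  ultimately have card: "card ?E = 2 * card ?V" using sum4 by simp
  have "quartic ?V ?en ?E"
    unfolding quartic_def
  proof (intro conjI ballI)
    show "\<exists>p\<in>?V. \<exists>q\<in>?V. ?en e = {p, q}" if e: "e \<in> ?E" for e
    proof -
      obtain p q where "?en e = {p, q}" using two[OF e] by (auto simp: card_2_iff)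
      then show ?thesis using sub[OF e] by auto
    qed
    show "(\<Sum>e\<in>?E. of_bool (u \<in> ?en e) + of_bool (?en e = {u})) = (4::nat)" if u: "u \<in> ?V" for u
    proof -
      have "?en e \<noteq> {u}" if "e \<in> ?E" for e using two[OF that] by auto
      then have "(\<Sum>e\<in>?E. of_bool (u \<in> ?en e) + of_bool (?en e = {u})) = (\<Sum>e\<in>?E. of_bool (u \<in> ?en e) :: nat)"
        by (intro sum.cong) auto
      then show ?thesis using sum4[OF u] by simp
    qed
  qed (use fin card in auto)
  moreover have "conn (?en ` ?E) a b" if "a \<in> ?V" "b \<in> ?V" for a b
  proof -
    have "adjacency G = link (?en ` ?E)" by (auto simp: adjacency_def link_def image_iff)
    then show ?thesis using assms(2) that by (simp add: connected_graph_def conn_def)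
  qed
  ultimately interpret quartic_graph ?V ?en ?E using two by unfold_locales auto
  have c2: "c2_invariant 2 (delete_vertex G u) =
    (zero_count (?V - {u}) ?en {e \<in> ?E. u \<notin> ?en e} div 4) mod 2" for u
  proof -
    have "multigraph (delete_vertex G u)"
      using assms(1) by (auto simp: multigraph_def delete_vertex_def)
    then show ?thesis
      by (simp add: c2_invariant_def card_kirchhoff_zeros_2) (simp add: delete_vertex_def)
  qed
  show ?thesis unfolding c2 by (rule zero_count_invariant[OF assms(4,5)])
qed

end
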